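(* Let $M$ be an $n$-dimensional differentiable manifold, $\gamma:J\to M$ a $C^1$ path and $g$ a $C^1$ metric which in a $C^1$ basis $\{E_i|_{\gamma(s)}\}$ along $\gamma$ is represented by the matrix $G(x)$, $x=\gamma(s)\in\gamma(J)$, whose signature does not depend on the point $x$. Let $D(x)$ be an orthogonal matrix ($D^T=D^{-1}$) such that $$D^{T}(x)G(x)D(x)=\tilde G(x):=\mathrm{diag}(g_1(x),\dots,g_n(x)),$$ where $g_i(x)\ne0$, $i=1,\dots,n$, are the eigenvalues of $G(x)$, and put $$K(\gamma(s)):=D^{T}(\gamma(s))\,\frac{dG(\gamma(s))}{ds}\,D(\gamma(s))=K^{T}(\gamma(s)),\qquad s\in J.$$ Then in the considered basis the coefficient matrices $\Gamma_\gamma(s)$ of all $S$-transports consistent with $g$ along $\gamma$ are those of the form $$\Gamma_\gamma(s)=D(x)\bigl[P(x)+Q(x)\tilde G(x)+R(x)\bigr]D^{T}(x)=D(x)\bigl[P(x)+R(x)\bigr]D^{T}(x)+D(x)Q(x)D^{T}(x)G(x),$$ $x=\gamma(s)$, $s\in J$, where the matrices $P,Q,R$ satisfy $P^{T}=P$, $Q^{T}=-Q$, $R^{T}=-R$, and their components satisfy $$Q_{ij}(x)=0,\quad R_{ij}(x)=\frac{K_{ij}(x)}{2g_i(x)}\qquad\text{for } g_i(x)+g_j(x)=0,$$ $$P_{ij}(x)=\frac{K_{ij}(x)}{g_i(x)+g_j(x)},\quad R_{ij}(x)=0\qquad\text{for } g_i(x)+g_j(x)\neq0,$$ the remaining components being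 arbitrary subject to the stated symmetries. (For $S$-transports globally consistent with $g$ the same holds along every path $\gamma$.)
   Context: A metric on $M$ is a symmetric nondegenerate tensor field $g$ of type $(0,2)$; its matrix is $G(\gamma(s))=[g_{\gamma(s)}(E_i,E_j)]_{ij}$. Quantities written with argument $x=\gamma(s)$ (such as $K,P,Q,R$) are to be understood as functions of the parameter $s\in J$. An $S$-transport along $\gamma$ assigns to each $s,t\in J$ a map $S^\gamma_{s\to t}$ from the tensor algebra at $\gamma(s)$ to the tensor algebra at $\gamma(t)$ which is linear, preserves the type of tensors, satisfies $S^\gamma_{s\to t}(A\otimes B)=(S^\gamma_{s\to t}A)\otimes(S^\gamma_{s\to t}B)$, commutes with contractions, is the identity on scalars, and satisfies $S^\gamma_{t\to r}\circ S^\gamma_{s\to t}=S^\gamma_{s\to r}$, $S^\gamma_{s\to s}=\mathrm{id}$; it is $C^1$ in its parameters $s,t$. The coefficient matrix $\Gamma_\gamma(s)=[\Gamma^{i}_{\;j}(s;\gamma)]$ is defined by $\lim_{\varepsilon\to0}\frac1\varepsilon\bigl(S^\gamma_{s+\varepsilon\to s}E_j|_{\gamma(s+\varepsilon)}-E_j|_{\gamma(s)}\bigr)=\sum_i\Gamma^{i}_{\;j}(s;\gamma)E_i|_{\gamma(s)}$. It is continuous in $s$, and $S$-transports along $\gamma$ correspond bijectively to continuous matrix functions $\Gamma_\gamma$ on $J$: the matrix $H(t,s)$ of $S^\gamma_{s\to t}$ on vectors ($S^\gamma_{s\to t}E_j|_{\gamma(s)}=\sum_iH^i_{\;j}(t,s)E_i|_{\gamma(t)}$)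 solves $\frac{\partial}{\partial t}H(t,s)=-\Gamma_\gamma(t)H(t,s)$, $H(s,s)=\mathbb{1}$. Thus the claim concerns continuous $\Gamma_\gamma$: such a $\Gamma_\gamma$ gives a consistent transport if and only if for each $s\in J$ it has the stated form for some $P,Q,R$ as described. $g$ and $S^\gamma$ are consistent along $\gamma$ if $g_{\gamma(s)}(A_0,B_0)=g_{\gamma(t)}(S^\gamma_{s\to t}A_0,S^\gamma_{s\to t}B_0)$ for all $s,t\in J$, $A_0,B_0\in T_{\gamma(s)}(M)$; globally consistent means consistent along every $C^1$ path. *)

theory Defs
  imports "HOL-Analysis.Analysis" "HOL-Library.Function_Algebras"
begin

section \<open>Pointwise real vector space structure on functions\<close>

instantiation "fun" :: (type, real_vector) real_vector
begin

definition scaleR_fun :: "real \<Rightarrow> ('a \<Rightarrow> 'b) \<Rightarrow> 'a \<Rightarrow> 'b"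
  where "scaleR_fun a f = (\<lambda>x. a *\<^sub>R f x)"

instance
  by standard (simp_all add: scaleR_fun_def fun_eq_iff algebra_simps)

end

text \<open>Linearity of a map on a subspace; nothing is required outside of \<open>V\<close>.\<close>

definition linear_on :: "'a::real_vector set \<Rightarrow> ('a \<Rightarrow> 'b::real_vector) \<Rightarrow> bool"
  where "linear_on V f \<longleftrightarrow>
    (\<forall>x\<in>V. \<forall>y\<in>V. f (x + y) = f x + f y) \<and> (\<forall>a. \<forall>x\<in>V. f (a *\<^sub>R x) = a *\<^sub>R f x)"


section \<open>Differentiability classes\<close>

text \<open>
  Derivatives are taken within the set, so that at the end points of an interval they are
  one-sided; on open sets this is the usual notion. The library's \<open>C1_differentiable_on\<close>
  uses two-sided derivatives and is restricted to functions of one real variable.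
\<close>

definition C1_on :: "'a::real_normed_vector set \<Rightarrow> ('a \<Rightarrow> 'b::real_normed_vector) \<Rightarrow> bool"
  where "C1_on S f \<longleftrightarrow> (\<exists>f' :: 'a \<Rightarrow> 'a \<Rightarrow>\<^sub>L 'b.
    (\<forall>x\<in>S. (f has_derivative blinfun_apply (f' x)) (at x within S)) \<and> continuous_on S f')"

definition C2_on :: "'a::real_normed_vector set \<Rightarrow> ('a \<Rightarrow> 'b::real_normed_vector) \<Rightarrow> bool"
  where "C2_on S f \<longleftrightarrow> (\<exists>f' :: 'a \<Rightarrow> 'a \<Rightarrow>\<^sub>L 'b.
    (\<forall>x\<in>S. (f has_derivative blinfun_apply (f' x)) (at x within S)) \<and> C1_on S f')"


section \<open>Manifolds\<close>

text \<open>
  A chart is a pair of its domain and its coordinate map (whose values outside of the domain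
  are irrelevant). The manifold is the whole type \<open>'m\<close>, its dimension is \<open>CARD('n)\<close>.
  Class \<open>C\<^sup>2\<close> is the least regularity for which \<open>C\<^sup>1\<close> tensor fields make sense; the
  atlas need not be maximal.
\<close>

type_synonym ('m, 'n) chart = "'m set \<times> ('m \<Rightarrow> real ^ 'n)"

definition chart_change :: "('m, 'n) chart \<Rightarrow> ('m, 'n) chart \<Rightarrow> real ^ 'n \<Rightarrow> real ^ 'n"
  where "chart_change c c' = (\<lambda>x. snd c' (inv_into (fst c) (snd c) x))"

definition c2_atlas ::
  "('m::{t2_space, second_countable_topology}, 'n::finite) chart set \<Rightarrow> bool"
  where "c2_atlas A \<longleftrightarrow>
    (\<Union>c\<in>A. fst c) = UNIV \<and>
    (\<forall>c\<in>A. open (fst c) \<and> open (snd c ` fst c) \<and>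
      homeomorphism (fst c) (snd c ` fst c) (snd c) (inv_into (fst c) (snd c))) \<and>
    (\<forall>c\<in>A. \<forall>c'\<in>A. C2_on (snd c ` (fst c \<inter> fst c')) (chart_change c c'))"


section \<open>Tangent vectors and tensors\<close>

text \<open>
  A tangent vector at \<open>p\<close> is the family of its component vectors in all charts around \<open>p\<close>,
  related by the Jacobian matrices of the chart changes.
\<close>

type_synonym ('m, 'n) tvec = "('m, 'n) chart \<Rightarrow> real ^ 'n"
type_synonym ('m, 'n) covec = "('m, 'n) tvec \<Rightarrow> real"
type_synonym ('m, 'n) tensor = "('m, 'n) covec list \<Rightarrow> ('m, 'n) tvec list \<Rightarrow> real"

definition tangent_space ::
  "('m, 'n::finite) chart set \<Rightarrow> 'm \<Rightarrow> ('m, 'n) tvec set"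
  where "tangent_space A p = {v.
    (\<forall>c\<in>A. \<forall>c'\<in>A. p \<in> fst c \<longrightarrow> p \<in> fst c' \<longrightarrow>
      v c' = frechet_derivative (chart_change c c') (at (snd c p)) (v c)) \<and>
    (\<forall>c. \<not> (c \<in> A \<and> p \<in> fst c) \<longrightarrow> v c = 0)}"

definition cotangent_space ::
  "('m, 'n::finite) chart set \<Rightarrow> 'm \<Rightarrow> ('m, 'n) covec set"
  where "cotangent_space A p = {\<omega>.
    linear_on (tangent_space A p) \<omega> \<and> (\<forall>v. v \<notin> tangent_space A p \<longrightarrow> \<omega> v = 0)}"

text \<open>
  Tensors of type \<open>(r,q)\<close> at \<open>p\<close> are the multilinear functions of \<open>r\<close> covectors and \<open>q\<close>
  vectors at \<open>p\<close>, extended by zero to all pairs of lists. Since lists of all lengths are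
  admissible arguments, the direct sum of these spaces, i.e. the tensor algebra at \<open>p\<close>,
  is their linear span.
\<close>

definition tensors ::
  "('m, 'n::finite) chart set \<Rightarrow> 'm \<Rightarrow> nat \<Rightarrow> nat \<Rightarrow> ('m, 'n) tensor set"
  where "tensors A p r q = {T.
    (\<forall>\<omega>s vs. \<not> (length \<omega>s = r \<and> set \<omega>s \<subseteq> cotangent_space A p \<and>
                length vs = q \<and> set vs \<subseteq> tangent_space A p) \<longrightarrow> T \<omega>s vs = 0) \<and>
    (\<forall>\<omega>s vs. length \<omega>s = r \<longrightarrow> set \<omega>s \<subseteq> cotangent_space A p \<longrightarrow>
             length vs = q \<longrightarrow> set vs \<subseteq> tangent_space A p \<longrightarrow>
       (\<forall>i<r. linear_on (cotangent_space A p) (\<lambda>\<omega>. T (\<omega>s[i := \<omega>]) vs)) \<and>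
       (\<forall>j<q. linear_on (tangent_space A p) (\<lambda>v. T \<omega>s (vs[j := v]))))}"

definition tensor_algebra ::
  "('m, 'n::finite) chart set \<Rightarrow> 'm \<Rightarrow> ('m, 'n) tensor set"
  where "tensor_algebra A p = span (\<Union>r q. tensors A p r q)"

definition scalar_tensor :: "real \<Rightarrow> ('m, 'n) tensor"
  where "scalar_tensor a = (\<lambda>\<omega>s vs. if \<omega>s = [] \<and> vs = [] then a else 0)"

text \<open>The tensor of type \<open>(1,0)\<close> corresponding to a tangent vector.\<close>

definition vec_tensor ::
  "('m, 'n::finite) chart set \<Rightarrow> 'm \<Rightarrow> ('m, 'n) tvec \<Rightarrow> ('m, 'n) tensor"
  where "vec_tensor A p v = (\<lambda>\<omega>s vs.
    if vs = [] \<and> (\<exists>\<omega>\<in>cotangent_space A p. \<omega>s = [\<omega>]) then hd \<omega>s v else 0)"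

text \<open>
  For \<open>S\<close> and \<open>T\<close> of types \<open>(r,q)\<close> and \<open>(r',q')\<close>, only the summand \<open>k = r\<close>, \<open>l = q\<close> is
  nonzero, and this on lists of lengths \<open>r + r'\<close> and \<open>q + q'\<close>; the sum extends the product
  bilinearly to inhomogeneous elements.
\<close>

definition tensor_prod ::
  "('m, 'n) tensor \<Rightarrow> ('m, 'n) tensor \<Rightarrow> ('m, 'n) tensor"
  where "tensor_prod S T = (\<lambda>\<omega>s vs.
    \<Sum>k\<le>length \<omega>s. \<Sum>l\<le>length vs. S (take k \<omega>s) (take l vs) * T (drop k \<omega>s) (drop l vs))"

definition coord_vec ::
  "('m, 'n::finite) chart set \<Rightarrow> 'm \<Rightarrow> ('m, 'n) chart \<Rightarrow> 'n \<Rightarrow> ('m, 'n) tvec"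
  where "coord_vec A p c k = (\<lambda>c'. if c' \<in> A \<and> p \<in> fst c'
    then frechet_derivative (chart_change c c') (at (snd c p)) (axis k 1) else 0)"

definition coord_covec ::
  "('m, 'n::finite) chart set \<Rightarrow> 'm \<Rightarrow> ('m, 'n) chart \<Rightarrow> 'n \<Rightarrow> ('m, 'n) covec"
  where "coord_covec A p c k = (\<lambda>v. if v \<in> tangent_space A p then v c $ k else 0)"

text \<open>
  Contraction of the covector slot \<open>i\<close> with the vector slot \<open>j\<close> (counted from 0) of a tensor
  of type \<open>(r,q)\<close>, \<open>i < r\<close>, \<open>j < q\<close>. The result does not depend on the basis used for the
  trace, here the coordinate basis of some chart around \<open>p\<close>.
\<close>

definition contraction ::
  "('m, 'n::finite) chart set \<Rightarrow> 'm \<Rightarrow> nat \<Rightarrow> nat \<Rightarrow> ('m, 'n) tensor \<Rightarrow> ('m, 'n) tensor"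
  where "contraction A p i j T = (\<lambda>\<omega>s vs.
    let c = (SOME c. c \<in> A \<and> p \<in> fst c) in
    \<Sum>k\<in>UNIV. T (take i \<omega>s @ coord_covec A p c k # drop i \<omega>s)
                (take j vs @ coord_vec A p c k # drop j vs))"

definition c1_metric ::
  "('m, 'n::finite) chart set \<Rightarrow> ('m \<Rightarrow> ('m, 'n) tensor) \<Rightarrow> bool"
  where "c1_metric A g \<longleftrightarrow>
    (\<forall>p. g p \<in> tensors A p 0 2) \<and>
    (\<forall>p. \<forall>X\<in>tangent_space A p. \<forall>Y\<in>tangent_space A p. g p [] [X, Y] = g p [] [Y, X]) \<and>
    (\<forall>p. \<forall>X\<in>tangent_space A p. (\<forall>Y\<in>tangent_space A p. g p [] [X, Y] = 0) \<longrightarrow> X = 0) \<and>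
    (\<forall>c\<in>A. \<forall>i j. C1_on (snd c ` fst c)
      (\<lambda>x. let p = inv_into (fst c) (snd c) x
           in g p [] [coord_vec A p c i, coord_vec A p c j]))"


section \<open>Paths and fields along paths\<close>

text \<open>\<open>J\<close> is an arbitrary (open, closed, half-open, bounded or not) nondegenerate interval.\<close>

definition c1_path ::
  "('m::topological_space, 'n::finite) chart set \<Rightarrow> real set \<Rightarrow> (real \<Rightarrow> 'm) \<Rightarrow> bool"
  where "c1_path A J \<gamma> \<longleftrightarrow>
    is_interval J \<and> (\<exists>a\<in>J. \<exists>b\<in>J. a < b) \<and> continuous_on J \<gamma> \<and>
    (\<forall>c\<in>A. C1_on {s\<in>J. \<gamma> s \<in> fst c} (\<lambda>s. snd c (\<gamma> s)))"

definition c1_vector_field ::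
  "('m, 'n::finite) chart set \<Rightarrow> real set \<Rightarrow> (real \<Rightarrow> 'm) \<Rightarrow> (real \<Rightarrow> ('m, 'n) tvec) \<Rightarrow> bool"
  where "c1_vector_field A J \<gamma> X \<longleftrightarrow>
    (\<forall>s\<in>J. X s \<in> tangent_space A (\<gamma> s)) \<and>
    (\<forall>c\<in>A. C1_on {s\<in>J. \<gamma> s \<in> fst c} (\<lambda>s. X s c))"

definition c1_covector_field ::
  "('m, 'n::finite) chart set \<Rightarrow> real set \<Rightarrow> (real \<Rightarrow> 'm) \<Rightarrow> (real \<Rightarrow> ('m, 'n) covec) \<Rightarrow> bool"
  where "c1_covector_field A J \<gamma> \<omega> \<longleftrightarrow>
    (\<forall>s\<in>J. \<omega> s \<in> cotangent_space A (\<gamma> s)) \<and>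
    (\<forall>X. c1_vector_field A J \<gamma> X \<longrightarrow> C1_on J (\<lambda>s. \<omega> s (X s)))"

definition c1_tensor_field ::
  "('m, 'n::finite) chart set \<Rightarrow> real set \<Rightarrow> (real \<Rightarrow> 'm) \<Rightarrow> (real \<Rightarrow> ('m, 'n) tensor) \<Rightarrow> bool"
  where "c1_tensor_field A J \<gamma> T \<longleftrightarrow>
    (\<forall>s\<in>J. T s \<in> tensor_algebra A (\<gamma> s)) \<and>
    (\<forall>\<omega>s Xs. (\<forall>\<omega>\<in>set \<omega>s. c1_covector_field A J \<gamma> \<omega>) \<longrightarrow>
             (\<forall>X\<in>set Xs. c1_vector_field A J \<gamma> X) \<longrightarrow>
       C1_on J (\<lambda>s. T s (map (\<lambda>\<omega>. \<omega> s) \<omega>s) (map (\<lambda>X. X s) Xs)))"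

definition c1_basis ::
  "('m, 'n::finite) chart set \<Rightarrow> real set \<Rightarrow> (real \<Rightarrow> 'm) \<Rightarrow>
    ('n \<Rightarrow> real \<Rightarrow> ('m, 'n) tvec) \<Rightarrow> bool"
  where "c1_basis A J \<gamma> E \<longleftrightarrow>
    (\<forall>i. c1_vector_field A J \<gamma> (E i)) \<and>
    (\<forall>s\<in>J. inj (\<lambda>i. E i s) \<and> independent (range (\<lambda>i. E i s)) \<and>
           span (range (\<lambda>i. E i s)) = tangent_space A (\<gamma> s))"

definition metric_matrix ::
  "('m \<Rightarrow> ('m, 'n) tensor) \<Rightarrow> (real \<Rightarrow> 'm) \<Rightarrow> ('n \<Rightarrow> real \<Rightarrow> ('m, 'n) tvec) \<Rightarrow>
    real \<Rightarrow> real ^ 'n::finite ^ 'n"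
  where "metric_matrix g \<gamma> E s = (\<chi> i j. g (\<gamma> s) [] [E i s, E j s])"


section \<open>S-transports\<close>

text \<open>
  \<open>S s t\<close> is the map from the tensor algebra at \<open>\<gamma> s\<close> to the one at \<open>\<gamma> t\<close>; its values outside
  of the former are irrelevant. The last clause says that \<open>S\<close> is \<open>C\<^sup>1\<close> in \<open>(s,t)\<close>: the
  components at \<open>\<gamma> t\<close> of the transport of a \<open>C\<^sup>1\<close> field of tensors are \<open>C\<^sup>1\<close> functions
  of both parameters.
\<close>

definition S_transport ::
  "('m, 'n::finite) chart set \<Rightarrow> real set \<Rightarrow> (real \<Rightarrow> 'm) \<Rightarrow>
    (real \<Rightarrow> real \<Rightarrow> ('m, 'n) tensor \<Rightarrow> ('m, 'n) tensor) \<Rightarrow> bool"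
  where "S_transport A J \<gamma> S \<longleftrightarrow>
    (\<forall>s\<in>J. \<forall>t\<in>J.
      S s t ` tensor_algebra A (\<gamma> s) \<subseteq> tensor_algebra A (\<gamma> t) \<and>
      linear_on (tensor_algebra A (\<gamma> s)) (S s t) \<and>
      (\<forall>r q. S s t ` tensors A (\<gamma> s) r q \<subseteq> tensors A (\<gamma> t) r q) \<and>
      (\<forall>T\<in>tensor_algebra A (\<gamma> s). \<forall>U\<in>tensor_algebra A (\<gamma> s).
        S s t (tensor_prod T U) = tensor_prod (S s t T) (S s t U)) \<and>
      (\<forall>r q i j. \<forall>T\<in>tensors A (\<gamma> s) r q. i < r \<longrightarrow> j < q \<longrightarrow>
        S s t (contraction A (\<gamma> s) i j T) = contraction A (\<gamma> t) i j (S s t T)) \<and>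
      (\<forall>a. S s t (scalar_tensor a) = scalar_tensor a)) \<and>
    (\<forall>s\<in>J. \<forall>t\<in>J. \<forall>r\<in>J. \<forall>T\<in>tensor_algebra A (\<gamma> s). S t r (S s t T) = S s r T) \<and>
    (\<forall>s\<in>J. \<forall>T\<in>tensor_algebra A (\<gamma> s). S s s T = T) \<and>
    (\<forall>T \<omega>s Xs. c1_tensor_field A J \<gamma> T \<longrightarrow>
        (\<forall>\<omega>\<in>set \<omega>s. c1_covector_field A J \<gamma> \<omega>) \<longrightarrow>
        (\<forall>X\<in>set Xs. c1_vector_field A J \<gamma> X) \<longrightarrow>
      C1_on (J \<times> J) (\<lambda>(s, t). S s t (T s) (map (\<lambda>\<omega>. \<omega> t) \<omega>s) (map (\<lambda>X. X t) Xs)))"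

text \<open>The action of an S-transport on tangent vectors.\<close>

definition vec_transport ::
  "('m, 'n::finite) chart set \<Rightarrow> (real \<Rightarrow> 'm) \<Rightarrow>
    (real \<Rightarrow> real \<Rightarrow> ('m, 'n) tensor \<Rightarrow> ('m, 'n) tensor) \<Rightarrow>
    real \<Rightarrow> real \<Rightarrow> ('m, 'n) tvec \<Rightarrow> ('m, 'n) tvec"
  where "vec_transport A \<gamma> S s t v =
    inv_into (tangent_space A (\<gamma> t)) (vec_tensor A (\<gamma> t)) (S s t (vec_tensor A (\<gamma> s) v))"

text \<open>
  The limit is taken in the product topology of the function type \<open>tvec\<close>, which induces the
  usual topology on the finite-dimensional tangent spaces. \<open>\<Gamma> s $ i $ j\<close> is the component
  with upper index (row) \<open>i\<close> and lower index (column) \<open>j\<close>.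
\<close>

definition has_coefficients ::
  "('m, 'n::finite) chart set \<Rightarrow> real set \<Rightarrow> (real \<Rightarrow> 'm) \<Rightarrow>
    ('n \<Rightarrow> real \<Rightarrow> ('m, 'n) tvec) \<Rightarrow>
    (real \<Rightarrow> real \<Rightarrow> ('m, 'n) tensor \<Rightarrow> ('m, 'n) tensor) \<Rightarrow>
    (real \<Rightarrow> real ^ 'n ^ 'n) \<Rightarrow> bool"
  where "has_coefficients A J \<gamma> E S \<Gamma> \<longleftrightarrow>
    (\<forall>s\<in>J. \<forall>j.
      ((\<lambda>\<epsilon>. (1 / \<epsilon>) *\<^sub>R (vec_transport A \<gamma> S (s + \<epsilon>) s (E j (s + \<epsilon>)) - E j s))
        \<longlongrightarrow> (\<Sum>i\<in>UNIV. (\<Gamma> s $ i $ j) *\<^sub>R E i s)) (at 0 within {\<epsilon>. s + \<epsilon> \<in> J}))"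

definition consistent_along ::
  "('m, 'n::finite) chart set \<Rightarrow> ('m \<Rightarrow> ('m, 'n) tensor) \<Rightarrow> real set \<Rightarrow> (real \<Rightarrow> 'm) \<Rightarrow>
    (real \<Rightarrow> real \<Rightarrow> ('m, 'n) tensor \<Rightarrow> ('m, 'n) tensor) \<Rightarrow> bool"
  where "consistent_along A g J \<gamma> S \<longleftrightarrow>
    (\<forall>s\<in>J. \<forall>t\<in>J. \<forall>X\<in>tangent_space A (\<gamma> s). \<forall>Y\<in>tangent_space A (\<gamma> s).
      g (\<gamma> s) [] [X, Y] =
      g (\<gamma> t) [] [vec_transport A \<gamma> S s t X, vec_transport A \<gamma> S s t Y])"

text \<open>
  When all paths are considered, a path is a map defined on its interval only, which is
  expressed by extensionality; \<open>S (J, \<gamma>)\<close> is the transport along the path \<open>\<gamma>\<close> on \<open>J\<close>.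
\<close>

definition c1_paths ::
  "('m::topological_space, 'n::finite) chart set \<Rightarrow> (real set \<times> (real \<Rightarrow> 'm)) set"
  where "c1_paths A = {(J, \<gamma>). c1_path A J \<gamma> \<and> \<gamma> \<in> extensional J}"

definition globally_consistent ::
  "('m::topological_space, 'n::finite) chart set \<Rightarrow> ('m \<Rightarrow> ('m, 'n) tensor) \<Rightarrow>
    (real set \<times> (real \<Rightarrow> 'm) \<Rightarrow> real \<Rightarrow> real \<Rightarrow> ('m, 'n) tensor \<Rightarrow> ('m, 'n) tensor) \<Rightarrow> bool"
  where "globally_consistent A g S \<longleftrightarrow>
    (\<forall>(J, \<gamma>)\<in>c1_paths A. consistent_along A g J \<gamma> (S (J, \<gamma>)))"


section \<open>Matrices\<close>

definition diag_matrix :: "real ^ 'n \<Rightarrow> real ^ 'n::finite ^ 'n"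
  where "diag_matrix d = (\<chi> i j. if i = j then d $ i else 0)"

text \<open>
  Number of positive and number of negative eigenvalues of a symmetric matrix, counted with
  multiplicity.
\<close>

definition eigenspace :: "real ^ 'n::finite ^ 'n \<Rightarrow> real \<Rightarrow> (real ^ 'n) set"
  where "eigenspace G l = {v. G *v v = l *\<^sub>R v}"

definition matrix_signature :: "real ^ 'n::finite ^ 'n \<Rightarrow> nat \<times> nat"
  where "matrix_signature G =
    (\<Sum>l | l > 0 \<and> eigenspace G l \<noteq> {0}. dim (eigenspace G l),
     \<Sum>l | l < 0 \<and> eigenspace G l \<noteq> {0}. dim (eigenspace G l))"

definition orthogonally_diagonalised ::
  "real set \<Rightarrow> (real \<Rightarrow> real ^ 'n::finite ^ 'n) \<Rightarrow> (real \<Rightarrow> real ^ 'n ^ 'n) \<Rightarrow>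
    (real \<Rightarrow> real ^ 'n) \<Rightarrow> bool"
  where "orthogonally_diagonalised J G D d \<longleftrightarrow>
    (\<forall>s\<in>J. orthogonal_matrix (D s) \<and>
           transpose (D s) ** G s ** D s = diag_matrix (d s) \<and> (\<forall>i. d s $ i \<noteq> 0))"

definition K_matrix ::
  "real set \<Rightarrow> (real \<Rightarrow> real ^ 'n::finite ^ 'n) \<Rightarrow> (real \<Rightarrow> real ^ 'n ^ 'n) \<Rightarrow>
    real \<Rightarrow> real ^ 'n ^ 'n"
  where "K_matrix J G D s = transpose (D s) ** vector_derivative G (at s within J) ** D s"

text \<open>The arguments are the values of the matrix functions at one parameter value.\<close>

definition consistent_form ::
  "real ^ 'n::finite ^ 'n \<Rightarrow> real ^ 'n ^ 'n \<Rightarrow> real ^ 'n \<Rightarrow> real ^ 'n ^ 'n \<Rightarrow>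
    real ^ 'n ^ 'n \<Rightarrow> bool"
  where "consistent_form G D d K \<Gamma> \<longleftrightarrow> (\<exists>P Q R.
    transpose P = P \<and> transpose Q = - Q \<and> transpose R = - R \<and>
    (\<forall>i j. d $ i + d $ j = 0 \<longrightarrow> Q $ i $ j = 0 \<and> R $ i $ j = K $ i $ j / (2 * d $ i)) \<and>
    (\<forall>i j. d $ i + d $ j \<noteq> 0 \<longrightarrow>
       P $ i $ j = K $ i $ j / (d $ i + d $ j) \<and> R $ i $ j = 0) \<and>
    \<Gamma> = D ** (P + Q ** diag_matrix d + R) ** transpose D \<and>
    \<Gamma> = D ** (P + R) ** transpose D + D ** Q ** transpose D ** G)"

end

theory Submission
  imports Defs
begin

text \<open>
  Let \<open>H(t,s)\<close> be the matrix of the transport from \<open>s\<close> to \<open>t\<close>. Consistency means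
  \<open>G(s) = H(t,s)\<^sup>T G(t) H(t,s)\<close>; since the derivative of \<open>r \<mapsto> H(s,r)\<close> at \<open>r = s\<close> is
  \<open>\<Gamma>(s)\<close>, differentiating this identity and, conversely, the function
  \<open>s \<mapsto> H(s,t)\<^sup>T G(s) H(s,t)\<close> shows that consistency is equivalent to
  \<open>G' = \<Gamma>\<^sup>T G + G \<Gamma>\<close>. In an orthonormal eigenbasis of \<open>G\<close> this reads
  \<open>K\<^sub>i\<^sub>j = B\<^sub>j\<^sub>i g\<^sub>j + g\<^sub>i B\<^sub>i\<^sub>j\<close> with \<open>B = D\<^sup>T \<Gamma> D\<close>, which is solved entry by entry,
  separating the pairs with \<open>g\<^sub>i + g\<^sub>j = 0\<close> from the others. Conversely, a continuous
  \<open>\<Gamma>\<close> is realised by \<open>H(t,s) = X(t) Y(s)\<close>, where \<open>X' = - \<Gamma> X\<close>, \<open>Y' = Y \<Gamma>\<close> and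
  \<open>X = Y = 1\<close> at a base point, extended to tensors as multilinear functions.
\<close>

section \<open>Calculus of \<open>C\<^sup>1\<close> functions\<close>

text \<open>The coefficients record the derivative of \<open>H\<close> only on the diagonal and only
  in the start parameter; the cocycle law spreads it to all pairs, and constancy of functions with
  zero derivative takes the place of uniqueness theorems for the differential equation. All
  derivatives are taken within \<open>J\<close>, so limits are unique because \<open>J\<close> has
  no isolated points, and results on compact intervals are transferred through relative
  neighbourhoods. Passing to the eigenbasis is a change of unknowns at each single parameter value,
  so crossings of eigenvalues cause no difficulty. In the converse the obstacle is joint regularity:
  the transport of every C1 tensor field must be C1 in both parameters, although a tensor field is
  tested only against fields of one parameter. Expanding each argument in the frame, with
  coefficients depending on both parameters, resolves this; that the frame components of C1 fields
  are themselves C1 comes from Cramer's rule in a chart.\<close>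

lemma C1_onI:
  fixes f :: "'a::euclidean_space \<Rightarrow> 'b::real_normed_vector"
  assumes "\<And>x. x \<in> S \<Longrightarrow> (f has_derivative f' x) (at x within S)"
    and "\<And>i. i \<in> Basis \<Longrightarrow> continuous_on S (\<lambda>x. f' x i)"
  shows "C1_on S f"
proof -
  define F where "F x = Blinfun (f' x)" for x
  have F: "blinfun_apply (F x) = f' x" if "x \<in> S" for x
    unfolding F_def
    by (rule bounded_linear_Blinfun_apply) (use assms(1)[OF that] has_derivative_bounded_linear in blast)
  \<comment> \<open>Finite dimension of the domain enters here: continuity in operator norm reduces
    to continuity of the values on basis vectors.\<close>
  have "continuous_on S F"
  proof (rule continuous_on_blinfun_componentwise)
    fix i :: 'a assume "i \<in> Basis"
    then show "continuous_on S (\<lambda>x. F x i)"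
      using assms(2)[of i] F by (metis (mono_tags, lifting) continuous_on_cong)
  qed
  then show ?thesis
    unfolding C1_on_def using F assms(1) by (intro exI[of _ F]) auto
qed

lemma C1_onE:
  assumes "C1_on S f"
  obtains f' where "\<And>x. x \<in> S \<Longrightarrow> (f has_derivative f' x) (at x within S)"
    "\<And>h. continuous_on S (\<lambda>x. f' x h)" "continuous_on S f"
proof -
  from assms obtain F :: "'a \<Rightarrow> 'a \<Rightarrow>\<^sub>L 'b"
    where F: "\<And>x. x \<in> S \<Longrightarrow> (f has_derivative blinfun_apply (F x)) (at x within S)"
      and c: "continuous_on S F"
    unfolding C1_on_def by blast
  have "continuous_on S (\<lambda>x. blinfun_apply (F x) h)" for h
    by (intro continuous_intros c)
  moreover have "continuous_on S f"
    using F by (intro has_derivative_continuous_on) 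
  ultimately show ?thesis by (intro that[of "\<lambda>x. blinfun_apply (F x)"] F)
qed

lemma C1_on_cong: "S = T \<Longrightarrow> (\<And>x. x \<in> T \<Longrightarrow> f x = g x) \<Longrightarrow> C1_on S f \<longleftrightarrow> C1_on T g"
  unfolding C1_on_def
  by (metis (mono_tags, lifting) has_derivative_transform)

lemma C1_on_const [simp]: "C1_on S (\<lambda>x. c)"
  unfolding C1_on_def by (intro exI[of _ "\<lambda>x. 0"]) (auto simp: zero_blinfun.rep_eq)

lemma C1_on_bounded_linear:
  fixes S :: "'a::euclidean_space set"
  assumes "C1_on S f" "bounded_linear h"
  shows "C1_on S (\<lambda>x. h (f x))"
proof -
  obtain f' where f': "\<And>x. x \<in> S \<Longrightarrow> (f has_derivative f' x) (at x within S)"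
    "\<And>i. continuous_on S (\<lambda>x. f' x i)" using C1_onE[OF assms(1)] by metis
  show ?thesis
  proof (rule C1_onI)
    show "((\<lambda>x. h (f x)) has_derivative (\<lambda>k. h (f' x k))) (at x within S)" if "x \<in> S" for x
      by (rule bounded_linear.has_derivative[OF assms(2) f'(1)[OF that]])
    show "continuous_on S (\<lambda>x. h (f' x i))" for i
      by (rule bounded_linear.continuous_on[OF assms(2) f'(2)])
  qed
qed

text \<open>The argument stays with operator-valued derivatives, because composition of bounded
  operators is bounded bilinear and hence jointly continuous.\<close>

lemma C1_on_compose:
  assumes "C1_on T f" "C1_on S h" "h ` S \<subseteq> T"
  shows "C1_on S (\<lambda>x. f (h x))"
proof -
  obtain F where F: "\<And>x. x \<in> T \<Longrightarrow> (f has_derivative blinfun_apply (F x)) (at x within T)"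
    and cF: "continuous_on T F" using assms(1) unfolding C1_on_def by blast
  obtain H where H: "\<And>x. x \<in> S \<Longrightarrow> (h has_derivative blinfun_apply (H x)) (at x within S)"
    and cH: "continuous_on S H" using assms(2) unfolding C1_on_def by blast
  have ch: "continuous_on S h" using H by (intro has_derivative_continuous_on)
  have "((\<lambda>x. f (h x)) has_derivative blinfun_apply (F (h x) o\<^sub>L H x)) (at x within S)"
    if "x \<in> S" for x
  proof -
    have "(f has_derivative blinfun_apply (F (h x))) (at (h x) within h ` S)"
      using F assms(3) that has_derivative_subset by blast
    from has_derivative_in_compose[OF H[OF that] this]
    show ?thesis by (simp add: blinfun_compose.rep_eq o_def)
  qed
  moreover have "continuous_on S (\<lambda>x. F (h x) o\<^sub>L H x)"
    by (rule bounded_bilinear.continuous_on[OF bounded_bilinear_blinfun_compose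
          continuous_on_compose2[OF cF ch assms(3)] cH])
  ultimately show ?thesis unfolding C1_on_def
    by (intro exI[of _ "\<lambda>x. F (h x) o\<^sub>L H x"]) simp
qed

lemma C1_on_linear:
  assumes "bounded_linear h"
  shows "C1_on S h"
proof -
  have "(h has_derivative blinfun_apply (Blinfun h)) (at x within S)" for x
    using bounded_linear_imp_has_derivative[OF assms] by (metis bounded_linear_Blinfun_apply assms)
  then show ?thesis unfolding C1_on_def
    by (intro exI[of _ "\<lambda>_. Blinfun h"] conjI ballI continuous_on_const)
qed

text \<open>A function of one path parameter is regarded as a function of the two transport
  parameters.\<close>

lemma C1_on_fst: "C1_on S f \<Longrightarrow> C1_on (S \<times> S) (\<lambda>x :: real \<times> real. f (fst x))"
  and C1_on_snd: "C1_on S f \<Longrightarrow> C1_on (S \<times> S) (\<lambda>x :: real \<times> real. f (snd x))"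
  by (auto intro: C1_on_compose[OF _ C1_on_linear[OF bounded_linear_fst]]
      C1_on_compose[OF _ C1_on_linear[OF bounded_linear_snd]])

lemma C1_on_add:
  fixes S :: "'a::euclidean_space set"
  assumes "C1_on S f" "C1_on S g"
  shows "C1_on S (\<lambda>x. f x + g x)"
proof -
  obtain f' where f': "\<And>x. x \<in> S \<Longrightarrow> (f has_derivative f' x) (at x within S)"
    "\<And>i. continuous_on S (\<lambda>x. f' x i)" using C1_onE[OF assms(1)] by metis
  obtain g' where g': "\<And>x. x \<in> S \<Longrightarrow> (g has_derivative g' x) (at x within S)"
    "\<And>i. continuous_on S (\<lambda>x. g' x i)" using C1_onE[OF assms(2)] by metis
  show ?thesis
    by (rule C1_onI[where f' = "\<lambda>x h. f' x h + g' x h"])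
      (auto intro!: continuous_intros has_derivative_add f' g')
qed

lemma C1_on_mult:
  fixes S :: "'a::euclidean_space set" and f g :: "'a \<Rightarrow> real"
  assumes "C1_on S f" "C1_on S g"
  shows "C1_on S (\<lambda>x. f x * g x)"
proof -
  obtain f' where f': "\<And>x. x \<in> S \<Longrightarrow> (f has_derivative f' x) (at x within S)"
    "\<And>i. continuous_on S (\<lambda>x. f' x i)" "continuous_on S f" using C1_onE[OF assms(1)] by metis
  obtain g' where g': "\<And>x. x \<in> S \<Longrightarrow> (g has_derivative g' x) (at x within S)"
    "\<And>i. continuous_on S (\<lambda>x. g' x i)" "continuous_on S g" using C1_onE[OF assms(2)] by metis
  show ?thesis
    by (rule C1_onI[where f' = "\<lambda>x h. f x * g' x h + f' x h * g x"])
      (auto intro!: continuous_intros has_derivative_mult f' g')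
qed

lemma C1_on_inverse:
  fixes S :: "'a::euclidean_space set" and f :: "'a \<Rightarrow> real"
  assumes "C1_on S f" "\<And>x. x \<in> S \<Longrightarrow> f x \<noteq> 0"
  shows "C1_on S (\<lambda>x. inverse (f x))"
proof -
  obtain f' where f': "\<And>x. x \<in> S \<Longrightarrow> (f has_derivative f' x) (at x within S)"
    "\<And>i. continuous_on S (\<lambda>x. f' x i)" "continuous_on S f" using C1_onE[OF assms(1)] by metis
  show ?thesis
    by (rule C1_onI[where f' = "\<lambda>x h. - (inverse (f x) * f' x h * inverse (f x))"])
      (use assms(2) in \<open>auto intro!: continuous_intros f' Deriv.has_derivative_inverse[OF _ f'(1)]\<close>)
qed

lemma C1_on_divide:
  fixes S :: "'a::euclidean_space set" and f :: "'a \<Rightarrow> real"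
  assumes "C1_on S f" "C1_on S g" "\<And>x. x \<in> S \<Longrightarrow> g x \<noteq> 0"
  shows "C1_on S (\<lambda>x. f x / g x)"
  unfolding divide_inverse by (intro C1_on_mult C1_on_inverse assms)

lemma C1_on_sum:
  fixes S :: "'a::euclidean_space set"
  assumes "\<And>i. i \<in> I \<Longrightarrow> C1_on S (f i)"
  shows "C1_on S (\<lambda>x. \<Sum>i\<in>I. f i x)"
  using assms by (induction I rule: infinite_finite_induct) (auto intro: C1_on_add)

lemma C1_on_prod:
  fixes S :: "'a::euclidean_space set" and f :: "'i \<Rightarrow> 'a \<Rightarrow> real"
  assumes "\<And>i. i \<in> I \<Longrightarrow> C1_on S (f i)"
  shows "C1_on S (\<lambda>x. \<Prod>i\<in>I. f i x)"
  using assms by (induction I rule: infinite_finite_induct) (auto intro: C1_on_mult)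

lemma C1_on_det:
  fixes S :: "'a::euclidean_space set" and M :: "'a \<Rightarrow> real^'n^'n"
  assumes "\<And>i j. C1_on S (\<lambda>x. M x $ i $ j)"
  shows "C1_on S (\<lambda>x. det (M x))"
  unfolding det_def by (intro C1_on_sum C1_on_mult C1_on_prod C1_on_const assms)

lemma C1_on_vec_nth:
  fixes S :: "'a::euclidean_space set"
  shows "C1_on S f \<Longrightarrow> C1_on S (\<lambda>x. f x $ i)"
  by (rule C1_on_bounded_linear[OF _ bounded_linear_vec_nth])

lemma C1_on_matrixI:
  fixes S :: "'a::euclidean_space set" and f :: "'a \<Rightarrow> real^'n^'m"
  assumes "\<And>i j. C1_on S (\<lambda>x. f x $ i $ j)"
  shows "C1_on S f"
proof -
  have "f x = (\<Sum>i\<in>UNIV. \<Sum>j\<in>UNIV. f x $ i $ j *\<^sub>R axis i (axis j 1))" for x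
  proof -
    have "(\<Sum>j\<in>UNIV. y $ i $ j *\<^sub>R axis i (axis j 1)) = axis i (y $ i)" for y :: "real^'n^'m" and i
      by (simp add: vec_eq_iff axis_def if_distrib[of "\<lambda>z. z $ _"] if_distrib[of "\<lambda>z. _ * z"]
          cong: if_cong)
    then show ?thesis by (simp add: vec_eq_iff axis_def if_distrib[of "\<lambda>z. z $ _"] cong: if_cong)
  qed
  moreover have "C1_on S (\<lambda>x. \<Sum>i\<in>UNIV. \<Sum>j\<in>UNIV. f x $ i $ j *\<^sub>R axis i (axis j 1) :: real^'n^'m)"
    by (intro C1_on_sum C1_on_bounded_linear[OF assms] bounded_linear_scaleR_left)
  ultimately show ?thesis by simp
qed

text \<open>A linear map on the reals is multiplication by its value at 1, so the operator-valued
  and the vector-valued derivative carry the same information, continuity included.\<close>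

lemma C1_on_real_iff:
  fixes S :: "real set"
  shows "C1_on S f \<longleftrightarrow>
    (\<exists>f'. (\<forall>x\<in>S. (f has_vector_derivative f' x) (at x within S)) \<and> continuous_on S f')"
proof
  assume "C1_on S f"
  then obtain f' where f': "\<And>x. x \<in> S \<Longrightarrow> (f has_derivative f' x) (at x within S)"
    "\<And>h. continuous_on S (\<lambda>x. f' x h)"
    using C1_onE by metis
  have "(f has_vector_derivative f' x 1) (at x within S)" if "x \<in> S" for x
  proof -
    have "f' x = (\<lambda>h. h *\<^sub>R f' x 1)"
      using has_derivative_linear[OF f'(1)[OF that]]
      by (metis linear_cmul mult.right_neutral real_scaleR_def)
    then show ?thesis using f'(1)[OF that] by (simp add: has_vector_derivative_def)
  qed
  then show "\<exists>f'. (\<forall>x\<in>S. (f has_vector_derivative f' x) (at x within S)) \<and> continuous_on S f'"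
    using f'(2)[of 1] by (intro exI[of _ "\<lambda>x. f' x 1"]) auto
next
  assume "\<exists>f'. (\<forall>x\<in>S. (f has_vector_derivative f' x) (at x within S)) \<and> continuous_on S f'"
  then obtain f' where "\<And>x. x \<in> S \<Longrightarrow> (f has_derivative (\<lambda>h. h *\<^sub>R f' x)) (at x within S)"
    "continuous_on S f'" unfolding has_vector_derivative_def by auto
  then show "C1_on S f"
    by (intro C1_onI[where f' = "\<lambda>x h. h *\<^sub>R f' x"]) (auto intro!: continuous_intros)
qed

definition nondegenerate_interval :: "real set \<Rightarrow> bool"
  where "nondegenerate_interval J \<longleftrightarrow> is_interval J \<and> (\<exists>a\<in>J. \<exists>b\<in>J. a < b)"

text \<open>A connected set with more than one point has no isolated point. This makes limits and
  derivatives within \<open>J\<close> unique everywhere, end points included.\<close>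

lemma nondegenerate_interval_trivial_limit:
  assumes "nondegenerate_interval J" "s \<in> J"
  shows "at s within J \<noteq> bot"
proof -
  obtain a b where ab: "a \<in> J" "b \<in> J" "a < b" 
    using assms by (auto simp: nondegenerate_interval_def)
  have "s islimpt J"
    using assms ab by (metis connected_imp_perfect is_interval_connected nondegenerate_interval_def
        order.strict_iff_order singleton_iff)
  then show ?thesis using trivial_limit_within by blast
qed

text \<open>Charts cover the path only piecewise, so regularity is obtained on relatively open
  pieces. They glue because the derivative within \<open>J\<close> is unique, which lets
  \<open>vector_derivative\<close> serve as the common derivative.\<close>

lemma C1_on_locally:
  assumes J: "nondegenerate_interval J"
    and loc: "\<And>s. s \<in> J \<Longrightarrow> \<exists>U. open U \<and> s \<in> U \<and> C1_on (J \<inter> U) f"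
  shows "C1_on J f"
proof -
  define f' where "f' s = vector_derivative f (at s within J)" for s
  have ex: "(f has_vector_derivative f' s) (at s within J) \<and> continuous (at s within J) f'"
    if s: "s \<in> J" for s
  proof -
    obtain U where U: "open U" "s \<in> U" "C1_on (J \<inter> U) f" using loc[OF s] by blast
    \<comment> \<open>\<open>U\<close> is open, so near its points \<open>J\<close> and
      \<open>J \<inter> U\<close> cannot be told apart.\<close>
    have nb: "at t within (J \<inter> U) = at t within J" if "t \<in> U" for t
      using that U(1) by (metis at_within_nhd inf_assoc inf_idem)
    obtain h where h: "\<And>x. x \<in> J \<inter> U \<Longrightarrow> (f has_vector_derivative h x) (at x within (J \<inter> U))"
      "continuous_on (J \<inter> U) h" using U(3) unfolding C1_on_real_iff by blast
    have fh: "f' x = h x" if "x \<in> J \<inter> U" for x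
      unfolding f'_def
      by (rule vector_derivative_within[OF nondegenerate_interval_trivial_limit[OF J]])
        (use h(1)[OF that] nb[of x] that in auto)
    have "continuous_on (J \<inter> U) f'" using h(2) fh by (metis continuous_on_cong)
    then have "continuous (at s within (J \<inter> U)) f'"
      using s U(2) by (simp add: continuous_on_eq_continuous_within)
    then show ?thesis using nb[OF U(2)] h(1)[of s] fh[of s] s U(2) by auto
  qed
  then show ?thesis unfolding C1_on_real_iff
    by (auto intro!: exI[of _ f'] simp: continuous_on_eq_continuous_within)
qed

section \<open>Linear differential equations on an interval\<close>

text \<open>Integration and uniform estimates live on compact intervals, while \<open>J\<close> may
  be open or unbounded. The interval found here contains the base point \<open>c\<close> and agrees
  with \<open>J\<close> near \<open>t\<close>, so derivatives within the two sets coincide at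
  \<open>t\<close>.\<close>

lemma nondegenerate_interval_Icc_nhd:
  assumes J: "nondegenerate_interval J" and c: "c \<in> J" and t: "t \<in> J"
  obtains a b where "a < b" "{a..b} \<subseteq> J" "c \<in> {a..b}" "t \<in> {a..b}" "at t within {a..b} = at t within J"
proof -
  obtain p q where pq: "p \<in> J" "q \<in> J" "p < q" 
    and I: "\<And>x y z. x \<in> J \<Longrightarrow> y \<in> J \<Longrightarrow> x \<le> z \<Longrightarrow> z \<le> y \<Longrightarrow> z \<in> J"
    using J unfolding nondegenerate_interval_def is_interval_1 by blast
  \<comment> \<open>\<open>u\<close> lies strictly to the left of \<open>t\<close> unless
    \<open>t\<close> is the left end point of \<open>J\<close>; \<open>v\<close> is its mirror
    image.\<close>
  obtain u where u: "u \<in> J" "u \<le> t" "(\<exists>x\<in>J. x < t) \<Longrightarrow> u < t" using t by (metis order.refl order.strict_implies_order)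
  obtain v where v: "v \<in> J" "t \<le> v" "(\<exists>x\<in>J. t < x) \<Longrightarrow> t < v" using t by (metis order.refl order.strict_implies_order)
  define a where "a = min (min u c) p"
  define b where "b = max (max v c) q"
  have ab: "a \<in> J" "b \<in> J" using u v c pq by (auto simp: a_def b_def min_def max_def)
  have sub: "{a..b} \<subseteq> J" using I[OF ab] by auto
  \<comment> \<open>At an end point of \<open>J\<close> there is nothing of \<open>J\<close> on the
    outer side, so any bound beyond \<open>t\<close> will do; the distance 1 is arbitrary.\<close>
  define l where "l = (if u < t then u else t - 1)"
  define r where "r = (if t < v then v else t + 1)"
  have eq: "{a..b} \<inter> {l<..<r} = J \<inter> {l<..<r}"
  proof (intro equalityI subsetI)
    fix x assume x: "x \<in> J \<inter> {l<..<r}"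
    have "a \<le> x" using x u by (cases "u < t") (force simp: l_def a_def)+
    moreover have "x \<le> b" using x v by (cases "t < v") (force simp: r_def b_def)+
    ultimately show "x \<in> {a..b} \<inter> {l<..<r}" using x by auto
  qed (use sub in auto)
  have "at t within {a..b} = at t within J"
    by (rule at_within_nhd[of t "{l<..<r}"]) (use eq u v in \<open>auto simp: l_def r_def\<close>)
  then show ?thesis
    using that[of a b] sub pq(3) u(2) v(2) by (auto simp: a_def b_def min_less_iff_disj less_max_iff_disj min_le_iff_disj le_max_iff_disj)
qed

text \<open>The oriented integral from \<open>c\<close> covers both sides of the base point with one
  formula; the fundamental theorem is applied on a compact interval that agrees with
  \<open>J\<close> near the point in question.\<close>

lemma antiderivative_on_interval:
  fixes f :: "real \<Rightarrow> 'a::euclidean_space"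
  assumes J: "nondegenerate_interval J" and c: "c \<in> J" and f: "continuous_on J f"
  shows "\<exists>F. F c = 0 \<and> (\<forall>t\<in>J. (F has_vector_derivative f t) (at t within J))"
proof (intro exI[of _ "\<lambda>u. LBINT y=ereal c..ereal u. f y"] conjI ballI)
  show "(LBINT y=ereal c..ereal c. f y) = 0" by simp
  fix t assume t: "t \<in> J"
  obtain a b where ab: "{a..b} \<subseteq> J" "c \<in> {a..b}" "t \<in> {a..b}" "at t within {a..b} = at t within J"
    using nondegenerate_interval_Icc_nhd[OF J c t] by metis
  have "((\<lambda>u. LBINT y=ereal c..ereal u. f y) has_vector_derivative f t) (at t within {a..b})"
    by (rule interval_integral_FTC2) (use ab continuous_on_subset[OF f ab(1)] in auto)
  then show "((\<lambda>u. LBINT y=ereal c..ereal u. f y) has_vector_derivative f t) (at t within J)"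
    using ab(4) by simp
qed

text \<open>Induction step of the estimate for iterated integrals: integrating the bound from
  \<open>c\<close> to \<open>t\<close> raises the power and the factorial by one.\<close>

lemma norm_le_power_fact:
  fixes F :: "real \<Rightarrow> 'a::real_normed_vector"
  assumes ct: "c \<in> {a..b}" "t \<in> {a..b}" and F0: "F c = 0"
    and F: "\<And>u. u \<in> {a..b} \<Longrightarrow> (F has_vector_derivative F' u) (at u within {a..b})"
    and bound: "\<And>u. u \<in> {a..b} \<Longrightarrow> norm (F' u) \<le> C * (M * \<bar>u - c\<bar>) ^ n / fact n * M"
  shows "norm (F t) \<le> C * (M * \<bar>t - c\<bar>) ^ Suc n / fact (Suc n)"
proof -
  \<comment> \<open>Running along the segment from \<open>c\<close> to \<open>t\<close> in unit time
    treats both orders of \<open>c\<close> and \<open>t\<close> alike.\<close>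
  define p where "p = (\<lambda>u. c + u * (t - c))"
  have p_in: "p u \<in> {a..b}" if "u \<in> {0..1}" for u
  proof -
    have "p u = (1 - u) *\<^sub>R c + u *\<^sub>R t" by (simp add: p_def algebra_simps)
    then show ?thesis using ct that convexD_alt[OF convex_real_interval(5), of c a b t u]
      by (metis atLeastAtMost_iff)
  qed
  have D: "((\<lambda>u. F (p u)) has_vector_derivative (t - c) *\<^sub>R F' (p u)) (at u within {0..1})"
    if u: "u \<in> {0..1}" for u
  proof -
    have "(p has_vector_derivative (t - c)) (at u within {0..1})"
      unfolding p_def by (auto intro!: derivative_eq_intros)
    moreover have "(F has_vector_derivative F' (p u)) (at (p u) within p ` {0..1})"
      using F[OF p_in[OF u]] by (rule has_vector_derivative_within_subset) (use p_in in auto)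
    ultimately show ?thesis using vector_diff_chain_within by (fastforce simp: o_def)
  qed
  \<comment> \<open>On the segment |p u - c| = u |t - c|. Hence \<phi>' bounds the speed of
    \<open>F\<close> along it, and \<phi> is the antiderivative of \<phi>' vanishing at 0.\<close>
  define \<phi> where "\<phi> = (\<lambda>u::real. u ^ Suc n * (C * (M * \<bar>t - c\<bar>) ^ Suc n / fact (Suc n)))"
  define \<phi>' where "\<phi>' = (\<lambda>u::real. u ^ n * (C * (M * \<bar>t - c\<bar>) ^ Suc n / fact n))"
  have "norm (F (p 1) - F (p 0)) \<le> \<phi> 1 - \<phi> 0"
  proof (rule differentiable_bound_general)
    show "continuous_on {0..1} (\<lambda>u. F (p u))"
      using D by (meson has_vector_derivative_continuous continuous_on_eq_continuous_within)
    show "continuous_on {0..1} \<phi>" unfolding \<phi>_def by (intro continuous_intros)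
    fix u :: real assume u: "0 < u" "u < 1"
    show "((\<lambda>u. F (p u)) has_vector_derivative (t - c) *\<^sub>R F' (p u)) (at u)"
      using D[of u] u at_within_interior[of u "{0..1}"] by auto
    have "(\<phi> has_real_derivative
        real (Suc n) * u ^ (Suc n - Suc 0) * (C * (M * \<bar>t - c\<bar>) ^ Suc n / fact (Suc n))) (at u)"
      unfolding \<phi>_def by (rule DERIV_cmult_right[OF DERIV_pow])
    moreover have "real (Suc n) * u ^ (Suc n - Suc 0) * (z / fact (Suc n)) = u ^ n * (z / fact n)"
      for z :: real
      unfolding fact_Suc by (simp del: of_nat_Suc)
    ultimately have "(\<phi> has_real_derivative \<phi>' u) (at u)"
      unfolding \<phi>'_def by metis
    then show "(\<phi> has_vector_derivative \<phi>' u) (at u)"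
      by (simp add: has_real_derivative_iff_has_vector_derivative)
    have "norm ((t - c) *\<^sub>R F' (p u)) \<le> \<bar>t - c\<bar> * (C * (M * \<bar>p u - c\<bar>) ^ n / fact n * M)"
      using mult_left_mono[OF bound[OF p_in[of u]], of "\<bar>t - c\<bar>"] u by simp
    also have "\<bar>p u - c\<bar> = u * \<bar>t - c\<bar>" using u by (simp add: p_def abs_mult)
    also have "\<bar>t - c\<bar> * (C * (M * (u * \<bar>t - c\<bar>)) ^ n / fact n * M) = \<phi>' u"
      by (simp add: \<phi>'_def power_mult_distrib)
    finally show "norm ((t - c) *\<^sub>R F' (p u)) \<le> \<phi>' u" .
  qed simp
  then show ?thesis by (simp add: p_def F0 \<phi>_def)
qed

text \<open>The series of iterated integrals gives one solution on the whole of \<open>J\<close>,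
  without gluing local solutions. On a compact interval around \<open>c\<close> where the norm of
  \<open>A\<close> is at most M, its n-th term is bounded by norm x0 (M |t - c|)^n / n!, which
  yields uniform convergence of the series and of its derivatives.\<close>

lemma linear_ode_solution:
  fixes A :: "real \<Rightarrow> 'a::euclidean_space \<Rightarrow>\<^sub>L 'a"
  assumes J: "nondegenerate_interval J" and c: "c \<in> J" and A: "continuous_on J A"
  shows "\<exists>x. x c = x0 \<and> (\<forall>t\<in>J. (x has_vector_derivative A t (x t)) (at t within J))"
proof -
  have "\<exists>F. continuous_on J f \<longrightarrow> F c = 0 \<and> (\<forall>t\<in>J. (F has_vector_derivative f t) (at t within J))"
    for f :: "real \<Rightarrow> 'a"
    using antiderivative_on_interval[OF J c] by blast
  \<comment> \<open>\<open>I\<close> chooses an antiderivative vanishing at \<open>c\<close> for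
    each continuous function; its values on other functions are arbitrary.\<close>
  then obtain I :: "(real \<Rightarrow> 'a) \<Rightarrow> real \<Rightarrow> 'a" where
    I: "\<And>f. continuous_on J f \<Longrightarrow> I f c = 0"
       "\<And>f t. continuous_on J f \<Longrightarrow> t \<in> J \<Longrightarrow> (I f has_vector_derivative f t) (at t within J)"
    by metis
  \<comment> \<open>the terms of the Peano--Baker series\<close>
  define X where "X = rec_nat (\<lambda>_. x0) (\<lambda>n f. I (\<lambda>t. A t (f t)))"
  have X0: "X 0 = (\<lambda>_. x0)" and XS: "X (Suc n) = I (\<lambda>t. A t (X n t))" for n
    by (simp_all add: X_def)
  have cont: "continuous_on J (X n)" for n
  proof (induction n)
    case (Suc n)
    then have "continuous_on J (\<lambda>t. A t (X n t))" by (intro continuous_intros A)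
    then show ?case unfolding XS using I(2)
      by (meson has_vector_derivative_continuous continuous_on_eq_continuous_within)
  qed (simp add: X0)
  have contA: "continuous_on J (\<lambda>t. A t (X n t))" for n by (intro continuous_intros A cont)
  have der: "(X (Suc n) has_vector_derivative A t (X n t)) (at t within J)" if "t \<in> J" for n t
    unfolding XS by (rule I(2)[OF contA that])
  have Xc: "X (Suc n) c = 0" for n unfolding XS by (rule I(1)[OF contA])
  define x where "x t = (\<Sum>n. X n t)" for t
  have "x c = (\<Sum>n. X n c)" by (simp add: x_def)
  also have "\<dots> = (\<Sum>n\<in>{0}. X n c)"
  proof (rule suminf_finite)
    fix n :: nat assume "n \<notin> {0}"
    then show "X n c = 0" using Xc by (cases n) auto
  qed simp
  finally have "x c = x0" by (simp add: X0)
  moreover have "(x has_vector_derivative A t (x t)) (at t within J)" if t: "t \<in> J" for t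
  proof -
    obtain a b where ab: "a < b" "{a..b} \<subseteq> J" "c \<in> {a..b}" "t \<in> {a..b}" "at t within {a..b} = at t within J"
      using nondegenerate_interval_Icc_nhd[OF J c t] by metis
    have "compact ((\<lambda>t. A t) ` {a..b})"
      using A ab(2) continuous_on_subset compact_continuous_image compact_Icc by metis
    then obtain M where M: "M > 0" "\<And>u. u \<in> {a..b} \<Longrightarrow> norm (A u) \<le> M"
      using compact_imp_bounded bounded_pos by (metis imageI)
    have derab: "(X (Suc n) has_vector_derivative A u (X n u)) (at u within {a..b})"
      if "u \<in> {a..b}" for n u
      using der[of u n] that ab(2) has_vector_derivative_within_subset by blast
    have bound: "norm (X n u) \<le> norm x0 * (M * \<bar>u - c\<bar>) ^ n / fact n" if "u \<in> {a..b}" for n u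
      using that
    proof (induction n arbitrary: u)
      case (Suc n)
      show ?case
      proof (rule norm_le_power_fact[OF ab(3) Suc.prems Xc derab])
        fix v assume v: "v \<in> {a..b}"
        have "norm (A v (X n v)) \<le> norm (A v) * norm (X n v)" by (rule norm_blinfun)
        also have "\<dots> \<le> M * (norm x0 * (M * \<bar>v - c\<bar>) ^ n / fact n)"
          using M(1) by (intro mult_mono M(2) v Suc.IH) auto
        finally show "norm (A v (X n v)) \<le> norm x0 * (M * \<bar>v - c\<bar>) ^ n / fact n * M"
          by (simp add: mult.commute)
      qed
    qed (simp add: X0)
    \<comment> \<open>A majorant independent of \<open>u\<close>, since |u - c| \<le> b - a; its sum
      is a multiple of a value of the exponential series.\<close>
    define B where "B n = norm x0 * ((M * (b - a)) ^ n / fact n)" for n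
    have boundB: "norm (X n u) \<le> B n" if "u \<in> {a..b}" for n u
    proof -
      have "(M * \<bar>u - c\<bar>) ^ n \<le> (M * (b - a)) ^ n"
        using that ab M(1) by (intro power_mono mult_left_mono) auto
      then have "norm x0 * (M * \<bar>u - c\<bar>) ^ n / fact n \<le> B n"
        unfolding B_def by (simp add: divide_right_mono mult_left_mono)
      then show ?thesis using bound[OF that, of n] by linarith
    qed
    have sumB: "summable B"
      unfolding B_def using summable_exp[of "M * (b - a)"]
      by (intro summable_mult) (simp add: field_simps)
    have ul: "uniform_limit {a..b} (\<lambda>n u. \<Sum>i<n. X i u) x sequentially"
      unfolding x_def by (rule Weierstrass_m_test[OF boundB sumB])
    \<comment> \<open>The series of derivatives is shifted by one: the constant term contributes 0
      and term m + 1 contributes \<open>A\<close> applied to term m. Hence the first n + 1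
      derivatives sum to \<open>A\<close> applied to the n-th partial sum.\<close>
    define dX where "dX n u = (case n of 0 \<Rightarrow> 0 | Suc m \<Rightarrow> A u (X m u))" for n u
    have dX_sum: "(\<Sum>i<Suc n. dX i u) = A u (\<Sum>i<n. X i u)" for n u
      by (induction n) (simp_all add: dX_def blinfun.zero_right blinfun.add_right)
    have summ: "(\<lambda>n. X n u) sums x u" if "u \<in> {a..b}" for u
      unfolding x_def
      by (rule summable_sums, rule summable_comparison_test'[OF sumB, of 0]) (use boundB[OF that] in auto)
    have "\<exists>g. \<forall>u\<in>{a..b}. (\<lambda>n. X n u) sums g u \<and>
        (g has_derivative (\<lambda>h. h *\<^sub>R A u (x u))) (at u within {a..b})"
    proof (rule has_derivative_series[where f = X and f' = "\<lambda>n u h. h *\<^sub>R dX n u" and x = t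
          and l = "x t"])
      show "convex {a..b}" "t \<in> {a..b}" "(\<lambda>n. X n t) sums x t"
        using ab(4) summ by auto
    next
      fix n u assume u: "u \<in> {a..b}"
      show "(X n has_derivative (\<lambda>h. h *\<^sub>R dX n u)) (at u within {a..b})"
        using derab[OF u] by (cases n) (auto simp: dX_def X0 has_vector_derivative_def)
    next
      fix e :: real assume e: "e > 0"
      then have "\<forall>\<^sub>F n in sequentially. \<forall>u\<in>{a..b}. dist (\<Sum>i<n. X i u) (x u) < e / M"
        using ul M(1) by (auto simp: uniform_limit_iff)
      then have "\<forall>\<^sub>F n in sequentially. \<forall>u\<in>{a..b}. \<forall>h.
        norm ((\<Sum>i<Suc n. h *\<^sub>R dX i u) - h *\<^sub>R A u (x u)) \<le> e * norm h"
      proof (rule eventually_mono, intro ballI allI)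
        fix n u and h :: real
        assume n: "\<forall>u\<in>{a..b}. dist (\<Sum>i<n. X i u) (x u) < e / M" and u: "u \<in> {a..b}"
        have "(\<Sum>i<Suc n. h *\<^sub>R dX i u) - h *\<^sub>R A u (x u) = h *\<^sub>R A u ((\<Sum>i<n. X i u) - x u)"
          unfolding scaleR_sum_right[symmetric] dX_sum blinfun.diff_right
          by (simp add: scaleR_diff_right)
        also have "norm \<dots> \<le> \<bar>h\<bar> * (norm (A u) * norm ((\<Sum>i<n. X i u) - x u))"
          by (simp add: mult_left_mono norm_blinfun)
        also have "\<dots> \<le> \<bar>h\<bar> * (M * (e / M))"
          using n u M by (intro mult_left_mono mult_mono) (auto simp: dist_norm less_imp_le)
        also have "\<dots> = e * norm h" using M(1) by simp
        finally show "norm ((\<Sum>i<Suc n. h *\<^sub>R dX i u) - h *\<^sub>R A u (x u)) \<le> e * norm h" .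
      qed
      then show "\<forall>\<^sub>F n in sequentially. \<forall>u\<in>{a..b}. \<forall>h.
        norm ((\<Sum>i<n. h *\<^sub>R dX i u) - h *\<^sub>R A u (x u)) \<le> e * norm h"
        by (subst (asm) eventually_sequentially_Suc)
    qed
    then obtain g where g: "\<And>u. u \<in> {a..b} \<Longrightarrow> (\<lambda>n. X n u) sums g u"
      "(g has_derivative (\<lambda>h. h *\<^sub>R A t (x t))) (at t within {a..b})" using ab(4) by blast
    \<comment> \<open>Differentiating the series yields some sum function; uniqueness of sums
      identifies it with \<open>x\<close> on the interval.\<close>
    have "g u = x u" if "u \<in> {a..b}" for u using g(1) summ that sums_unique2 by blast
    then have "(x has_derivative (\<lambda>h. h *\<^sub>R A t (x t))) (at t within {a..b})"
      using g(2) ab(4) by (metis has_derivative_transform)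
    then show ?thesis using ab(5) by (simp add: has_vector_derivative_def)
  qed
  ultimately show ?thesis by blast
qed

section \<open>The pointwise matrix equation\<close>

lemma diag_matrix_nth [simp]: "diag_matrix d $ i $ j = (if i = j then d $ i else 0)"
  by (simp add: diag_matrix_def)

lemma matrix_diag_mult_right: "(B ** diag_matrix d) $ i $ j = B $ i $ j * d $ j"
  by (simp add: matrix_matrix_mult_def if_distrib cong: if_cong)

lemma matrix_diag_mult_left: "(diag_matrix d ** B) $ i $ j = d $ i * B $ i $ j"
proof -
  have "(diag_matrix d ** B) $ i $ j = (\<Sum>k\<in>UNIV. if k = i then d $ i * B $ i $ j else 0)"
    unfolding matrix_matrix_mult_def vec_lambda_beta by (rule sum.cong) auto
  then show ?thesis by simp
qed

lemma matrix_add_rdistrib: "(B + C) ** A = B ** A + C ** (A :: real^'n^'m)"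
  by (vector matrix_matrix_mult_def sum.distrib[symmetric] field_simps)

lemma symmetric_matrix_nth: "transpose A = A \<longleftrightarrow> (\<forall>i j. A $ j $ i = A $ i $ j)"
  by (simp add: transpose_def vec_eq_iff)

lemma skew_matrix_nth:
  "transpose A = - A \<longleftrightarrow> (\<forall>i j. A $ j $ i = - (A $ i $ j :: 'a::uminus))"
  by (simp add: transpose_def vec_eq_iff)

text \<open>In entries the equation is K_ij = B_ji d_j + d_i B_ij. If d_j = - d_i it reads K_ij =
  d_i (B_ij - B_ji): the skew part of B is prescribed, namely R, and the symmetric part P is free.
  Otherwise K_ij / (d_i + d_j) is a symmetric particular solution, and a solution C of the
  homogeneous equation satisfies C_ij / d_j = - C_ji / d_i, so that C_ij = Q_ij d_j with Q
  skew.\<close>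

lemma consistent_form_diagonal:
  fixes d :: "real^'n"
  assumes d: "\<And>i. d $ i \<noteq> 0" and K: "transpose K = K"
  shows "(\<exists>P Q R. transpose P = P \<and> transpose Q = - Q \<and> transpose R = - R \<and>
    (\<forall>i j. d $ i + d $ j = 0 \<longrightarrow> Q $ i $ j = 0 \<and> R $ i $ j = K $ i $ j / (2 * d $ i)) \<and>
    (\<forall>i j. d $ i + d $ j \<noteq> 0 \<longrightarrow>
       P $ i $ j = K $ i $ j / (d $ i + d $ j) \<and> R $ i $ j = 0) \<and>
    B = P + Q ** diag_matrix d + R) \<longleftrightarrow>
   K = transpose B ** diag_matrix d + diag_matrix d ** B" (is "?form \<longleftrightarrow> ?eq")
proof
  have Ks: "K $ j $ i = K $ i $ j" for i j using K by (simp add: symmetric_matrix_nth)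
  {
    assume ?form
    then obtain P Q R where P: "\<And>i j. P $ j $ i = P $ i $ j" and Q: "\<And>i j. Q $ j $ i = - Q $ i $ j"
      and R: "\<And>i j. R $ j $ i = - R $ i $ j"
      and 0: "\<And>i j. d $ i + d $ j = 0 \<Longrightarrow> Q $ i $ j = 0 \<and> R $ i $ j = K $ i $ j / (2 * d $ i)"
      and n0: "\<And>i j. d $ i + d $ j \<noteq> 0 \<Longrightarrow> P $ i $ j = K $ i $ j / (d $ i + d $ j) \<and> R $ i $ j = 0"
      and B: "B = P + Q ** diag_matrix d + R"
      unfolding symmetric_matrix_nth skew_matrix_nth by blast
    have "K $ i $ j = B $ j $ i * d $ j + d $ i * B $ i $ j" for i j
    proof -
      \<comment> \<open>By skewness Q contributes Q_ij d_i d_j - Q_ij d_i d_j = 0.\<close>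
      have *: "B $ j $ i * d $ j + d $ i * B $ i $ j
          = (d $ i + d $ j) * P $ i $ j + (d $ i - d $ j) * R $ i $ j"
        unfolding B by (simp add: matrix_diag_mult_right P[of i j] Q[of i j] R[of i j] algebra_simps)
      show ?thesis
      proof (cases "d $ i + d $ j = 0")
        case True
        then have "d $ i - d $ j = 2 * d $ i" by simp
        then show ?thesis unfolding * \<open>d $ i - d $ j = 2 * d $ i\<close> using True 0[OF True] d[of i] by simp
      next
        case False
        then show ?thesis unfolding * using n0[OF False] by simp
      qed
    qed
    then show ?eq
      by (simp add: vec_eq_iff matrix_diag_mult_right matrix_diag_mult_left transpose_def)
  }
  {
    assume ?eq
    then have eq: "K $ i $ j = B $ j $ i * d $ j + d $ i * B $ i $ j" for i j
      by (simp add: matrix_diag_mult_right matrix_diag_mult_left transpose_def)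
    \<comment> \<open>The choices are forced. Where d_i + d_j = 0, P is what remains of B after
      removing R; elsewhere Q is what remains of B after removing P, with the factor d_j divided
      out.\<close>
    define R :: "real^'n^'n" where
      "R = (\<chi> i j. if d $ i + d $ j = 0 then K $ i $ j / (2 * d $ i) else 0)"
    define P :: "real^'n^'n" where
      "P = (\<chi> i j. if d $ i + d $ j = 0 then B $ i $ j - K $ i $ j / (2 * d $ i)
              else K $ i $ j / (d $ i + d $ j))"
    define Q :: "real^'n^'n" where
      "Q = (\<chi> i j. if d $ i + d $ j = 0 then 0
              else (B $ i $ j - K $ i $ j / (d $ i + d $ j)) / d $ j)"
    have neg: "d $ j = - d $ i" if "d $ i + d $ j = 0" for i j using that by simp
    have "transpose P = P"
    proof -
      have "P $ j $ i = P $ i $ j" for i j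
      proof (cases "d $ i + d $ j = 0")
        case True
        show ?thesis
          using eq[of i j] d[of i] True
          by (simp add: P_def neg[OF True] Ks[of i j] field_simps)
      next
        case False
        then show ?thesis by (simp add: P_def Ks[of i j] add.commute)
      qed
      then show ?thesis unfolding symmetric_matrix_nth by blast
    qed
    moreover have "transpose R = - R"
    proof -
      have "R $ j $ i = - R $ i $ j" for i j
      proof (cases "d $ i + d $ j = 0")
        case True
        then show ?thesis by (simp add: R_def neg[OF True] Ks[of i j])
      next
        case False
        then show ?thesis by (simp add: R_def add.commute)
      qed
      then show ?thesis unfolding skew_matrix_nth by blast
    qed
    moreover have "transpose Q = - Q"
    proof -
      have "Q $ j $ i = - Q $ i $ j" for i j
      proof (cases "d $ i + d $ j = 0")
        case False
        have frac: "x / a = - (y / b)" if "x * b = - y * a" "a \<noteq> 0" "b \<noteq> 0" for x y a b :: real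
          using that by (simp add: field_simps)
        \<comment> \<open>\<open>q\<close> is unchanged when i and j are exchanged. Subtracting it
          from both entries of B leaves the homogeneous equation, and dividing by d_i d_j turns that
          into skewness of Q.\<close>
        define q where "q = K $ i $ j / (d $ i + d $ j)"
        have "K $ i $ j = q * (d $ i + d $ j)" using False by (simp add: q_def)
        with eq[of i j] have "(B $ j $ i - q) * d $ j = - (B $ i $ j - q) * d $ i"
          by (simp add: algebra_simps)
        then have "(B $ j $ i - q) / d $ i = - ((B $ i $ j - q) / d $ j)"
          by (rule frac) (fact d)+
        then show ?thesis using False
          by (simp add: Q_def q_def Ks[of i j] add.commute[of "d $ j"] del: minus_diff_eq)
      qed (simp add: Q_def add.commute)
      then show ?thesis unfolding skew_matrix_nth by blast
    qed
    moreover have "B = P + Q ** diag_matrix d + R"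
      using d by (auto simp: vec_eq_iff matrix_diag_mult_right P_def Q_def R_def)
    ultimately show ?form
      by (intro exI[of _ P] exI[of _ Q] exI[of _ R]) (auto simp: P_def Q_def R_def)
  }
qed

text \<open>Orthogonality makes conjugation by \<open>D\<close> act at once as the transformation of
  a bilinear form, for \<open>G\<close> and \<open>G'\<close>, and of an endomorphism, for \<Gamma>.
  Hence the equation keeps its shape in the eigenbasis.\<close>

lemma consistent_form_iff:
  fixes G D \<Gamma> G' :: "real^'n^'n" and d :: "real^'n"
  assumes D: "orthogonal_matrix D" and G: "transpose D ** G ** D = diag_matrix d"
    and d: "\<And>i. d $ i \<noteq> 0" and G': "transpose G' = G'"
  shows "consistent_form G D d (transpose D ** G' ** D) \<Gamma> \<longleftrightarrow>
    G' = transpose \<Gamma> ** G + G ** \<Gamma>"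
proof -
  have DD: "D ** transpose D = mat 1" "transpose D ** D = mat 1"
    using D by (auto simp: orthogonal_matrix_def)
  have DDx: "D ** (transpose D ** X) = X" "transpose D ** (D ** X) = X" for X :: "real^'n^'n"
    by (simp_all add: matrix_mul_assoc DD)
  have Geq: "G = D ** diag_matrix d ** transpose D"
    unfolding G[symmetric] by (simp add: DDx DD flip: matrix_mul_assoc)
  define B where "B = transpose D ** \<Gamma> ** D"
  have \<Gamma>: "\<Gamma> = D ** B ** transpose D"
    unfolding B_def by (simp add: DDx DD flip: matrix_mul_assoc)
  define K where "K = transpose D ** G' ** D"
  have K: "transpose K = K"
    unfolding K_def by (simp add: matrix_transpose_mul G' matrix_mul_assoc)
  have B_eq: "\<Gamma> = D ** C ** transpose D \<longleftrightarrow> B = C" for C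
  proof
    assume "\<Gamma> = D ** C ** transpose D"
    then show "B = C" unfolding B_def by (simp add: DDx DD flip: matrix_mul_assoc)
  qed (simp add: \<Gamma>)
  \<comment> \<open>The two displayed shapes of the solution agree because
    \<open>diag_matrix d ** transpose D = transpose D ** G\<close>.\<close>
  have second: "D ** (P + Q ** diag_matrix d + R) ** transpose D =
      D ** (P + R) ** transpose D + D ** Q ** transpose D ** G" for P Q R
    unfolding Geq
    by (simp add: matrix_add_ldistrib matrix_add_rdistrib matrix_mul_assoc[symmetric] DDx)
  have "consistent_form G D d K \<Gamma> \<longleftrightarrow>
    (\<exists>P Q R. transpose P = P \<and> transpose Q = - Q \<and> transpose R = - R \<and>
    (\<forall>i j. d $ i + d $ j = 0 \<longrightarrow> Q $ i $ j = 0 \<and> R $ i $ j = K $ i $ j / (2 * d $ i)) \<and>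
    (\<forall>i j. d $ i + d $ j \<noteq> 0 \<longrightarrow>
       P $ i $ j = K $ i $ j / (d $ i + d $ j) \<and> R $ i $ j = 0) \<and>
    B = P + Q ** diag_matrix d + R)"
    unfolding consistent_form_def second[symmetric] B_eq by simp
  also have "\<dots> \<longleftrightarrow> K = transpose B ** diag_matrix d + diag_matrix d ** B"
    by (rule consistent_form_diagonal[OF d K])
  also have "\<dots> \<longleftrightarrow> G' = transpose \<Gamma> ** G + G ** \<Gamma>"
  proof -
    have "transpose \<Gamma> ** G + G ** \<Gamma> =
      D ** (transpose B ** diag_matrix d + diag_matrix d ** B) ** transpose D"
      unfolding \<Gamma> Geq
      by (simp add: matrix_transpose_mul matrix_add_ldistrib matrix_add_rdistrib
          matrix_mul_assoc[symmetric] DDx)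
    moreover have "G' = D ** C ** transpose D \<longleftrightarrow> K = C" for C
      unfolding K_def by (auto simp: DDx DD simp flip: matrix_mul_assoc)
    ultimately show ?thesis by simp
  qed
  finally show ?thesis unfolding K_def .
qed

section \<open>Tangent spaces and dual frames\<close>

lemma sum_fun_apply: "(\<Sum>i\<in>I. f i) x = (\<Sum>i\<in>I. f i x)"
  by (induction I rule: infinite_finite_induct) (auto simp: zero_fun_def)

lemma scaleR_fun_apply [simp]: "(a *\<^sub>R f) x = a *\<^sub>R f x"
  by (simp add: scaleR_fun_def)

lemma linear_on_zero: "linear_on V f \<Longrightarrow> x \<in> V \<Longrightarrow> f 0 = 0"
  unfolding linear_on_def by (metis scaleR_zero_left)

lemma linear_on_sum:
  assumes "linear_on V f" "subspace V" "\<And>i. i \<in> I \<Longrightarrow> v i \<in> V"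
  shows "f (\<Sum>i\<in>I. a i *\<^sub>R v i) = (\<Sum>i\<in>I. a i *\<^sub>R f (v i))"
  using assms(3)
proof (induction I rule: infinite_finite_induct)
  case (insert i I)
  have "(\<Sum>i\<in>I. a i *\<^sub>R v i) \<in> V"
    using assms(2) insert.prems by (auto intro!: subspace_sum subspace_scale)
  moreover have "a i *\<^sub>R v i \<in> V" "v i \<in> V" using assms(2) insert.prems by (auto intro: subspace_scale)
  ultimately have "f (a i *\<^sub>R v i + (\<Sum>i\<in>I. a i *\<^sub>R v i)) = a i *\<^sub>R f (v i) + f (\<Sum>i\<in>I. a i *\<^sub>R v i)"
    using assms(1) unfolding linear_on_def by simp
  then show ?case using insert by simp
qed (use linear_on_zero[OF assms(1) subspace_0[OF assms(2)]] in auto)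

lemma linear_on_compose:
  assumes "linear_on V g" "g ` V \<subseteq> W" "linear_on W f"
  shows "linear_on V (\<lambda>x. f (g x))"
  using assms by (simp add: linear_on_def image_subset_iff)

lemma linear_on_cong:
  "(\<And>x. x \<in> V \<Longrightarrow> f x = g x) \<Longrightarrow> subspace V \<Longrightarrow> linear_on V f \<longleftrightarrow> linear_on V g"
  unfolding linear_on_def by (auto simp: subspace_add subspace_scale)

lemma subspace_cotangent_space: "subspace (cotangent_space A p)"
  unfolding subspace_def cotangent_space_def linear_on_def
  by (auto simp: algebra_simps zero_fun_def)

lemma cotangent_linear: "\<omega> \<in> cotangent_space A p \<Longrightarrow> linear_on (tangent_space A p) \<omega>"
  by (simp add: cotangent_space_def)

text \<open>Biorthogonality and expansion are the facts that calculations use, and both survive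
  linear isomorphisms. Coordinate frames, the given basis and transported frames are all treated
  through them.\<close>

definition dual_frame ::
  "('m, 'n::finite) chart set \<Rightarrow> 'm \<Rightarrow> ('n \<Rightarrow> ('m, 'n) tvec) \<Rightarrow> ('n \<Rightarrow> ('m, 'n) covec) \<Rightarrow> bool"
  where "dual_frame A p e \<theta> \<longleftrightarrow>
    (\<forall>k. e k \<in> tangent_space A p) \<and> (\<forall>k. \<theta> k \<in> cotangent_space A p) \<and>
    (\<forall>j k. \<theta> j (e k) = (if j = k then 1 else 0)) \<and>
    (\<forall>v\<in>tangent_space A p. v = (\<Sum>k\<in>UNIV. \<theta> k v *\<^sub>R e k))"

text \<open>The value off the tangent space is forced by \<open>cotangent_space\<close>. For a basis
  \<open>e\<close> of the tangent space the chosen coefficient vector is unique.\<close>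

definition dual_covec ::
  "('m, 'n::finite) chart set \<Rightarrow> 'm \<Rightarrow> ('n \<Rightarrow> ('m, 'n) tvec) \<Rightarrow> 'n \<Rightarrow> ('m, 'n) covec"
  where "dual_covec A p e k v = (if v \<in> tangent_space A p
    then (SOME x :: real^'n. v = (\<Sum>j\<in>UNIV. x $ j *\<^sub>R e j)) $ k else 0)"

lemma basis_coefficients_unique:
  fixes e :: "'n::finite \<Rightarrow> 'v::real_vector"
  assumes "inj e" "independent (range e)" "(\<Sum>j\<in>UNIV. x j *\<^sub>R e j) = (\<Sum>j\<in>UNIV. y j *\<^sub>R e j)"
  shows "x j = y j"
proof -
  \<comment> \<open>Independence speaks of sets of vectors, so the coefficients are moved from
    indices to vectors through the inverse of the injective family.\<close>
  define u where "u v = x (inv e v) - y (inv e v)" for v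
  have "(\<Sum>v\<in>range e. u v *\<^sub>R v) = (\<Sum>j\<in>UNIV. (x j - y j) *\<^sub>R e j)"
    by (subst sum.reindex[OF assms(1)]) (simp add: u_def inv_f_f[OF assms(1)])
  also have "\<dots> = 0" using assms(3) by (simp add: scaleR_diff_left sum_subtractf)
  finally have "\<forall>v\<in>range e. u v = 0"
    using assms(2) unfolding dependent_finite[OF finite_imageI[OF finite_class.finite_UNIV]] by blast
  then have "u (e j) = 0" by blast
  then show ?thesis by (simp add: u_def inv_f_f[OF assms(1)])
qed

lemma basis_coefficients_exist:
  fixes e :: "'n::finite \<Rightarrow> 'v::real_vector"
  assumes "inj e" "v \<in> span (range e)"
  shows "\<exists>x :: real^'n. v = (\<Sum>j\<in>UNIV. x $ j *\<^sub>R e j)"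
proof -
  obtain u where "v = (\<Sum>w\<in>range e. u w *\<^sub>R w)"
    using assms(2) span_finite[of "range e"] by auto
  also have "\<dots> = (\<Sum>j\<in>UNIV. (\<chi> j. u (e j)) $ j *\<^sub>R e j)"
    by (subst sum.reindex[OF assms(1)]) simp
  finally show ?thesis by blast
qed

section \<open>Jacobians, tangent spaces and dual frames at a point\<close>

locale c2_manifold =
  fixes A :: "('m::{t2_space, second_countable_topology}, 'n::finite) chart set"
  assumes atlas: "c2_atlas A"
begin

abbreviation jac :: "'m \<Rightarrow> ('m, 'n) chart \<Rightarrow> ('m, 'n) chart \<Rightarrow> real^'n \<Rightarrow> real^'n"
  where "jac p c c' \<equiv> frechet_derivative (chart_change c c') (at (snd c p))"

lemma ex_chart: "\<exists>c\<in>A. p \<in> fst c"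
  using atlas unfolding c2_atlas_def by blast

lemma chart_homeo:
  assumes "c \<in> A"
  shows "open (fst c)" "open (snd c ` fst c)"
    "homeomorphism (fst c) (snd c ` fst c) (snd c) (inv_into (fst c) (snd c))"
  using atlas assms unfolding c2_atlas_def by blast+

lemma chart_inv: "c \<in> A \<Longrightarrow> p \<in> fst c \<Longrightarrow> inv_into (fst c) (snd c) (snd c p) = p"
  using chart_homeo(3) by (simp add: homeomorphism_def)

text \<open>Makes the domains of the chart changes open, so that the derivatives within them
  supplied by the atlas are ordinary derivatives, as \<open>frechet_derivative\<close> at a point
  requires.\<close>

lemma chart_image_open:
  assumes c: "c \<in> A" and U: "open U"
  shows "open (snd c ` (fst c \<inter> U))"
proof -
  have "openin (top_of_set (fst c)) (fst c \<inter> U)" using U by (simp add: openin_open_Int)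
  from homeomorphism_imp_open_map[OF chart_homeo(3)[OF c] this]
  show ?thesis using chart_homeo(2)[OF c] by (simp add: openin_open_eq)
qed

lemma chart_change_apply:
  "c \<in> A \<Longrightarrow> p \<in> fst c \<Longrightarrow> chart_change c c' (snd c p) = snd c' p"
  by (simp add: chart_change_def chart_inv)

lemma chart_change_has_derivative:
  assumes "c \<in> A" "c' \<in> A" "p \<in> fst c" "p \<in> fst c'"
  shows "(chart_change c c' has_derivative jac p c c') (at (snd c p))"
proof -
  have "C2_on (snd c ` (fst c \<inter> fst c')) (chart_change c c')"
    using atlas assms unfolding c2_atlas_def by blast
  then have "chart_change c c' differentiable (at (snd c p) within (snd c ` (fst c \<inter> fst c')))"
    using assms unfolding C2_on_def differentiable_def by blast
  moreover have "open (snd c ` (fst c \<inter> fst c'))"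
    using chart_image_open assms chart_homeo(1) by blast
  ultimately have "chart_change c c' differentiable (at (snd c p))"
    using assms at_within_open by (metis IntI imageI)
  then show ?thesis by (simp add: frechet_derivative_works)
qed

lemma jac_linear:
  assumes "c \<in> A" "c' \<in> A" "p \<in> fst c" "p \<in> fst c'"
  shows "linear (jac p c c')"
  using chart_change_has_derivative[OF assms] has_derivative_linear by blast

text \<open>Chain rule: the chart changes compose on the image of the common domain of the three
  charts, which is open and so determines the derivative at the point.\<close>

lemma jac_trans:
  assumes "c \<in> A" "c' \<in> A" "c'' \<in> A" "p \<in> fst c" "p \<in> fst c'" "p \<in> fst c''"
  shows "jac p c c'' h = jac p c' c'' (jac p c c' h)"
proof -
  have D: "((\<lambda>x. chart_change c' c'' (chart_change c c' x)) has_derivative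
      (\<lambda>h. jac p c' c'' (jac p c c' h))) (at (snd c p))"
    by (rule has_derivative_compose[OF chart_change_has_derivative[OF assms(1,2,4,5)]])
      (use chart_change_has_derivative[OF assms(2,3,5,6)] chart_change_apply[OF assms(1,4)] in simp)
  have "(chart_change c c'' has_derivative (\<lambda>h. jac p c' c'' (jac p c c' h))) (at (snd c p))"
  proof (rule has_derivative_transform_within_open[OF D])
    show "open (snd c ` (fst c \<inter> (fst c' \<inter> fst c'')))"
      by (intro chart_image_open open_Int chart_homeo(1) assms)
    show "snd c p \<in> snd c ` (fst c \<inter> (fst c' \<inter> fst c''))" using assms by auto
    show "chart_change c' c'' (chart_change c c' x) = chart_change c c'' x"
      if "x \<in> snd c ` (fst c \<inter> (fst c' \<inter> fst c''))" for x
      using that assms by (auto simp: chart_change_apply)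
  qed
  then show ?thesis using frechet_derivative_at by metis
qed

lemma jac_self:
  assumes "c \<in> A" "p \<in> fst c"
  shows "jac p c c h = h"
proof -
  have "(chart_change c c has_derivative (\<lambda>h. h)) (at (snd c p))"
    by (rule has_derivative_transform_within_open[OF has_derivative_ident chart_homeo(2)[OF assms(1)]])
      (use assms in \<open>auto simp: chart_change_apply\<close>)
  then show ?thesis using frechet_derivative_at by metis
qed

lemma tangent_spaceI:
  assumes "\<And>c c'. c \<in> A \<Longrightarrow> c' \<in> A \<Longrightarrow> p \<in> fst c \<Longrightarrow> p \<in> fst c' \<Longrightarrow> v c' = jac p c c' (v c)"
    and "\<And>c. \<not> (c \<in> A \<and> p \<in> fst c) \<Longrightarrow> v c = 0"
  shows "v \<in> tangent_space A p"
  using assms unfolding tangent_space_def by blast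

lemma tangent_spaceD:
  assumes "v \<in> tangent_space A p"
  shows "c \<in> A \<Longrightarrow> c' \<in> A \<Longrightarrow> p \<in> fst c \<Longrightarrow> p \<in> fst c' \<Longrightarrow> v c' = jac p c c' (v c)"
    and "\<not> (c \<in> A \<and> p \<in> fst c) \<Longrightarrow> v c = 0"
  using assms unfolding tangent_space_def by blast+

lemma subspace_tangent_space: "subspace (tangent_space A p)"
proof (rule subspaceI)
  show "0 \<in> tangent_space A p"
    by (rule tangent_spaceI) (simp_all add: linear_0[OF jac_linear])
  show "v + w \<in> tangent_space A p" if "v \<in> tangent_space A p" "w \<in> tangent_space A p" for v w
  proof (rule tangent_spaceI)
    fix c c' assume c: "c \<in> A" "c' \<in> A" "p \<in> fst c" "p \<in> fst c'"
    show "(v + w) c' = jac p c c' ((v + w) c)"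
      using tangent_spaceD(1)[OF that(1) c] tangent_spaceD(1)[OF that(2) c]
      by (metis linear_add[OF jac_linear[OF c]] plus_fun_apply)
  qed (use that in \<open>simp add: tangent_spaceD(2)\<close>)
  show "a *\<^sub>R v \<in> tangent_space A p" if "v \<in> tangent_space A p" for a v
  proof (rule tangent_spaceI)
    fix c c' assume c: "c \<in> A" "c' \<in> A" "p \<in> fst c" "p \<in> fst c'"
    show "(a *\<^sub>R v) c' = jac p c c' ((a *\<^sub>R v) c)"
      using tangent_spaceD(1)[OF that c]
      by (metis linear_scale[OF jac_linear[OF c]] scaleR_fun_apply)
  qed (use that in \<open>simp add: tangent_spaceD(2)\<close>)
qed

text \<open>The Jacobians carry equality from one chart to all others at \<open>p\<close>, and
  elsewhere both families vanish.\<close>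

lemma tangent_eqI:
  assumes "v \<in> tangent_space A p" "w \<in> tangent_space A p" "c \<in> A" "p \<in> fst c" "v c = w c"
  shows "v = w"
proof
  fix c'
  show "v c' = w c'"
  proof (cases "c' \<in> A \<and> p \<in> fst c'")
    case True
    then show ?thesis
      using tangent_spaceD(1)[OF assms(1,3)] tangent_spaceD(1)[OF assms(2,3)] assms(4,5) by metis
  next
    case False
    then show ?thesis using assms by (simp add: tangent_spaceD(2))
  qed
qed

lemma coord_vec_tangent:
  assumes "c \<in> A" "p \<in> fst c"
  shows "coord_vec A p c k \<in> tangent_space A p"
proof (rule tangent_spaceI)
  fix c1 c2 assume c: "c1 \<in> A" "c2 \<in> A" "p \<in> fst c1" "p \<in> fst c2"
  show "coord_vec A p c k c2 = jac p c1 c2 (coord_vec A p c k c1)"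
    using c jac_trans[OF assms(1) c(1,2) assms(2) c(3,4)] by (simp add: coord_vec_def)
qed (auto simp: coord_vec_def)

lemma coord_vec_self: "c \<in> A \<Longrightarrow> p \<in> fst c \<Longrightarrow> coord_vec A p c k c = axis k 1"
  by (simp add: coord_vec_def jac_self)

lemma tangent_eq_sum_coord:
  assumes "v \<in> tangent_space A p" "c \<in> A" "p \<in> fst c"
  shows "v = (\<Sum>k\<in>UNIV. (v c $ k) *\<^sub>R coord_vec A p c k)"
proof (rule tangent_eqI[OF assms(1) _ assms(2,3)])
  show "(\<Sum>k\<in>UNIV. (v c $ k) *\<^sub>R coord_vec A p c k) \<in> tangent_space A p"
    by (intro subspace_sum subspace_scale subspace_tangent_space coord_vec_tangent assms)
  show "v c = (\<Sum>k\<in>UNIV. (v c $ k) *\<^sub>R coord_vec A p c k) c"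
    using basis_expansion[of "v c"] by (simp add: sum_fun_apply coord_vec_self assms scalar_mult_eq_scaleR)
qed

lemma coord_covec_cotangent: "coord_covec A p c k \<in> cotangent_space A p"
  using subspace_tangent_space[of p] unfolding cotangent_space_def coord_covec_def linear_on_def
  by (auto simp: subspace_add subspace_scale)

lemma dual_frame_coord:
  assumes "c \<in> A" "p \<in> fst c"
  shows "dual_frame A p (coord_vec A p c) (coord_covec A p c)"
  unfolding dual_frame_def
  using coord_vec_tangent[OF assms] coord_covec_cotangent tangent_eq_sum_coord[OF _ assms]
  by (auto simp: coord_covec_def coord_vec_self assms axis_def)

text \<open>Linearity and biorthogonality both come from uniqueness of the expansion: each asserted
  value is exhibited as a coefficient of an expansion in \<open>e\<close>.\<close>

lemma dual_frame_basis:
  fixes e :: "'n \<Rightarrow> ('m, 'n) tvec"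
  assumes inj: "inj e" and ind: "independent (range e)" and sp: "span (range e) = tangent_space A p"
  shows "dual_frame A p e (dual_covec A p e)"
proof -
  note sub = subspace_tangent_space[of p]
  have e: "e k \<in> tangent_space A p" for k
    using sp span_base[of "e k" "range e"] by auto
  have expand: "v = (\<Sum>k\<in>UNIV. dual_covec A p e k v *\<^sub>R e k)" if "v \<in> tangent_space A p" for v
  proof -
    have "v = (\<Sum>j\<in>UNIV. (SOME x :: real^'n. v = (\<Sum>j\<in>UNIV. x $ j *\<^sub>R e j)) $ j *\<^sub>R e j)"
      by (rule someI_ex) (rule basis_coefficients_exist[OF inj], use sp that in simp)
    then show ?thesis using that by (simp add: dual_covec_def)
  qed
  have uniq: "dual_covec A p e k v = x k"
    if "v \<in> tangent_space A p" "v = (\<Sum>k\<in>UNIV. x k *\<^sub>R e k)" for k v x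
    by (rule basis_coefficients_unique[OF inj ind, of "\<lambda>k. dual_covec A p e k v" x])
      (use expand[OF that(1)] that(2) in metis)
  have "dual_covec A p e k \<in> cotangent_space A p" for k
    unfolding cotangent_space_def linear_on_def
  proof (intro CollectI conjI ballI allI impI)
    fix v w assume v: "v \<in> tangent_space A p" and w: "w \<in> tangent_space A p"
    show "dual_covec A p e k (v + w) = dual_covec A p e k v + dual_covec A p e k w"
      by (rule uniq[OF subspace_add[OF sub v w]])
        (simp add: scaleR_add_left sum.distrib flip: expand[OF v] expand[OF w])
  next
    fix a v assume v: "v \<in> tangent_space A p"
    show "dual_covec A p e k (a *\<^sub>R v) = a *\<^sub>R dual_covec A p e k v"
      by (rule uniq[OF subspace_scale[OF sub v]])
        (simp flip: expand[OF v] scaleR_scaleR scaleR_sum_right)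
  qed (simp add: dual_covec_def)
  moreover have "dual_covec A p e j (e k) = (if j = k then 1 else 0)" for j k
    by (rule uniq[OF e]) (simp add: if_distrib[of "\<lambda>x. x *\<^sub>R _"] cong: if_cong)
  ultimately show ?thesis using e expand unfolding dual_frame_def by blast
qed

text \<open>Expanding the argument in the frame settles tangent vectors; off the tangent space both
  sides vanish.\<close>

lemma dual_frame_covec:
  assumes "dual_frame A p e \<theta>" "\<omega> \<in> cotangent_space A p"
  shows "\<omega> = (\<Sum>k\<in>UNIV. \<omega> (e k) *\<^sub>R \<theta> k)"
proof
  fix v
  have e: "\<And>k. e k \<in> tangent_space A p" and \<theta>: "\<And>k. \<theta> k \<in> cotangent_space A p"
    using assms(1) by (auto simp: dual_frame_def)
  show "\<omega> v = (\<Sum>k\<in>UNIV. \<omega> (e k) *\<^sub>R \<theta> k) v"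
  proof (cases "v \<in> tangent_space A p")
    case True
    then have "\<omega> v = \<omega> (\<Sum>k\<in>UNIV. \<theta> k v *\<^sub>R e k)" using assms(1) by (auto simp: dual_frame_def)
    also have "\<dots> = (\<Sum>k\<in>UNIV. \<theta> k v *\<^sub>R \<omega> (e k))"
      by (rule linear_on_sum[OF cotangent_linear[OF assms(2)] subspace_tangent_space e])
    finally show ?thesis by (simp add: sum_fun_apply mult.commute)
  next
    case False
    then show ?thesis using assms(2) \<theta> by (simp add: cotangent_space_def sum_fun_apply)
  qed
qed

text \<open>Basis independence of the trace: expand the vectors e' in \<open>e\<close>, exchange the
  sums, and recollect each \<theta> from its values on e'. It is applied to contractions, where a
  transported coordinate frame has to be compared with the coordinate frame of a chosen
  chart.\<close>

lemma dual_frame_trace: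
  assumes d1: "dual_frame A p e \<theta>" and d2: "dual_frame A p e' \<theta>'"
    and lin1: "\<And>v. v \<in> tangent_space A p \<Longrightarrow> linear_on (cotangent_space A p) (\<lambda>\<omega>. f \<omega> v)"
    and lin2: "\<And>\<omega>. \<omega> \<in> cotangent_space A p \<Longrightarrow> linear_on (tangent_space A p) (f \<omega>)"
  shows "(\<Sum>k\<in>UNIV. f (\<theta>' k) (e' k)) = (\<Sum>k\<in>UNIV. f (\<theta> k) (e k) :: real)"
proof -
  have e: "\<And>k. e k \<in> tangent_space A p" "\<And>k. e' k \<in> tangent_space A p"
    and \<theta>: "\<And>k. \<theta> k \<in> cotangent_space A p" "\<And>k. \<theta>' k \<in> cotangent_space A p"
    using d1 d2 by (auto simp: dual_frame_def)
  have "f (\<theta>' k) (e' k) = (\<Sum>j\<in>UNIV. \<theta> j (e' k) * f (\<theta>' k) (e j))" for k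
  proof -
    have "e' k = (\<Sum>j\<in>UNIV. \<theta> j (e' k) *\<^sub>R e j)"
      using d1 e(2)[of k] unfolding dual_frame_def by blast
    then have "f (\<theta>' k) (e' k) = f (\<theta>' k) (\<Sum>j\<in>UNIV. \<theta> j (e' k) *\<^sub>R e j)"
      by (rule arg_cong)
    also have "\<dots> = (\<Sum>j\<in>UNIV. \<theta> j (e' k) * f (\<theta>' k) (e j))"
      by (simp add: linear_on_sum[OF lin2[OF \<theta>(2)] subspace_tangent_space e(1)])
    finally show ?thesis .
  qed
  then have "(\<Sum>k\<in>UNIV. f (\<theta>' k) (e' k)) = (\<Sum>k\<in>UNIV. \<Sum>j\<in>UNIV. \<theta> j (e' k) * f (\<theta>' k) (e j))"
    by simp
  also have "\<dots> = (\<Sum>j\<in>UNIV. \<Sum>k\<in>UNIV. \<theta> j (e' k) * f (\<theta>' k) (e j))"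
    by (rule sum.swap)
  also have "\<dots> = (\<Sum>j\<in>UNIV. f (\<theta> j) (e j))"
  proof (rule sum.cong[OF refl])
    fix j
    have "f (\<theta> j) (e j) = f (\<Sum>k\<in>UNIV. \<theta> j (e' k) *\<^sub>R \<theta>' k) (e j)"
      using dual_frame_covec[OF d2 \<theta>(1)[of j]] by simp
    then show "(\<Sum>k\<in>UNIV. \<theta> j (e' k) * f (\<theta>' k) (e j)) = f (\<theta> j) (e j)"
      by (simp add: linear_on_sum[OF lin1[OF e(1)] subspace_cotangent_space \<theta>(2)])
  qed
  finally show ?thesis .
qed

end

section \<open>Tensors and frames along a path\<close>

lemma tensorsD:
  assumes "T \<in> tensors A p r q"
  shows "\<not> (length \<omega>s = r \<and> set \<omega>s \<subseteq> cotangent_space A p \<and>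
      length vs = q \<and> set vs \<subseteq> tangent_space A p) \<Longrightarrow> T \<omega>s vs = 0"
    and "length \<omega>s = r \<Longrightarrow> set \<omega>s \<subseteq> cotangent_space A p \<Longrightarrow> length vs = q \<Longrightarrow>
      set vs \<subseteq> tangent_space A p \<Longrightarrow> i < r \<Longrightarrow>
      linear_on (cotangent_space A p) (\<lambda>\<omega>. T (\<omega>s[i := \<omega>]) vs)"
    and "length \<omega>s = r \<Longrightarrow> set \<omega>s \<subseteq> cotangent_space A p \<Longrightarrow> length vs = q \<Longrightarrow>
      set vs \<subseteq> tangent_space A p \<Longrightarrow> j < q \<Longrightarrow>
      linear_on (tangent_space A p) (\<lambda>v. T \<omega>s (vs[j := v]))"
  using assms unfolding tensors_def by blast+

lemma tensors_subset_algebra: "tensors A p r q \<subseteq> tensor_algebra A p"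
  unfolding tensor_algebra_def by (rule order_trans[OF _ span_superset]) blast

lemma subspace_tensor_algebra: "subspace (tensor_algebra A p)"
  unfolding tensor_algebra_def by (rule subspace_span)

lemma tensors_0_2_linear:
  assumes "T \<in> tensors A p 0 2" "Y \<in> tangent_space A p"
  shows "linear_on (tangent_space A p) (\<lambda>X. T [] [X, Y])"
    and "linear_on (tangent_space A p) (\<lambda>X. T [] [Y, X])"
  using tensorsD(3)[OF assms(1), of "[]" "[Y, Y]" 0] tensorsD(3)[OF assms(1), of "[]" "[Y, Y]" 1]
    assms(2) by simp_all

lemma vec_tensor_in_tensors:
  assumes "v \<in> tangent_space A p"
  shows "vec_tensor A p v \<in> tensors A p 1 0"
proof -
  have "vec_tensor A p v ([\<omega>0][i := \<omega>]) [] = \<omega> v"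
    if "i < 1" "\<omega> \<in> cotangent_space A p" for \<omega> \<omega>0 :: "('a, 'b) covec" and i :: nat
    using that by (simp add: vec_tensor_def)
  then have "linear_on (cotangent_space A p) (\<lambda>\<omega>. vec_tensor A p v (\<omega>s[i := \<omega>]) [])"
    if "length \<omega>s = 1" "i < 1" for \<omega>s :: "('a, 'b) covec list" and i :: nat
    using that linear_on_cong[OF _ subspace_cotangent_space, of A p
        "\<lambda>\<omega>. vec_tensor A p v (\<omega>s[i := \<omega>]) []" "\<lambda>\<omega>. \<omega> v"]
    by (auto simp: length_Suc_conv linear_on_def)
  then show ?thesis
    unfolding tensors_def by (auto simp: vec_tensor_def)
qed

lemma vec_tensor_apply [simp]: "\<omega> \<in> cotangent_space A p \<Longrightarrow> vec_tensor A p v [\<omega>] [] = \<omega> v"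
  by (simp add: vec_tensor_def)

context c2_manifold begin

lemma inj_on_vec_tensor: "inj_on (vec_tensor A p) (tangent_space A p)"
proof (rule inj_onI)
  fix v w assume v: "v \<in> tangent_space A p" and w: "w \<in> tangent_space A p"
    and eq: "vec_tensor A p v = vec_tensor A p w"
  obtain c where c: "c \<in> A" "p \<in> fst c" using ex_chart by blast
  have "v c $ k = w c $ k" for k
    using fun_cong[OF fun_cong[OF eq], of "[coord_covec A p c k]" "[]"] v w
    by (simp add: coord_covec_cotangent) (simp add: coord_covec_def)
  then show "v = w" using tangent_eqI[OF v w c] by (simp add: vec_eq_iff)
qed

text \<open>Double duality in finite dimension. Together with injectivity of
  \<open>vec_tensor\<close> it gives \<open>vec_transport\<close> its meaning, since the inverse
  there is genuine only on the range.\<close>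

lemma tensors_1_0_vec:
  assumes T: "T \<in> tensors A p 1 0"
  shows "\<exists>v\<in>tangent_space A p. T = vec_tensor A p v"
proof -
  obtain c where c: "c \<in> A" "p \<in> fst c" using ex_chart by blast
  note df = dual_frame_coord[OF c]
  define v where "v = (\<Sum>k\<in>UNIV. T [coord_covec A p c k] [] *\<^sub>R coord_vec A p c k)"
  have v: "v \<in> tangent_space A p"
    unfolding v_def by (intro subspace_sum subspace_scale subspace_tangent_space coord_vec_tangent c)
  have lin: "linear_on (cotangent_space A p) (\<lambda>\<omega>. T [\<omega>] [])"
    using tensorsD(2)[OF T, of "[coord_covec A p c k]" "[]" 0 for k] by (simp add: coord_covec_cotangent)
  have "T [\<omega>] [] = \<omega> v" if \<omega>: "\<omega> \<in> cotangent_space A p" for \<omega>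
  proof -
    have "T [\<omega>] [] = T [\<Sum>k\<in>UNIV. \<omega> (coord_vec A p c k) *\<^sub>R coord_covec A p c k] []"
      using dual_frame_covec[OF df \<omega>] by simp
    also have "\<dots> = (\<Sum>k\<in>UNIV. \<omega> (coord_vec A p c k) * T [coord_covec A p c k] [])"
      using linear_on_sum[OF lin subspace_cotangent_space coord_covec_cotangent] by simp
    also have "\<dots> = \<omega> v"
      unfolding v_def
      by (simp add: linear_on_sum[OF cotangent_linear[OF \<omega>] subspace_tangent_space coord_vec_tangent[OF c]]
          mult.commute)
    finally show ?thesis .
  qed
  moreover have "T \<omega>s vs = 0" if "\<not> (vs = [] \<and> (\<exists>\<omega>\<in>cotangent_space A p. \<omega>s = [\<omega>]))" for \<omega>s vs
    by (rule tensorsD(1)[OF T]) (use that in \<open>auto simp: length_Suc_conv\<close>)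
  ultimately have "T = vec_tensor A p v"
    unfolding vec_tensor_def by (intro ext) auto
  then show ?thesis using v by blast
qed

lemma dual_frame_bilinear:
  assumes df: "dual_frame A p e \<theta>" and T: "T \<in> tensors A p 0 2"
    and X: "X \<in> tangent_space A p" and Y: "Y \<in> tangent_space A p"
  shows "T [] [X, Y] = (\<Sum>k\<in>UNIV. \<Sum>l\<in>UNIV. \<theta> k X * \<theta> l Y * T [] [e k, e l])"
proof -
  have e: "e k \<in> tangent_space A p" for k using df by (simp add: dual_frame_def)
  have XY: "X = (\<Sum>k\<in>UNIV. \<theta> k X *\<^sub>R e k)" "Y = (\<Sum>k\<in>UNIV. \<theta> k Y *\<^sub>R e k)"
    using df X Y by (auto simp: dual_frame_def)
  have "T [] [\<Sum>k\<in>UNIV. \<theta> k X *\<^sub>R e k, Y] = (\<Sum>k\<in>UNIV. \<theta> k X * T [] [e k, Y])"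
    using linear_on_sum[OF tensors_0_2_linear(1)[OF T Y] subspace_tangent_space e] by simp
  moreover have "T [] [e k, \<Sum>l\<in>UNIV. \<theta> l Y *\<^sub>R e l] = (\<Sum>l\<in>UNIV. \<theta> l Y * T [] [e k, e l])" for k
    using linear_on_sum[OF tensors_0_2_linear(2)[OF T e] subspace_tangent_space e] by simp
  ultimately show ?thesis
    unfolding XY(1)[symmetric] XY(2)[symmetric] by (simp add: sum_distrib_left mult.assoc)
qed

end

section \<open>Regularity of components along a path\<close>

locale frame_along = c2_manifold A
  for A :: "('m::{t2_space, second_countable_topology}, 'n::finite) chart set" +
  fixes J :: "real set" and \<gamma> :: "real \<Rightarrow> 'm" and E :: "'n \<Rightarrow> real \<Rightarrow> ('m, 'n) tvec"
  assumes path: "c1_path A J \<gamma>" and basis: "c1_basis A J \<gamma> E"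
begin

abbreviation \<theta> :: "real \<Rightarrow> 'n \<Rightarrow> ('m, 'n) covec"
  where "\<theta> s \<equiv> dual_covec A (\<gamma> s) (\<lambda>i. E i s)"

lemma nondegenerate: "nondegenerate_interval J"
  using path by (simp add: c1_path_def nondegenerate_interval_def)

lemma E_field: "c1_vector_field A J \<gamma> (E i)"
  using basis by (simp add: c1_basis_def)

lemma frame: "s \<in> J \<Longrightarrow> dual_frame A (\<gamma> s) (\<lambda>i. E i s) (\<theta> s)"
  using basis by (intro dual_frame_basis) (auto simp: c1_basis_def)

lemma E_tangent: "s \<in> J \<Longrightarrow> E i s \<in> tangent_space A (\<gamma> s)"
  and \<theta>_cotangent: "s \<in> J \<Longrightarrow> \<theta> s i \<in> cotangent_space A (\<gamma> s)"
  and \<theta>_E: "s \<in> J \<Longrightarrow> \<theta> s i (E j s) = (if i = j then 1 else 0)"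
  using frame[of s] by (auto simp: dual_frame_def)

lemma vec_expand: "s \<in> J \<Longrightarrow> v \<in> tangent_space A (\<gamma> s) \<Longrightarrow> v = (\<Sum>k\<in>UNIV. \<theta> s k v *\<^sub>R E k s)"
  using frame[of s] by (simp add: dual_frame_def)

text \<open>Supplies the relatively open pieces for \<open>C1_on_locally\<close>: the preimage of a
  chart domain under the continuous path is the trace on \<open>J\<close> of an open set.\<close>

lemma chart_nhd:
  assumes "s \<in> J"
  shows "\<exists>c U. c \<in> A \<and> \<gamma> s \<in> fst c \<and> open U \<and> s \<in> U \<and> {t\<in>J. \<gamma> t \<in> fst c} = J \<inter> U"
proof -
  obtain c where c: "c \<in> A" "\<gamma> s \<in> fst c" using ex_chart by blast
  have "continuous_on J \<gamma>" using path by (simp add: c1_path_def)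
  then obtain U where "open U" "U \<inter> J = \<gamma> -` fst c \<inter> J"
    using chart_homeo(1)[OF c(1)] unfolding continuous_on_open_invariant by blast
  then show ?thesis using c assms by (intro exI[of _ c] exI[of _ U]) auto
qed

text \<open>Cramer's rule in one chart shows the frame components as quotients of determinants in
  chart components, so that they inherit the regularity of the field and of the frame.\<close>

lemma components_cramer:
  assumes c: "c \<in> A" "\<gamma> t \<in> fst c" and t: "t \<in> J" and X: "X \<in> tangent_space A (\<gamma> t)"
  defines "M \<equiv> \<chi> i j. E j t c $ i"
  shows "det M \<noteq> 0"
    and "\<theta> t k X = det (\<chi> i j. if j = k then X c $ i else M $ i $ j) / det M"
proof -
  have M: "M *v x = (\<Sum>j\<in>UNIV. x $ j *\<^sub>R E j t) c" for x
    by (simp add: M_def vec_eq_iff matrix_vector_mult_def sum_fun_apply mult.commute)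
  \<comment> \<open>A kernel vector of \<open>M\<close> combines the frame to a tangent vector with
    zero components in \<open>c\<close>, hence to zero; independence of the frame then gives zero
    coefficients.\<close>
  have "x = 0" if "M *v x = 0" for x
  proof -
    have "(\<Sum>j\<in>UNIV. x $ j *\<^sub>R E j t) = 0"
      by (rule tangent_eqI[OF _ _ c])
        (use that M subspace_tangent_space E_tangent[OF t] in
          \<open>auto intro!: subspace_sum subspace_scale subspace_0\<close>)
    then have "x $ j = 0" for j
      using basis_coefficients_unique[of "\<lambda>j. E j t" "\<lambda>j. x $ j" "\<lambda>_. 0"] basis t
      by (simp add: c1_basis_def)
    then show ?thesis by (simp add: vec_eq_iff)
  qed
  then show d: "det M \<noteq> 0"
    using matrix_left_invertible_ker[of M] invertible_left_inverse[of M] invertible_det_nz[of M] by blast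
  have "M *v (\<chi> j. \<theta> t j X) = X c"
    using vec_expand[OF t X] M by simp
  then have "(\<chi> j. \<theta> t j X) = (\<chi> k. det (\<chi> i j. if j = k then X c $ i else M $ i $ j) / det M)"
    using cramer[OF d] by blast
  then show "\<theta> t k X = det (\<chi> i j. if j = k then X c $ i else M $ i $ j) / det M"
    by (simp add: vec_eq_iff)
qed

lemma vector_field_C1:
  "c1_vector_field A J \<gamma> X \<Longrightarrow> c \<in> A \<Longrightarrow> C1_on {s\<in>J. \<gamma> s \<in> fst c} (\<lambda>s. X s c)"
  by (simp add: c1_vector_field_def)

lemma components_C1:
  assumes X: "c1_vector_field A J \<gamma> X"
  shows "C1_on J (\<lambda>s. \<theta> s k (X s))"
proof (rule C1_on_locally[OF nondegenerate])
  fix s assume s: "s \<in> J"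
  obtain c U where c: "c \<in> A" "\<gamma> s \<in> fst c" "open U" "s \<in> U" "{t\<in>J. \<gamma> t \<in> fst c} = J \<inter> U"
    using chart_nhd[OF s] by (elim exE conjE) (rule that; assumption)
  have in_c: "t \<in> J" "\<gamma> t \<in> fst c" if "t \<in> J \<inter> U" for t using c(5) that by blast+
  have field: "C1_on (J \<inter> U) (\<lambda>s. Y s c $ i)" if "c1_vector_field A J \<gamma> Y" for Y i
    by (rule C1_on_vec_nth[OF vector_field_C1[OF that c(1), unfolded c(5)]])
  define M where "M t = (\<chi> i j. E j t c $ i)" for t
  define N where "N t = (\<chi> i j. if j = k then X t c $ i else M t $ i $ j)" for t
  have Xt: "t \<in> J \<Longrightarrow> X t \<in> tangent_space A (\<gamma> t)" for t using X by (simp add: c1_vector_field_def)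
  have "C1_on (J \<inter> U) (\<lambda>t. det (N t) / det (M t))"
  proof (intro C1_on_divide C1_on_det)
    show MC: "C1_on (J \<inter> U) (\<lambda>t. M t $ i $ j)" for i j
      unfolding M_def by (simp add: field E_field)
    show "C1_on (J \<inter> U) (\<lambda>t. N t $ i $ j)" for i j
      by (cases "j = k") (simp_all add: N_def field X MC)
    show "det (M t) \<noteq> 0" if "t \<in> J \<inter> U" for t
      unfolding M_def by (rule components_cramer(1)[OF c(1) in_c(2,1)[OF that] Xt[OF in_c(1)[OF that]]])
  qed
  moreover have "\<theta> t k (X t) = det (N t) / det (M t)" if "t \<in> J \<inter> U" for t
    unfolding N_def M_def by (rule components_cramer(2)[OF c(1) in_c(2,1)[OF that] Xt[OF in_c(1)[OF that]]])
  ultimately have "C1_on (J \<inter> U) (\<lambda>s. \<theta> s k (X s))"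
    by (rule C1_on_cong[OF refl, THEN iffD2, rotated])
  then show "\<exists>U. open U \<and> s \<in> U \<and> C1_on (J \<inter> U) (\<lambda>s. \<theta> s k (X s))" using c by blast
qed

text \<open>Admits the dual frame as a test field in the regularity clause of
  \<open>S_transport\<close>.\<close>

lemma \<theta>_field: "c1_covector_field A J \<gamma> (\<lambda>s. \<theta> s k)"
  unfolding c1_covector_field_def by (simp add: \<theta>_cotangent components_C1)

text \<open>\<open>c1_metric\<close> controls the metric only in coordinate frames, as a function of
  the coordinates. Locally the basis is therefore expanded in the coordinate frame of one chart, and
  the coordinate components are composed with the path.\<close>

lemma metric_matrix_C1:
  assumes g: "c1_metric A g"
  shows "C1_on J (metric_matrix g \<gamma> E)"
proof (rule C1_on_locally[OF nondegenerate])
  fix s assume s: "s \<in> J"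
  obtain c U where c: "c \<in> A" "\<gamma> s \<in> fst c" "open U" "s \<in> U" "{t\<in>J. \<gamma> t \<in> fst c} = J \<inter> U"
    using chart_nhd[OF s] by (elim exE conjE) (rule that; assumption)
  have in_c: "t \<in> J" "\<gamma> t \<in> fst c" if "t \<in> J \<inter> U" for t using c(5) that by blast+
  have field: "C1_on (J \<inter> U) (\<lambda>s. E j s c $ i)" for j i
    by (rule C1_on_vec_nth[OF vector_field_C1[OF E_field c(1), unfolded c(5)]])
  define h where "h k l x = (let p = inv_into (fst c) (snd c) x
      in g p [] [coord_vec A p c k, coord_vec A p c l])" for k l x
  have hC: "C1_on (snd c ` fst c) (h k l)" for k l
    using g c(1) unfolding c1_metric_def h_def by blast
  have path_c: "C1_on (J \<inter> U) (\<lambda>s. snd c (\<gamma> s))"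
    using path c(1) unfolding c1_path_def c(5)[symmetric] by blast
  have hC: "C1_on (J \<inter> U) (\<lambda>t. h k l (snd c (\<gamma> t)))" for k l
    by (rule C1_on_compose[OF hC path_c]) (use in_c in auto)
  have "C1_on (J \<inter> U) (\<lambda>t. metric_matrix g \<gamma> E t $ i $ j)" for i j
  proof -
    have "C1_on (J \<inter> U) (\<lambda>t. \<Sum>k\<in>UNIV. \<Sum>l\<in>UNIV. E i t c $ k * E j t c $ l * h k l (snd c (\<gamma> t)))"
      by (intro C1_on_sum C1_on_mult field hC)
    moreover have "metric_matrix g \<gamma> E t $ i $ j =
      (\<Sum>k\<in>UNIV. \<Sum>l\<in>UNIV. E i t c $ k * E j t c $ l * h k l (snd c (\<gamma> t)))" if "t \<in> J \<inter> U" for t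
    proof -
      note t = in_c[OF that]
      have "g (\<gamma> t) \<in> tensors A (\<gamma> t) 0 2" using g by (simp add: c1_metric_def)
      from dual_frame_bilinear[OF dual_frame_coord[OF c(1) t(2)] this E_tangent[OF t(1), of i] E_tangent[OF t(1), of j]]
      show ?thesis
        by (simp add: metric_matrix_def h_def Let_def chart_inv[OF c(1) t(2)] coord_covec_def E_tangent[OF t(1)])
    qed
    ultimately show ?thesis
      by (rule C1_on_cong[OF refl, THEN iffD2, rotated])
  qed
  then have "C1_on (J \<inter> U) (metric_matrix g \<gamma> E)" by (rule C1_on_matrixI)
  then show "\<exists>U. open U \<and> s \<in> U \<and> C1_on (J \<inter> U) (metric_matrix g \<gamma> E)" using c by blast
qed

end

section \<open>Isometric matrix cocycles\<close>

lemma bounded_bilinear_matrix_mult: "bounded_bilinear ((**) :: real^'n^'m \<Rightarrow> real^'k^'n \<Rightarrow> real^'k^'m)"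
proof -
  have "bilinear ((**) :: real^'n^'m \<Rightarrow> real^'k^'n \<Rightarrow> real^'k^'m)"
    unfolding bilinear_def
    by (auto intro!: linearI simp: vec_eq_iff matrix_matrix_mult_def sum.distrib algebra_simps sum_distrib_left)
  then show ?thesis by (rule bilinear_conv_bounded_bilinear[THEN iffD1])
qed

lemmas has_vector_derivative_matrix_mult =
  bounded_bilinear.has_vector_derivative[OF bounded_bilinear_matrix_mult]

lemma bounded_linear_transpose: "bounded_linear (transpose :: real^'n^'m \<Rightarrow> real^'m^'n)"
  by (rule linear_conv_bounded_linear[THEN iffD1], rule linearI) (simp_all add: transpose_def vec_eq_iff)

lemmas has_vector_derivative_transpose =
  bounded_linear.has_vector_derivative[OF bounded_linear_transpose]

lemmas matrix_minus_simps =
  bounded_bilinear.minus_left[OF bounded_bilinear_matrix_mult]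
  bounded_bilinear.minus_right[OF bounded_bilinear_matrix_mult]

text \<open>The derivative of \<open>H\<close> is given on the diagonal in the second argument; in
  the first argument only differentiability is assumed. The derivative there is recovered from the
  fact that \<open>H t r\<close> and \<open>H r t\<close> are mutually inverse.\<close>

lemma matrix_cocycle_isometry_iff:
  fixes H :: "real \<Rightarrow> real \<Rightarrow> real^'n^'n" and G G' \<Gamma> :: "real \<Rightarrow> real^'n^'n"
  assumes J: "nondegenerate_interval J"
    and comp: "\<And>r s t. r \<in> J \<Longrightarrow> s \<in> J \<Longrightarrow> t \<in> J \<Longrightarrow> H r t ** H t s = H r s"
    and id: "\<And>s. s \<in> J \<Longrightarrow> H s s = mat 1"
    and diag: "\<And>s. s \<in> J \<Longrightarrow> (H s has_vector_derivative \<Gamma> s) (at s within J)"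
    and diff: "\<And>s t. s \<in> J \<Longrightarrow> t \<in> J \<Longrightarrow> (\<lambda>s. H s t) differentiable (at s within J)"
    and G: "\<And>s. s \<in> J \<Longrightarrow> (G has_vector_derivative G' s) (at s within J)"
  shows "(\<forall>s\<in>J. \<forall>t\<in>J. G s = transpose (H t s) ** G t ** H t s) \<longleftrightarrow>
    (\<forall>s\<in>J. G' s = transpose (\<Gamma> s) ** G s + G s ** \<Gamma> s)"
proof (intro iffI ballI)
  fix s assume iso: "\<forall>s\<in>J. \<forall>t\<in>J. G s = transpose (H t s) ** G t ** H t s" and s: "s \<in> J"
  have "((\<lambda>r. transpose (H s r) ** G s ** H s r) has_vector_derivative
      transpose (H s s) ** G s ** \<Gamma> s
        + (transpose (H s s) ** 0 + transpose (\<Gamma> s) ** G s) ** H s s) (at s within J)"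
    by (intro has_vector_derivative_matrix_mult has_vector_derivative_transpose diag s
        has_vector_derivative_const)
  then have "((\<lambda>r. transpose (H s r) ** G s ** H s r) has_vector_derivative
      transpose (\<Gamma> s) ** G s + G s ** \<Gamma> s) (at s within J)"
    by (simp add: id[OF s] transpose_mat add.commute)
  then have "(G has_vector_derivative transpose (\<Gamma> s) ** G s + G s ** \<Gamma> s) (at s within J)"
    by (rule has_vector_derivative_transform[OF s, rotated]) (use iso s in blast)
  then show "G' s = transpose (\<Gamma> s) ** G s + G s ** \<Gamma> s"
    by (rule vector_derivative_unique_within[OF nondegenerate_interval_trivial_limit[OF J s] G[OF s]])
next
  fix t s assume eq: "\<forall>s\<in>J. G' s = transpose (\<Gamma> s) ** G s + G s ** \<Gamma> s" and t: "t \<in> J" and "s \<in> J"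
  \<comment> \<open>The pullback to \<open>t\<close> of the metric at \<open>r\<close>; its value at
    \<open>r = t\<close> is \<open>G t\<close>, so constancy is the isometry property.\<close>
  define \<psi> where "\<psi> r = transpose (H r t) ** G r ** H r t" for r
  have "(\<psi> has_vector_derivative 0) (at r within J)" if r: "r \<in> J" for r
  proof -
    obtain h where h: "((\<lambda>s. H s t) has_vector_derivative h) (at r within J)"
      using diff[OF r t] vector_derivative_works by blast
    \<comment> \<open>The factorisation through \<open>r\<close> carries the derivative from the
      diagonal to arbitrary \<open>t\<close>.\<close>
    have "((\<lambda>r'. H t r ** H r r') has_vector_derivative H t r ** \<Gamma> r + 0 ** H r r) (at r within J)"
      by (intro has_vector_derivative_matrix_mult has_vector_derivative_const diag r)
    then have "(H t has_vector_derivative H t r ** \<Gamma> r + 0 ** H r r) (at r within J)"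
      by (rule has_vector_derivative_transform[OF r, rotated]) (simp add: comp r t)
    then have "(H t has_vector_derivative H t r ** \<Gamma> r) (at r within J)" by simp
    \<comment> \<open>The product \<open>H t r' ** H r' t\<close> is constantly the identity, so its
      derivative ties the unknown \<open>h\<close> to \<Gamma>.\<close>
    from has_vector_derivative_matrix_mult[OF this h]
    have "((\<lambda>r'. H t r' ** H r' t) has_vector_derivative
        H t r ** h + H t r ** \<Gamma> r ** H r t) (at r within J)" .
    then have "((\<lambda>r'. mat 1) has_vector_derivative
        H t r ** h + H t r ** \<Gamma> r ** H r t) (at r within J)"
      by (rule has_vector_derivative_transform[OF r, rotated]) (simp add: comp id t)
    from vector_derivative_unique_within[OF nondegenerate_interval_trivial_limit[OF J r]
        has_vector_derivative_const this]
    have "H t r ** h + H t r ** \<Gamma> r ** H r t = 0" by simp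
    then have "H r t ** (H t r ** h + H t r ** \<Gamma> r ** H r t) = 0" by simp
    then have "h = - (\<Gamma> r ** H r t)"
      by (simp add: matrix_add_ldistrib matrix_mul_assoc comp id r t eq_neg_iff_add_eq_0)
    with h have h': "((\<lambda>s. H s t) has_vector_derivative - (\<Gamma> r ** H r t)) (at r within J)" by simp
    have "(\<psi> has_vector_derivative
        transpose (H r t) ** G r ** (- (\<Gamma> r ** H r t))
        + (transpose (H r t) ** G' r + transpose (- (\<Gamma> r ** H r t)) ** G r) ** H r t) (at r within J)"
      unfolding \<psi>_def
      by (intro has_vector_derivative_matrix_mult has_vector_derivative_transpose h' G r)
    moreover have "transpose (- X) = - transpose X" for X :: "real^'n^'n"
      by (simp add: transpose_def vec_eq_iff)
    \<comment> \<open>Once \<open>G' r\<close> is replaced by its expression in \<Gamma>, all terms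
      cancel.\<close>
    ultimately show ?thesis
      using eq r by (simp add: matrix_minus_simps matrix_transpose_mul matrix_mul_assoc
          bounded_bilinear.add_left[OF bounded_bilinear_matrix_mult] matrix_add_ldistrib)
  qed
  then have "\<psi> s = \<psi> t"
    using J \<open>s \<in> J\<close> t unfolding has_vector_derivative_def nondegenerate_interval_def
    by (intro has_derivative_zero_unique[of J]) (auto simp: is_interval_convex)
  then show "G t = transpose (H s t) ** G s ** H s t"
    by (simp add: \<psi>_def id t transpose_mat)
qed

section \<open>The matrix of an S-transport\<close>

text \<open>The difference quotients defining the coefficients run over this set of increments, and
  their limit at 0 is unique because the set has no isolated points.\<close>

lemma nondegenerate_interval_translate:
  assumes "nondegenerate_interval J"
  shows "nondegenerate_interval {\<epsilon>. s + \<epsilon> \<in> J}"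
proof -
  obtain a b where ab: "a \<in> J" "b \<in> J" "a < b"
    and I: "\<And>x y z. x \<in> J \<Longrightarrow> y \<in> J \<Longrightarrow> x \<le> z \<Longrightarrow> z \<le> y \<Longrightarrow> z \<in> J"
    using assms unfolding nondegenerate_interval_def is_interval_1 by blast
  have "a - s \<in> {\<epsilon>. s + \<epsilon> \<in> J}" "b - s \<in> {\<epsilon>. s + \<epsilon> \<in> J}" "a - s < b - s" using ab by auto
  moreover have "z \<in> {\<epsilon>. s + \<epsilon> \<in> J}"
    if "x \<in> {\<epsilon>. s + \<epsilon> \<in> J}" "y \<in> {\<epsilon>. s + \<epsilon> \<in> J}" "x \<le> z" "z \<le> y" for x y z
    using that I[of "s + x" "s + y" "s + z"] by simp
  ultimately show ?thesis unfolding nondegenerate_interval_def is_interval_1 by blast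
qed

lemma has_real_derivative_increment_limit:
  assumes "(f has_real_derivative D) (at s within J)"
  shows "((\<lambda>\<epsilon>. (f (s + \<epsilon>) - f s) / \<epsilon>) \<longlongrightarrow> D) (at 0 within {\<epsilon>. s + \<epsilon> \<in> J})"
proof -
  have "((\<lambda>\<epsilon>. s + \<epsilon>) \<longlongrightarrow> s + 0) (at 0 within {\<epsilon>. s + \<epsilon> \<in> J})"
    by (intro tendsto_intros)
  then have "filterlim (\<lambda>\<epsilon>. s + \<epsilon>) (at s within J) (at 0 within {\<epsilon>. s + \<epsilon> \<in> J})"
    by (auto simp: filterlim_at eventually_at_filter)
  from filterlim_compose[OF assms[unfolded has_field_derivative_iff] this]
  show ?thesis by simp
qed

text \<open>The total derivative is evaluated at diagonal points on the direction (1, 0). With the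
  start parameter as first argument this is the derivative that defines \<Gamma>, and its continuity
  along the diagonal becomes continuity of \<Gamma>.\<close>

lemma C1_on_partial2:
  fixes f :: "real \<times> real \<Rightarrow> 'a::real_normed_vector"
  assumes "C1_on (J \<times> J) f"
  shows "\<exists>D. continuous_on J D \<and>
    (\<forall>s\<in>J. ((\<lambda>t. f (t, s)) has_vector_derivative D s) (at s within J))"
proof -
  obtain f' where f': "\<And>x. x \<in> J \<times> J \<Longrightarrow> (f has_derivative f' x) (at x within (J \<times> J))"
    "\<And>h. continuous_on (J \<times> J) (\<lambda>x. f' x h)"
    using C1_onE[OF assms] by metis
  have "((\<lambda>t. f (t, s)) has_vector_derivative f' (s, s) (1, 0)) (at s within J)" if s: "s \<in> J" for s
  proof -
    have "((\<lambda>t. (t, s)) has_derivative (\<lambda>h. (h, 0))) (at s within J)"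
      by (auto intro!: derivative_eq_intros)
    moreover have "(f has_derivative f' (s, s)) (at (s, s) within (\<lambda>t. (t, s)) ` J)"
      by (rule has_derivative_subset[OF f'(1)]) (use s in auto)
    ultimately have "((\<lambda>t. f (t, s)) has_derivative (\<lambda>h. f' (s, s) (h, 0))) (at s within J)"
      by (rule has_derivative_in_compose)
    moreover have "(\<lambda>h. f' (s, s) (h, 0)) = (\<lambda>h. h *\<^sub>R f' (s, s) (1, 0))"
    proof (rule ext)
      fix h show "f' (s, s) (h, 0) = h *\<^sub>R f' (s, s) (1, 0)"
        using linear_scale[OF has_derivative_linear[OF f'(1)], of "(s, s)" h "(1, 0)"] s by simp
    qed
    ultimately show ?thesis by (simp only: has_vector_derivative_def)
  qed
  moreover have "continuous_on J (\<lambda>s. f' (s, s) (1, 0))"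
    by (rule continuous_on_compose2[OF f'(2)]) (auto intro!: continuous_intros)
  ultimately show ?thesis by blast
qed

lemma tendsto_fun_apply:
  fixes f :: "'a \<Rightarrow> 'b \<Rightarrow> 'c::topological_space"
  assumes "(f \<longlongrightarrow> l) F"
  shows "((\<lambda>x. f x c) \<longlongrightarrow> l c) F"
proof (rule topological_tendstoI)
  fix U :: "'c set" assume U: "open U" "l c \<in> U"
  have "open ((\<lambda>g::'b \<Rightarrow> 'c. g c) -` U)"
    using U(1) continuous_on_product_coordinates by (rule open_vimage)
  from topological_tendstoD[OF assms this] U(2)
  show "eventually (\<lambda>x. f x c \<in> U) F" by simp
qed

lemma S_transportD:
  assumes "S_transport A J \<gamma> S" "s \<in> J" "t \<in> J"
  shows "linear_on (tensor_algebra A (\<gamma> s)) (S s t)"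
    and "T \<in> tensors A (\<gamma> s) p q \<Longrightarrow> S s t T \<in> tensors A (\<gamma> t) p q"
    and "r \<in> J \<Longrightarrow> T \<in> tensor_algebra A (\<gamma> s) \<Longrightarrow> S t r (S s t T) = S s r T"
    and "T \<in> tensor_algebra A (\<gamma> s) \<Longrightarrow> S s s T = T"
proof -
  note def = assms(1)[unfolded S_transport_def]
  note st = conjunct2[OF bspec[OF bspec[OF conjunct1[OF def] assms(2)] assms(3)]]
  show "linear_on (tensor_algebra A (\<gamma> s)) (S s t)" by (rule conjunct1[OF st])
  show "T \<in> tensors A (\<gamma> s) p q \<Longrightarrow> S s t T \<in> tensors A (\<gamma> t) p q"
    using conjunct1[OF conjunct2[OF st]] by blast
  show "r \<in> J \<Longrightarrow> T \<in> tensor_algebra A (\<gamma> s) \<Longrightarrow> S t r (S s t T) = S s r T"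
    using conjunct1[OF conjunct2[OF def]] assms(2,3) by blast
  show "T \<in> tensor_algebra A (\<gamma> s) \<Longrightarrow> S s s T = T"
    using conjunct1[OF conjunct2[OF conjunct2[OF def]]] assms(2) by blast
qed

lemma S_transport_C1:
  assumes "S_transport A J \<gamma> S" "c1_tensor_field A J \<gamma> T"
    and "\<forall>\<omega>\<in>set \<omega>s. c1_covector_field A J \<gamma> \<omega>" "\<forall>X\<in>set Xs. c1_vector_field A J \<gamma> X"
  shows "C1_on (J \<times> J) (\<lambda>(s, t). S s t (T s) (map (\<lambda>\<omega>. \<omega> t) \<omega>s) (map (\<lambda>X. X t) Xs))"
proof -
  from assms(1) have "\<forall>T \<omega>s Xs. c1_tensor_field A J \<gamma> T \<longrightarrow>
        (\<forall>\<omega>\<in>set \<omega>s. c1_covector_field A J \<gamma> \<omega>) \<longrightarrow>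
        (\<forall>X\<in>set Xs. c1_vector_field A J \<gamma> X) \<longrightarrow>
      C1_on (J \<times> J) (\<lambda>(s, t). S s t (T s) (map (\<lambda>\<omega>. \<omega> t) \<omega>s) (map (\<lambda>X. X t) Xs))"
    unfolding S_transport_def by (elim conjE) assumption
  then show ?thesis using assms(2-4) by blast
qed

context frame_along begin

text \<open>Preservation of type keeps the image of a vector among the tensors of type (1,0), which
  is the range of \<open>vec_tensor\<close>.\<close>

lemma vec_transport_props:
  assumes S: "S_transport A J \<gamma> S" and s: "s \<in> J" and t: "t \<in> J" and v: "v \<in> tangent_space A (\<gamma> s)"
  shows "vec_transport A \<gamma> S s t v \<in> tangent_space A (\<gamma> t)"
    and "vec_tensor A (\<gamma> t) (vec_transport A \<gamma> S s t v) = S s t (vec_tensor A (\<gamma> s) v)"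
proof -
  have "S s t (vec_tensor A (\<gamma> s) v) \<in> tensors A (\<gamma> t) 1 0"
    by (rule S_transportD(2)[OF S s t vec_tensor_in_tensors[OF v]])
  then have "S s t (vec_tensor A (\<gamma> s) v) \<in> vec_tensor A (\<gamma> t) ` tangent_space A (\<gamma> t)"
    using tensors_1_0_vec by blast
  then show "vec_transport A \<gamma> S s t v \<in> tangent_space A (\<gamma> t)"
    and "vec_tensor A (\<gamma> t) (vec_transport A \<gamma> S s t v) = S s t (vec_tensor A (\<gamma> s) v)"
    unfolding vec_transport_def by (auto simp: inv_into_f_f[OF inj_on_vec_tensor])
qed

lemma vec_transport_eqI:
  assumes "w \<in> tangent_space A (\<gamma> t)" "S s t (vec_tensor A (\<gamma> s) v) = vec_tensor A (\<gamma> t) w"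
  shows "vec_transport A \<gamma> S s t v = w"
  using assms inv_into_f_f[OF inj_on_vec_tensor] by (simp add: vec_transport_def)

text \<open>The end parameter comes first, so that composition of transports is the matrix product
  in the same order.\<close>

definition transport_matrix ::
  "(real \<Rightarrow> real \<Rightarrow> ('m, 'n) tensor \<Rightarrow> ('m, 'n) tensor) \<Rightarrow> real \<Rightarrow> real \<Rightarrow> real^'n^'n"
  where "transport_matrix S t s = (\<chi> i j. \<theta> t i (vec_transport A \<gamma> S s t (E j s)))"

lemma vec_tensor_algebra: "v \<in> tangent_space A p \<Longrightarrow> vec_tensor A p v \<in> tensor_algebra A p"
  by (rule subsetD[OF tensors_subset_algebra vec_tensor_in_tensors])

text \<open>Linearity on the tensor algebra is transferred to vectors by expanding
  \<open>vec_tensor\<close> of the argument in the frame.\<close>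

lemma \<theta>_vec_transport:
  assumes S: "S_transport A J \<gamma> S" and s: "s \<in> J" and t: "t \<in> J" and v: "v \<in> tangent_space A (\<gamma> s)"
  shows "\<theta> t i (vec_transport A \<gamma> S s t v) = (\<Sum>j\<in>UNIV. transport_matrix S t s $ i $ j * \<theta> s j v)"
proof -
  have app: "\<theta> t i (vec_transport A \<gamma> S s t w) = S s t (vec_tensor A (\<gamma> s) w) [\<theta> t i] []"
    if "w \<in> tangent_space A (\<gamma> s)" for w
    by (simp flip: vec_transport_props(2)[OF S s t that] add: \<theta>_cotangent[OF t])
  have lin: "linear_on (tensor_algebra A (\<gamma> s)) (S s t)" by (rule S_transportD(1)[OF S s t])
  have "vec_tensor A (\<gamma> s) v = (\<Sum>j\<in>UNIV. \<theta> s j v *\<^sub>R vec_tensor A (\<gamma> s) (E j s))"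
  proof (intro ext)
    fix \<omega>s :: "('m, 'n) covec list" and vs :: "('m, 'n) tvec list"
    have "\<omega> v = (\<Sum>j\<in>UNIV. \<theta> s j v * \<omega> (E j s))" if "\<omega> \<in> cotangent_space A (\<gamma> s)" for \<omega>
      using linear_on_sum[where I = UNIV and a = "\<lambda>j. \<theta> s j v" and v = "\<lambda>j. E j s",
          OF cotangent_linear[OF that] subspace_tangent_space E_tangent[OF s]] vec_expand[OF s v] by simp
    then show "vec_tensor A (\<gamma> s) v \<omega>s vs = (\<Sum>j\<in>UNIV. \<theta> s j v *\<^sub>R vec_tensor A (\<gamma> s) (E j s)) \<omega>s vs"
      by (auto simp: vec_tensor_def sum_fun_apply)
  qed
  then have "S s t (vec_tensor A (\<gamma> s) v) = (\<Sum>j\<in>UNIV. \<theta> s j v *\<^sub>R S s t (vec_tensor A (\<gamma> s) (E j s)))"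
    by (simp add: linear_on_sum[OF lin subspace_tensor_algebra vec_tensor_algebra[OF E_tangent[OF s]]])
  then show ?thesis
    by (simp add: app[OF v] transport_matrix_def app[OF E_tangent[OF s]] sum_fun_apply mult.commute)
qed

lemma transport_matrix_comp:
  assumes S: "S_transport A J \<gamma> S" and s: "s \<in> J" and t: "t \<in> J" and r: "r \<in> J"
  shows "transport_matrix S r t ** transport_matrix S t s = transport_matrix S r s"
proof -
  have "transport_matrix S r s $ i $ j = (transport_matrix S r t ** transport_matrix S t s) $ i $ j" for i j
  proof -
    note e = E_tangent[OF s, of j]
    have "S t r (S s t (vec_tensor A (\<gamma> s) (E j s))) = S s r (vec_tensor A (\<gamma> s) (E j s))"
      by (rule S_transportD(3)[OF S s t r vec_tensor_algebra[OF e]])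
    then have "vec_transport A \<gamma> S s r (E j s) = vec_transport A \<gamma> S t r (vec_transport A \<gamma> S s t (E j s))"
      by (simp add: vec_transport_def[of _ _ _ t r] vec_transport_def[of _ _ _ s r]
          vec_transport_props(2)[OF S s t e])
    then have "transport_matrix S r s $ i $ j = \<theta> r i (vec_transport A \<gamma> S t r (vec_transport A \<gamma> S s t (E j s)))"
      by (simp add: transport_matrix_def)
    also have "\<dots> = (\<Sum>k\<in>UNIV. transport_matrix S r t $ i $ k * transport_matrix S t s $ k $ j)"
      by (subst \<theta>_vec_transport[OF S t r vec_transport_props(1)[OF S s t e]])
        (simp add: transport_matrix_def[of _ t s])
    finally show ?thesis by (simp add: matrix_matrix_mult_def)
  qed
  then show ?thesis by (simp add: vec_eq_iff)
qed

lemma transport_matrix_id: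
  assumes S: "S_transport A J \<gamma> S" and s: "s \<in> J"
  shows "transport_matrix S s s = mat 1"
proof -
  have "vec_transport A \<gamma> S s s (E j s) = E j s" for j
  proof (rule vec_transport_eqI[OF E_tangent[OF s]])
    show "S s s (vec_tensor A (\<gamma> s) (E j s)) = vec_tensor A (\<gamma> s) (E j s)"
      by (rule S_transportD(4)[OF S s s vec_tensor_algebra[OF E_tangent[OF s]]])
  qed
  then show ?thesis by (simp add: transport_matrix_def vec_eq_iff \<theta>_E[OF s] mat_def)
qed

text \<open>An entry of the matrix is the transported frame vector, seen as a tensor field of type
  (1,0), tested against a member of the dual frame; the regularity clause of
  \<open>S_transport\<close> applies to it.\<close>

lemma transport_matrix_C1:
  assumes S: "S_transport A J \<gamma> S"
  shows "C1_on (J \<times> J) (\<lambda>(s, t). transport_matrix S t s)"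
proof -
  have "C1_on (J \<times> J) (\<lambda>x. (case x of (s, t) \<Rightarrow> transport_matrix S t s) $ i $ j)" for i j
  proof -
    define T where "T s = vec_tensor A (\<gamma> s) (E j s)" for s
    \<comment> \<open>Test lists of all lengths have to be considered; only one covector field and
      no vector field give a nonzero function.\<close>
    have "c1_tensor_field A J \<gamma> T"
      unfolding c1_tensor_field_def
    proof (intro conjI ballI allI impI)
      fix s assume "s \<in> J"
      then show "T s \<in> tensor_algebra A (\<gamma> s)" by (simp add: T_def vec_tensor_algebra E_tangent)
    next
      fix \<omega>s and Xs :: "(real \<Rightarrow> ('m, 'n) tvec) list"
      assume \<omega>s: "\<forall>\<omega>\<in>set \<omega>s. c1_covector_field A J \<gamma> \<omega>"
      show "C1_on J (\<lambda>s. T s (map (\<lambda>\<omega>. \<omega> s) \<omega>s) (map (\<lambda>X. X s) Xs))"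
      proof (cases "length \<omega>s = 1 \<and> Xs = []")
        case True
        then obtain \<omega> where \<omega>: "\<omega>s = [\<omega>]" "Xs = []" by (auto simp: length_Suc_conv)
        then have field: "c1_covector_field A J \<gamma> \<omega>" using \<omega>s by simp
        then have "C1_on J (\<lambda>s. \<omega> s (E j s))" "\<And>s. s \<in> J \<Longrightarrow> \<omega> s \<in> cotangent_space A (\<gamma> s)"
          using E_field by (auto simp: c1_covector_field_def)
        then show ?thesis
          by (subst C1_on_cong[OF refl, where g = "\<lambda>s. \<omega> s (E j s)"]) (auto simp: T_def \<omega>)
      next
        case False
        have "T s (map (\<lambda>\<omega>. \<omega> s) \<omega>s) (map (\<lambda>X. X s) Xs) = 0" for s
        proof -
          have "length (map (\<lambda>\<omega>. \<omega> s) \<omega>s) = length \<omega>s" by simp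
          then have "\<not> (map (\<lambda>X. X s) Xs = [] \<and> (\<exists>\<omega>. map (\<lambda>\<omega>. \<omega> s) \<omega>s = [\<omega>]))"
            using False by (metis One_nat_def length_Cons list.size(3) map_is_Nil_conv)
          then show ?thesis by (auto simp: T_def vec_tensor_def)
        qed
        then show ?thesis by simp
      qed
    qed
    then have "C1_on (J \<times> J) (\<lambda>(s, t). S s t (T s) (map (\<lambda>\<omega>. \<omega> t) [\<lambda>s. \<theta> s i]) (map (\<lambda>X. X t) []))"
      by (rule S_transport_C1[OF S]) (simp_all add: \<theta>_field)
    then show ?thesis
    proof (rule C1_on_cong[OF refl, THEN iffD2, rotated])
      fix x assume "x \<in> J \<times> J"
      then obtain s t where x: "x = (s, t)" "s \<in> J" "t \<in> J" by blast
      show "(case x of (s, t) \<Rightarrow> transport_matrix S t s) $ i $ j =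
        (case x of (s, t) \<Rightarrow> S s t (T s) (map (\<lambda>\<omega>. \<omega> t) [\<lambda>s. \<theta> s i]) (map (\<lambda>X. X t) []))"
        by (simp add: x(1) T_def transport_matrix_def \<theta>_cotangent[OF x(3)]
            flip: vec_transport_props(2)[OF S x(2,3) E_tangent[OF x(2)]])
    qed
  qed
  then show ?thesis by (rule C1_on_matrixI)
qed

lemma transport_matrix_differentiable:
  assumes S: "S_transport A J \<gamma> S" and s: "s \<in> J" and t: "t \<in> J"
  shows "(\<lambda>s. transport_matrix S s t) differentiable (at s within J)"
proof -
  have "C1_on J (\<lambda>s. (\<lambda>(s, t). transport_matrix S t s) (t, s))"
  proof (rule C1_on_compose[OF transport_matrix_C1[OF S]])
    show "C1_on J (\<lambda>s. (t, s))"
      by (rule C1_onI[where f' = "\<lambda>_ h. (0, h)"]) (auto intro!: derivative_eq_intros continuous_intros)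
  qed (use t in auto)
  then show ?thesis using s unfolding C1_on_def differentiable_def by auto
qed

text \<open>The limit in \<open>has_coefficients\<close> is read off in one chart, turned into frame
  components, and recognised as the limit of difference quotients of the transport matrix. So
  \<Gamma> is determined on \<open>J\<close> by the transport and is continuous there.\<close>

lemma coefficients_derivative:
  assumes S: "S_transport A J \<gamma> S" and \<Gamma>: "has_coefficients A J \<gamma> E S \<Gamma>"
  shows "continuous_on J \<Gamma>"
    and "s \<in> J \<Longrightarrow> (transport_matrix S s has_vector_derivative \<Gamma> s) (at s within J)"
proof -
  obtain D where D: "continuous_on J D"
    "\<And>s. s \<in> J \<Longrightarrow> (transport_matrix S s has_vector_derivative D s) (at s within J)"
    using C1_on_partial2[OF transport_matrix_C1[OF S]] by auto
  have eq: "\<Gamma> s = D s" if s: "s \<in> J" for s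
  proof -
    obtain c where c: "c \<in> A" "\<gamma> s \<in> fst c" using ex_chart by blast
    have "\<Gamma> s $ i $ j = D s $ i $ j" for i j
    proof (rule tendsto_unique)
      let ?F = "at 0 within {\<epsilon>. s + \<epsilon> \<in> J}"
      define V where "V \<epsilon> = (1 / \<epsilon>) *\<^sub>R (vec_transport A \<gamma> S (s + \<epsilon>) s (E j (s + \<epsilon>)) - E j s)" for \<epsilon>
      \<comment> \<open>These constants convert chart components at \<open>\<gamma> s\<close> into
        the i-th frame component. As a fixed finite combination of coordinates, that component
        passes through limits in the product topology.\<close>
      define a where "a k = \<theta> s i (coord_vec A (\<gamma> s) c k)" for k
      have \<theta>_coord: "\<theta> s i v = (\<Sum>k\<in>UNIV. v c $ k * a k)" if "v \<in> tangent_space A (\<gamma> s)" for v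
        using linear_on_sum[where I = UNIV and a = "\<lambda>k. v c $ k" and v = "coord_vec A (\<gamma> s) c",
              OF cotangent_linear[OF \<theta>_cotangent[OF s]] subspace_tangent_space
              coord_vec_tangent[OF c]] tangent_eq_sum_coord[OF that c]
        by (simp add: a_def)
      have "(V \<longlongrightarrow> (\<Sum>i\<in>UNIV. (\<Gamma> s $ i $ j) *\<^sub>R E i s)) ?F"
        using \<Gamma> s unfolding has_coefficients_def V_def by blast
      from tendsto_fun_apply[OF this, of c]
      have "((\<lambda>\<epsilon>. \<Sum>k\<in>UNIV. V \<epsilon> c $ k * a k) \<longlongrightarrow> (\<Sum>k\<in>UNIV. (\<Sum>i\<in>UNIV. (\<Gamma> s $ i $ j) *\<^sub>R E i s) c $ k * a k)) ?F"
        by (intro tendsto_intros)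
      also have "(\<Sum>k\<in>UNIV. (\<Sum>i\<in>UNIV. (\<Gamma> s $ i $ j) *\<^sub>R E i s) c $ k * a k) = \<theta> s i (\<Sum>i\<in>UNIV. (\<Gamma> s $ i $ j) *\<^sub>R E i s)"
        by (rule \<theta>_coord[symmetric]) (intro subspace_sum subspace_scale subspace_tangent_space E_tangent s)
      also have "\<dots> = \<Gamma> s $ i $ j"
        by (simp add: linear_on_sum[OF cotangent_linear[OF \<theta>_cotangent[OF s]] subspace_tangent_space E_tangent[OF s]]
            \<theta>_E[OF s] if_distrib[of "\<lambda>x. _ * x"] cong: if_cong)
      finally have lim: "((\<lambda>\<epsilon>. \<Sum>k\<in>UNIV. V \<epsilon> c $ k * a k) \<longlongrightarrow> \<Gamma> s $ i $ j) ?F" .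
      have "(\<Sum>k\<in>UNIV. V \<epsilon> c $ k * a k) =
          (transport_matrix S s (s + \<epsilon>) $ i $ j - transport_matrix S s s $ i $ j) / \<epsilon>"
        if \<epsilon>: "s + \<epsilon> \<in> J" for \<epsilon>
      proof -
        note w = vec_transport_props(1)[OF S \<epsilon> s E_tangent[OF \<epsilon>, of j]]
        have lin: "linear_on (tangent_space A (\<gamma> s)) (\<theta> s i)"
          by (rule cotangent_linear[OF \<theta>_cotangent[OF s]])
        have "V \<epsilon> = (1 / \<epsilon>) *\<^sub>R vec_transport A \<gamma> S (s + \<epsilon>) s (E j (s + \<epsilon>)) + (- (1 / \<epsilon>)) *\<^sub>R E j s"
          unfolding V_def by (simp add: scaleR_diff_right)
        moreover have "r *\<^sub>R v \<in> tangent_space A (\<gamma> s)" if "v \<in> tangent_space A (\<gamma> s)" for r v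
          using that subspace_scale subspace_tangent_space by blast
        ultimately have "\<theta> s i (V \<epsilon>) = (1 / \<epsilon>) * \<theta> s i (vec_transport A \<gamma> S (s + \<epsilon>) s (E j (s + \<epsilon>)))
            - (1 / \<epsilon>) * \<theta> s i (E j s)" and "V \<epsilon> \<in> tangent_space A (\<gamma> s)"
          using lin w E_tangent[OF s, of j] subspace_add[OF subspace_tangent_space[of "\<gamma> s"]]
          unfolding linear_on_def by (simp_all del: scaleR_minus_left)
        then show ?thesis
          using \<theta>_coord[of "V \<epsilon>"]
          by (simp add: transport_matrix_id[OF S s] \<theta>_E[OF s] mat_def diff_divide_distrib)
            (simp add: transport_matrix_def)
      qed
      then have "eventually (\<lambda>\<epsilon>. (\<Sum>k\<in>UNIV. V \<epsilon> c $ k * a k) =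
          (transport_matrix S s (s + \<epsilon>) $ i $ j - transport_matrix S s s $ i $ j) / \<epsilon>) ?F"
        by (auto simp: eventually_at_filter)
      then show "((\<lambda>\<epsilon>. (transport_matrix S s (s + \<epsilon>) $ i $ j - transport_matrix S s s $ i $ j) / \<epsilon>)
          \<longlongrightarrow> \<Gamma> s $ i $ j) ?F"
        by (rule Lim_transform_eventually[OF lim])
      have "((\<lambda>r. transport_matrix S s r $ i $ j) has_vector_derivative D s $ i $ j) (at s within J)"
        by (intro bounded_linear.has_vector_derivative[OF bounded_linear_vec_nth] D s)
      then show "((\<lambda>\<epsilon>. (transport_matrix S s (s + \<epsilon>) $ i $ j - transport_matrix S s s $ i $ j) / \<epsilon>)
          \<longlongrightarrow> D s $ i $ j) ?F"
        by (intro has_real_derivative_increment_limit)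
          (simp add: has_real_derivative_iff_has_vector_derivative)
      show "?F \<noteq> bot"
        by (rule nondegenerate_interval_trivial_limit[OF nondegenerate_interval_translate[OF nondegenerate]])
          (use s in simp)
    qed
    then show ?thesis by (simp add: vec_eq_iff)
  qed
  show "continuous_on J \<Gamma>" using D(1) eq by (metis continuous_on_cong)
  show "s \<in> J \<Longrightarrow> (transport_matrix S s has_vector_derivative \<Gamma> s) (at s within J)"
    using D(2) eq by simp
qed

text \<open>Both sides of the consistency condition are bilinear in the two vectors, so it is
  decided on the frame, where the metric is given by \<open>G\<close>.\<close>

lemma consistent_along_iff_matrix:
  assumes S: "S_transport A J \<gamma> S" and g: "c1_metric A g"
  defines "G \<equiv> metric_matrix g \<gamma> E"
  shows "consistent_along A g J \<gamma> S \<longleftrightarrow>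
    (\<forall>s\<in>J. \<forall>t\<in>J. G s = transpose (transport_matrix S t s) ** G t ** transport_matrix S t s)"
proof -
  let ?H = "transport_matrix S" and ?L = "vec_transport A \<gamma> S"
  have gt: "g p \<in> tensors A p 0 2" for p using g by (simp add: c1_metric_def)
  have GG: "g (\<gamma> s) [] [X, Y] = (\<Sum>k\<in>UNIV. \<Sum>l\<in>UNIV. \<theta> s k X * \<theta> s l Y * G s $ k $ l)"
    if "s \<in> J" "X \<in> tangent_space A (\<gamma> s)" "Y \<in> tangent_space A (\<gamma> s)" for s X Y
    using dual_frame_bilinear[OF frame[OF that(1)] gt that(2,3)] by (simp add: G_def metric_matrix_def)
  have entry: "(transpose (?H t s) ** G t ** ?H t s) $ i $ j = g (\<gamma> t) [] [?L s t (E i s), ?L s t (E j s)]"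
    if "s \<in> J" "t \<in> J" for s t i j
  proof -
    have "(transpose (?H t s) ** G t ** ?H t s) $ i $ j =
      (\<Sum>l\<in>UNIV. \<Sum>k\<in>UNIV. ?H t s $ k $ i * ?H t s $ l $ j * G t $ k $ l)"
      by (simp add: matrix_matrix_mult_def transpose_def sum_distrib_right sum_distrib_left mult.assoc mult.left_commute mult.commute)
    also have "\<dots> = (\<Sum>k\<in>UNIV. \<Sum>l\<in>UNIV. ?H t s $ k $ i * ?H t s $ l $ j * G t $ k $ l)"
      by (rule sum.swap)
    also have "\<dots> = g (\<gamma> t) [] [?L s t (E i s), ?L s t (E j s)]"
      using GG[OF that(2) vec_transport_props(1)[OF S that E_tangent[OF that(1)]]
          vec_transport_props(1)[OF S that E_tangent[OF that(1)]], of i j]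
      by (simp add: transport_matrix_def)
    finally show ?thesis .
  qed
  show ?thesis
  proof
    assume con: "consistent_along A g J \<gamma> S"
    have "G s $ i $ j = (transpose (?H t s) ** G t ** ?H t s) $ i $ j"
      if "s \<in> J" "t \<in> J" for s t i j
    proof -
      have "g (\<gamma> s) [] [E i s, E j s] = g (\<gamma> t) [] [?L s t (E i s), ?L s t (E j s)]"
        using con that E_tangent[OF that(1)] unfolding consistent_along_def by blast
      then show ?thesis unfolding entry[OF that] by (simp add: G_def metric_matrix_def)
    qed
    then show "\<forall>s\<in>J. \<forall>t\<in>J. G s = transpose (?H t s) ** G t ** ?H t s"
      by (simp add: vec_eq_iff)
  next
    assume eq: "\<forall>s\<in>J. \<forall>t\<in>J. G s = transpose (?H t s) ** G t ** ?H t s"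
    show "consistent_along A g J \<gamma> S"
      unfolding consistent_along_def
    proof (intro ballI)
      fix s t X Y assume s: "s \<in> J" and t: "t \<in> J"
        and X: "X \<in> tangent_space A (\<gamma> s)" and Y: "Y \<in> tangent_space A (\<gamma> s)"
      define x where "x = (\<chi> k. \<theta> s k X)"
      define y where "y = (\<chi> k. \<theta> s k Y)"
      \<comment> \<open>As an inner product the double sum lets the transport matrix be moved to the
        other argument by transposition.\<close>
      have inner: "(\<Sum>k\<in>UNIV. \<Sum>l\<in>UNIV. u $ k * w $ l * M $ k $ l) = u \<bullet> (M *v w)"
        for u w :: "real^'n" and M :: "real^'n^'n"
        by (simp add: inner_vec_def matrix_vector_mult_def sum_distrib_left mult.assoc mult.left_commute mult.commute)
      have Lx: "(\<chi> k. \<theta> t k (?L s t Z)) = ?H t s *v (\<chi> k. \<theta> s k Z)" if "Z \<in> tangent_space A (\<gamma> s)" for Z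
        by (simp add: vec_eq_iff matrix_vector_mult_def \<theta>_vec_transport[OF S s t that])
      have "g (\<gamma> t) [] [?L s t X, ?L s t Y] = (?H t s *v x) \<bullet> (G t *v (?H t s *v y))"
        unfolding x_def y_def Lx[OF X, symmetric] Lx[OF Y, symmetric] inner[symmetric]
        using GG[OF t vec_transport_props(1)[OF S s t X] vec_transport_props(1)[OF S s t Y]] by simp
      also have "\<dots> = x \<bullet> ((transpose (?H t s) ** G t ** ?H t s) *v y)"
        by (simp only: matrix_vector_mul_assoc[symmetric] dot_lmul_matrix[symmetric] vector_transpose_matrix)
      also have "\<dots> = x \<bullet> (G s *v y)"
        by (simp only: bspec[OF bspec[OF eq s] t, symmetric])
      also have "\<dots> = g (\<gamma> s) [] [X, Y]"
        unfolding inner[symmetric] x_def y_def using GG[OF s X Y] by simp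
      finally show "g (\<gamma> s) [] [X, Y] = g (\<gamma> t) [] [?L s t X, ?L s t Y]" by simp
    qed
  qed
qed

end

section \<open>Construction of an S-transport from its matrix\<close>

text \<open>Y is obtained from its own equation rather than as an inverse of X. The derivative of Y
  X is Y \<Gamma> X - Y \<Gamma> X = 0 and both are the identity at the base point, so Y is a left
  inverse of X, and for square matrices also a right inverse.\<close>

lemma transition_matrices:
  fixes \<Gamma> :: "real \<Rightarrow> real^'n^'n"
  assumes J: "nondegenerate_interval J" and \<Gamma>: "continuous_on J \<Gamma>"
  shows "\<exists>X Y :: real \<Rightarrow> real^'n^'n. (\<forall>t\<in>J. X t ** Y t = mat 1 \<and> Y t ** X t = mat 1) \<and> C1_on J X \<and> C1_on J Y \<and>
    (\<forall>t\<in>J. (Y has_vector_derivative Y t ** \<Gamma> t) (at t within J))"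
proof -
  note bl = bounded_bilinear_matrix_mult
  obtain c where c: "c \<in> J" using J by (auto simp: nondegenerate_interval_def)
  have bl1: "bounded_linear (\<lambda>Z. - \<Gamma> t ** Z)" for t by (rule bounded_bilinear.bounded_linear_right[OF bl])
  have bl2: "bounded_linear (\<lambda>Z. Z ** \<Gamma> t)" for t by (rule bounded_bilinear.bounded_linear_left[OF bl])
  have "continuous_on J (\<lambda>t. Blinfun (\<lambda>Z. - \<Gamma> t ** Z))"
    by (rule continuous_on_blinfun_componentwise)
      (simp add: bounded_linear_Blinfun_apply[OF bl1] bounded_bilinear.continuous_on[OF bl]
        continuous_on_minus \<Gamma>)
  from linear_ode_solution[OF J c this, of "mat 1"]
  obtain X where X: "X c = mat 1" "\<And>t. t \<in> J \<Longrightarrow> (X has_vector_derivative - \<Gamma> t ** X t) (at t within J)"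
    by (auto simp: bounded_linear_Blinfun_apply[OF bl1])
  have "continuous_on J (\<lambda>t. Blinfun (\<lambda>Z. Z ** \<Gamma> t))"
    by (rule continuous_on_blinfun_componentwise)
      (simp add: bounded_linear_Blinfun_apply[OF bl2] bounded_bilinear.continuous_on[OF bl] \<Gamma>)
  from linear_ode_solution[OF J c this, of "mat 1"]
  obtain Y where Y: "Y c = mat 1" "\<And>t. t \<in> J \<Longrightarrow> (Y has_vector_derivative Y t ** \<Gamma> t) (at t within J)"
    by (auto simp: bounded_linear_Blinfun_apply[OF bl2])
  have cX: "continuous_on J X" and cY: "continuous_on J Y"
    using X(2) Y(2) by (meson has_vector_derivative_continuous continuous_on_eq_continuous_within)+
  have "((\<lambda>t. Y t ** X t) has_vector_derivative 0) (at t within J)" if "t \<in> J" for t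
    using has_vector_derivative_matrix_mult[OF Y(2) X(2), OF that that]
    by (simp add: matrix_minus_simps matrix_mul_assoc)
  then have "Y t ** X t = Y c ** X c" if "t \<in> J" for t
    using J c that unfolding has_vector_derivative_def nondegenerate_interval_def
    by (intro has_derivative_zero_unique[of J "\<lambda>t. Y t ** X t"]) (auto simp: is_interval_convex)
  then have YX: "Y t ** X t = mat 1" if "t \<in> J" for t using that X(1) Y(1) by simp
  then have XY: "X t ** Y t = mat 1" if "t \<in> J" for t using that matrix_left_right_inverse by blast
  have "C1_on J X"
    unfolding C1_on_real_iff
    by (intro exI[of _ "\<lambda>t. - \<Gamma> t ** X t"] conjI ballI X(2)
        bounded_bilinear.continuous_on[OF bl] continuous_on_minus \<Gamma> cX)
  moreover have "C1_on J Y"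
    unfolding C1_on_real_iff
    by (intro exI[of _ "\<lambda>t. Y t ** \<Gamma> t"] conjI ballI Y(2)
        bounded_bilinear.continuous_on[OF bl] \<Gamma> cY)
  ultimately have "(\<forall>t\<in>J. X t ** Y t = mat 1 \<and> Y t ** X t = mat 1) \<and> C1_on J X \<and> C1_on J Y \<and>
    (\<forall>t\<in>J. (Y has_vector_derivative Y t ** \<Gamma> t) (at t within J))"
    using XY YX Y(2) by simp
  then show ?thesis by - (rule exI[of _ X], rule exI[of _ Y])
qed

text \<open>Splitting the list at the slot suits contractions and inductions over argument lists.
  When the lengths do not match the type the tensor vanishes, so no length condition
  appears.\<close>

lemma tensors_linear_covec_slot:
  assumes T: "T \<in> tensors A p r q"
    and "set as \<subseteq> cotangent_space A p" "set bs \<subseteq> cotangent_space A p" "set vs \<subseteq> tangent_space A p"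
  shows "linear_on (cotangent_space A p) (\<lambda>\<omega>. T (as @ \<omega> # bs) vs)"
proof (cases "length as + Suc (length bs) = r \<and> length vs = q")
  case True
  obtain z where z: "z \<in> cotangent_space A p"
    by (rule that, rule subspace_0[OF subspace_cotangent_space])
  have "linear_on (cotangent_space A p) (\<lambda>\<omega>. T ((as @ z # bs)[length as := \<omega>]) vs)"
  proof (rule tensorsD(2)[OF T, of "as @ z # bs" vs "length as"])
    show "set (as @ z # bs) \<subseteq> cotangent_space A p" using assms(2,3) z by simp
  qed (use True assms(4) in simp_all)
  then show ?thesis by (simp only: list_update_length)
next
  case False
  then have "T (as @ \<omega> # bs) vs = 0" for \<omega> by (intro tensorsD(1)[OF T]) auto
  then show ?thesis by (simp add: linear_on_def)
qed

lemma (in c2_manifold) tensors_linear_vec_slot: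
  assumes T: "T \<in> tensors A p r q"
    and "set \<omega>s \<subseteq> cotangent_space A p" "set as \<subseteq> tangent_space A p" "set bs \<subseteq> tangent_space A p"
  shows "linear_on (tangent_space A p) (\<lambda>v. T \<omega>s (as @ v # bs))"
proof (cases "length \<omega>s = r \<and> length as + Suc (length bs) = q")
  case True
  obtain z where z: "z \<in> tangent_space A p"
    by (rule that, rule subspace_0[OF subspace_tangent_space])
  have "linear_on (tangent_space A p) (\<lambda>v. T \<omega>s ((as @ z # bs)[length as := v]))"
  proof (rule tensorsD(3)[OF T, of \<omega>s "as @ z # bs" "length as"])
    show "set (as @ z # bs) \<subseteq> tangent_space A p" using assms(3,4) z by simp
  qed (use True assms(2) in simp_all)
  then show ?thesis by (simp only: list_update_length)
next
  case False
  then have "T \<omega>s (as @ v # bs) = 0" for v by (intro tensorsD(1)[OF T]) auto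
  then show ?thesis by (simp add: linear_on_def)
qed

lemma tensor_algebra_induct [consumes 1, case_names tensors zero add scale]:
  assumes "T \<in> tensor_algebra A p"
    and "\<And>r q T. T \<in> tensors A p r q \<Longrightarrow> P T"
    and "P 0" "\<And>T U. P T \<Longrightarrow> P U \<Longrightarrow> P (T + U)" "\<And>a T. P T \<Longrightarrow> P (a *\<^sub>R T)"
  shows "P T"
  using assms(1) unfolding tensor_algebra_def
proof (rule span_induct)
  show "subspace {T. P T}" using assms(3-5) by (auto intro: subspaceI)
qed (use assms(2) in blast)

text \<open>Fields in the regularity clause of \<open>S_transport\<close> may be inhomogeneous, so
  multilinearity is extended from tensors of a fixed type to their span.\<close>

lemma tensor_algebra_linear_covec_slot:
  assumes "T \<in> tensor_algebra A p"
    and "set as \<subseteq> cotangent_space A p" "set bs \<subseteq> cotangent_space A p" "set vs \<subseteq> tangent_space A p"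
  shows "linear_on (cotangent_space A p) (\<lambda>\<omega>. T (as @ \<omega> # bs) vs)"
  using assms(1)
proof (induction rule: tensor_algebra_induct)
  case (tensors r q T)
  then show ?case using assms(2-4) by (rule tensors_linear_covec_slot)
qed (simp_all add: linear_on_def algebra_simps zero_fun_def)

lemma (in c2_manifold) tensor_algebra_linear_vec_slot:
  assumes "T \<in> tensor_algebra A p"
    and "set \<omega>s \<subseteq> cotangent_space A p" "set as \<subseteq> tangent_space A p" "set bs \<subseteq> tangent_space A p"
  shows "linear_on (tangent_space A p) (\<lambda>v. T \<omega>s (as @ v # bs))"
  using assms(1)
proof (induction rule: tensor_algebra_induct)
  case (tensors r q T)
  then show ?case using assms(2-4) by (rule tensors_linear_vec_slot)
qed (simp_all add: linear_on_def algebra_simps zero_fun_def)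

text \<open>Ensures that setting the transported tensor to zero on inadmissible arguments loses
  nothing, as the identity law requires.\<close>

lemma tensor_algebra_support:
  assumes "T \<in> tensor_algebra A p" "\<not> (set \<omega>s \<subseteq> cotangent_space A p \<and> set vs \<subseteq> tangent_space A p)"
  shows "T \<omega>s vs = 0"
  using assms(1)
proof (induction rule: tensor_algebra_induct)
  case (tensors r q T)
  then show ?case using assms(2) tensorsD(1)[OF tensors] by blast
qed (simp_all add: zero_fun_def)

section \<open>The tensor transport induced by a matrix cocycle\<close>

locale frame_cocycle = frame_along A J \<gamma> E
  for A :: "('m::{t2_space, second_countable_topology}, 'n::finite) chart set"
    and J :: "real set" and \<gamma> :: "real \<Rightarrow> 'm" and E :: "'n \<Rightarrow> real \<Rightarrow> ('m, 'n) tvec" +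
  fixes H :: "real \<Rightarrow> real \<Rightarrow> real^'n^'n"
  assumes H_comp: "\<And>r s t. r \<in> J \<Longrightarrow> s \<in> J \<Longrightarrow> t \<in> J \<Longrightarrow> H r t ** H t s = H r s"
    and H_id: "\<And>s. s \<in> J \<Longrightarrow> H s s = mat 1"
    and H_C1: "\<And>i j. C1_on (J \<times> J) (\<lambda>(s, t). H t s $ i $ j)"
begin

definition push :: "real \<Rightarrow> real \<Rightarrow> ('m, 'n) tvec \<Rightarrow> ('m, 'n) tvec"
  where "push s t v = (\<Sum>i\<in>UNIV. (\<Sum>j\<in>UNIV. H t s $ i $ j * \<theta> s j v) *\<^sub>R E i t)"

definition pull :: "real \<Rightarrow> real \<Rightarrow> ('m, 'n) covec \<Rightarrow> ('m, 'n) covec"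
  where "pull s t \<omega> = (\<lambda>v. if v \<in> tangent_space A (\<gamma> s) then \<omega> (push s t v) else 0)"

text \<open>The lengths of the lists stay free, because elements of the tensor algebra may have
  parts of several types.\<close>

definition admissible :: "real \<Rightarrow> ('m, 'n) covec list \<Rightarrow> ('m, 'n) tvec list \<Rightarrow> bool"
  where "admissible s \<omega>s vs \<longleftrightarrow>
    set \<omega>s \<subseteq> cotangent_space A (\<gamma> s) \<and> set vs \<subseteq> tangent_space A (\<gamma> s)"

text \<open>
  The arguments at \<open>\<gamma> t\<close> are carried back to \<open>\<gamma> s\<close>: covectors by pulling back along
  \<open>push s t\<close>, vectors by the inverse \<open>push t s\<close>.
\<close>

definition tensor_transport :: "real \<Rightarrow> real \<Rightarrow> ('m, 'n) tensor \<Rightarrow> ('m, 'n) tensor"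
  where "tensor_transport s t T = (\<lambda>\<omega>s vs. if admissible t \<omega>s vs
    then T (map (pull s t) \<omega>s) (map (push t s) vs) else 0)"

lemma push_tangent: "t \<in> J \<Longrightarrow> push s t v \<in> tangent_space A (\<gamma> t)"
  unfolding push_def by (intro subspace_sum subspace_scale subspace_tangent_space E_tangent)

lemma \<theta>_push:
  assumes "t \<in> J"
  shows "\<theta> t i (push s t v) = (\<Sum>j\<in>UNIV. H t s $ i $ j * \<theta> s j v)"
  unfolding push_def
  by (simp add: linear_on_sum[OF cotangent_linear[OF \<theta>_cotangent[OF assms]] subspace_tangent_space
        E_tangent[OF assms]] \<theta>_E[OF assms] if_distrib[of "\<lambda>x. _ * x"] cong: if_cong)

lemma push_linear:
  assumes "s \<in> J"
  shows "linear_on (tangent_space A (\<gamma> s)) (push s t)"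
proof -
  have "\<theta> s j (v + w) = \<theta> s j v + \<theta> s j w" "\<theta> s j (a *\<^sub>R v) = a * \<theta> s j v"
    if "v \<in> tangent_space A (\<gamma> s)" "w \<in> tangent_space A (\<gamma> s)" for v w a j
    using cotangent_linear[OF \<theta>_cotangent[OF assms]] that by (auto simp: linear_on_def)
  then show ?thesis
    unfolding linear_on_def push_def
    by (simp add: distrib_left sum.distrib scaleR_add_left scaleR_sum_right sum_distrib_left
        mult.left_commute)
qed

lemma push_comp:
  assumes "s \<in> J" "t \<in> J" "r \<in> J"
  shows "push t r (push s t v) = push s r v"
proof -
  have "(\<Sum>k\<in>UNIV. H r t $ i $ k * (\<Sum>j\<in>UNIV. H t s $ k $ j * \<theta> s j v))
      = (\<Sum>j\<in>UNIV. H r s $ i $ j * \<theta> s j v)" for i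
  proof -
    have "(\<Sum>k\<in>UNIV. H r t $ i $ k * (\<Sum>j\<in>UNIV. H t s $ k $ j * \<theta> s j v))
      = (\<Sum>k\<in>UNIV. \<Sum>j\<in>UNIV. H r t $ i $ k * H t s $ k $ j * \<theta> s j v)"
      by (simp add: sum_distrib_left mult.assoc)
    also have "\<dots> = (\<Sum>j\<in>UNIV. \<Sum>k\<in>UNIV. H r t $ i $ k * H t s $ k $ j * \<theta> s j v)"
      by (rule sum.swap)
    also have "\<dots> = (\<Sum>j\<in>UNIV. (H r t ** H t s) $ i $ j * \<theta> s j v)"
      by (simp add: matrix_matrix_mult_def sum_distrib_right)
    finally show ?thesis by (simp add: H_comp assms)
  qed
  then show ?thesis by (simp add: push_def[of t r] \<theta>_push[OF assms(2)] push_def[of s r])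
qed

lemma push_id:
  assumes "s \<in> J" "v \<in> tangent_space A (\<gamma> s)"
  shows "push s s v = v"
  using vec_expand[OF assms]
  by (simp add: push_def H_id[OF assms(1)] mat_def if_distrib[of "\<lambda>x. x * _"] cong: if_cong)

lemma pull_cotangent:
  assumes "s \<in> J" "t \<in> J" "\<omega> \<in> cotangent_space A (\<gamma> t)"
  shows "pull s t \<omega> \<in> cotangent_space A (\<gamma> s)"
  using cotangent_linear[OF assms(3)] push_linear[OF assms(1), of t] push_tangent[OF assms(2)]
    subspace_tangent_space[of "\<gamma> s"]
  by (auto simp: cotangent_space_def linear_on_def pull_def subspace_add subspace_scale)

lemma pull_comp:
  assumes "s \<in> J" "t \<in> J" "r \<in> J"
  shows "pull s t (pull t r \<omega>) = pull s r \<omega>"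
  by (simp add: pull_def fun_eq_iff push_tangent push_comp assms)

lemma pull_id:
  assumes "s \<in> J" "\<omega> \<in> cotangent_space A (\<gamma> s)"
  shows "pull s s \<omega> = \<omega>"
  using assms by (auto simp: pull_def fun_eq_iff push_id cotangent_space_def)

lemma pull_linear: "linear_on V (pull s t)"
  by (simp add: linear_on_def pull_def fun_eq_iff)

lemma admissible_map:
  assumes "s \<in> J" "t \<in> J" "admissible t \<omega>s vs"
  shows "admissible s (map (pull s t) \<omega>s) (map (push t s) vs)"
  using assms pull_cotangent push_tangent unfolding admissible_def by auto

lemma tensor_transport_linear: "linear_on V (tensor_transport s t)"
  by (simp add: linear_on_def tensor_transport_def fun_eq_iff)

text \<open>Linear maps substituted into the slots keep multilinearity. Updating a slot commutes
  with mapping over the list, and the updated lists stay admissible.\<close>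

lemma tensor_transport_tensors:
  assumes s: "s \<in> J" and t: "t \<in> J" and T: "T \<in> tensors A (\<gamma> s) p q"
  shows "tensor_transport s t T \<in> tensors A (\<gamma> t) p q"
  unfolding tensors_def
proof (intro CollectI conjI allI impI)
  fix \<omega>s vs
  assume "\<not> (length \<omega>s = p \<and> set \<omega>s \<subseteq> cotangent_space A (\<gamma> t) \<and> length vs = q \<and> set vs \<subseteq> tangent_space A (\<gamma> t))"
  then show "tensor_transport s t T \<omega>s vs = 0"
    using tensorsD(1)[OF T, of "map (pull s t) \<omega>s" "map (push t s) vs"]
    by (auto simp: tensor_transport_def admissible_def)
next
  fix \<omega>s vs i
  assume *: "length \<omega>s = p" "set \<omega>s \<subseteq> cotangent_space A (\<gamma> t)" "length vs = q"
    "set vs \<subseteq> tangent_space A (\<gamma> t)" "i < p"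
  then have adm: "admissible s (map (pull s t) \<omega>s) (map (push t s) vs)"
    by (intro admissible_map s t) (simp add: admissible_def)
  have "linear_on (cotangent_space A (\<gamma> t)) (\<lambda>\<omega>. T ((map (pull s t) \<omega>s)[i := pull s t \<omega>]) (map (push t s) vs))"
    by (rule linear_on_compose[OF pull_linear _ tensorsD(2)[OF T]])
      (use adm * pull_cotangent[OF s t] in \<open>auto simp: admissible_def\<close>)
  then show "linear_on (cotangent_space A (\<gamma> t)) (\<lambda>\<omega>. tensor_transport s t T (\<omega>s[i := \<omega>]) vs)"
  proof (rule linear_on_cong[OF _ subspace_cotangent_space, THEN iffD2, rotated])
    fix \<omega> assume "\<omega> \<in> cotangent_space A (\<gamma> t)"
    then have "admissible t (\<omega>s[i := \<omega>]) vs"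
      using * set_update_subset_insert[of \<omega>s i \<omega>] by (auto simp: admissible_def)
    then show "tensor_transport s t T (\<omega>s[i := \<omega>]) vs = T ((map (pull s t) \<omega>s)[i := pull s t \<omega>]) (map (push t s) vs)"
      by (simp add: tensor_transport_def map_update)
  qed
next
  fix \<omega>s vs j
  assume *: "length \<omega>s = p" "set \<omega>s \<subseteq> cotangent_space A (\<gamma> t)" "length vs = q"
    "set vs \<subseteq> tangent_space A (\<gamma> t)" "j < q"
  then have adm: "admissible s (map (pull s t) \<omega>s) (map (push t s) vs)"
    by (intro admissible_map s t) (simp add: admissible_def)
  have "linear_on (tangent_space A (\<gamma> t)) (\<lambda>v. T (map (pull s t) \<omega>s) ((map (push t s) vs)[j := push t s v]))"
    by (rule linear_on_compose[OF push_linear[OF t] _ tensorsD(3)[OF T]])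
      (use adm * push_tangent[OF s] in \<open>auto simp: admissible_def\<close>)
  then show "linear_on (tangent_space A (\<gamma> t)) (\<lambda>v. tensor_transport s t T \<omega>s (vs[j := v]))"
  proof (rule linear_on_cong[OF _ subspace_tangent_space, THEN iffD2, rotated])
    fix v assume "v \<in> tangent_space A (\<gamma> t)"
    then have "admissible t \<omega>s (vs[j := v])"
      using * set_update_subset_insert[of vs j v] by (auto simp: admissible_def)
    then show "tensor_transport s t T \<omega>s (vs[j := v]) = T (map (pull s t) \<omega>s) ((map (push t s) vs)[j := push t s v])"
      by (simp add: tensor_transport_def map_update)
  qed
qed

lemma tensor_transport_algebra:
  assumes s: "s \<in> J" and t: "t \<in> J" and T: "T \<in> tensor_algebra A (\<gamma> s)"
  shows "tensor_transport s t T \<in> tensor_algebra A (\<gamma> t)"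
  using T
proof (induction rule: tensor_algebra_induct)
  case (tensors r q T)
  then show ?case by (rule subsetD[OF tensors_subset_algebra tensor_transport_tensors[OF s t]])
next
  case zero
  have "tensor_transport s t 0 = 0" by (simp add: tensor_transport_def fun_eq_iff)
  then show ?case by (simp only: subspace_0[OF subspace_tensor_algebra])
next
  case (add T U)
  have "tensor_transport s t (T + U) = tensor_transport s t T + tensor_transport s t U"
    using tensor_transport_linear[of UNIV] by (simp add: linear_on_def)
  then show ?case using subspace_add[OF subspace_tensor_algebra add] by (simp only:)
next
  case (scale a T)
  have "tensor_transport s t (a *\<^sub>R T) = a *\<^sub>R tensor_transport s t T"
    using tensor_transport_linear[of UNIV] by (simp add: linear_on_def)
  then show ?case using subspace_scale[OF subspace_tensor_algebra scale] by (simp only:)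
qed

text \<open>\<open>tensor_prod\<close> sums over all splittings of the argument lists; admissibility
  has to be compatible with each of them for the transport to respect products.\<close>

lemma admissible_take_drop:
  "admissible t \<omega>s vs \<longleftrightarrow> admissible t (take k \<omega>s) (take l vs) \<and> admissible t (drop k \<omega>s) (drop l vs)"
proof -
  have "set \<omega>s = set (take k \<omega>s) \<union> set (drop k \<omega>s)" "set vs = set (take l vs) \<union> set (drop l vs)"
    by (metis append_take_drop_id set_append)+
  then show ?thesis unfolding admissible_def by blast
qed

lemma tensor_transport_prod:
  "tensor_transport s t (tensor_prod T U) = tensor_prod (tensor_transport s t T) (tensor_transport s t U)"
proof (intro ext)
  fix \<omega>s vs
  show "tensor_transport s t (tensor_prod T U) \<omega>s vs =
    tensor_prod (tensor_transport s t T) (tensor_transport s t U) \<omega>s vs"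
  proof (cases "admissible t \<omega>s vs")
    case True
    then have "admissible t (take k \<omega>s) (take l vs)" "admissible t (drop k \<omega>s) (drop l vs)" for k l
      using admissible_take_drop by blast+
    then show ?thesis using True
      by (simp add: tensor_transport_def tensor_prod_def take_map drop_map)
  next
    case False
    \<comment> \<open>In every splitting at least one part contains the inadmissible argument, so
      one factor is cut off to zero.\<close>
    then have "tensor_transport s t T (take k \<omega>s) (take l vs) * tensor_transport s t U (drop k \<omega>s) (drop l vs) = 0"
      for k l using admissible_take_drop[of t \<omega>s vs k l] by (auto simp: tensor_transport_def)
    then have "tensor_prod (tensor_transport s t T) (tensor_transport s t U) \<omega>s vs = 0"
      unfolding tensor_prod_def by (intro sum.neutral ballI)
    then show ?thesis using False by (simp add: tensor_transport_def)
  qed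
qed

text \<open>\<open>push t s\<close> is an isomorphism with inverse \<open>push s t\<close>, and
  \<open>pull s t\<close> is the matching map on covectors. A frame used for the trace at
  \<open>\<gamma> t\<close> thus becomes a frame at \<open>\<gamma> s\<close>.\<close>

lemma dual_frame_transport:
  assumes s: "s \<in> J" and t: "t \<in> J" and df: "dual_frame A (\<gamma> t) e \<tau>"
  shows "dual_frame A (\<gamma> s) (\<lambda>k. push t s (e k)) (\<lambda>k. pull s t (\<tau> k))"
proof -
  have e: "e k \<in> tangent_space A (\<gamma> t)" "\<tau> k \<in> cotangent_space A (\<gamma> t)"
    "\<tau> j (e k) = (if j = k then 1 else 0)" for j k
    using df by (auto simp: dual_frame_def)
  have "v = (\<Sum>k\<in>UNIV. pull s t (\<tau> k) v *\<^sub>R push t s (e k))" if v: "v \<in> tangent_space A (\<gamma> s)" for v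
  proof -
    have "push s t v = (\<Sum>k\<in>UNIV. \<tau> k (push s t v) *\<^sub>R e k)"
      using df push_tangent[OF t] unfolding dual_frame_def by blast
    then have "push t s (push s t v) = push t s (\<Sum>k\<in>UNIV. \<tau> k (push s t v) *\<^sub>R e k)" by simp
    also have "\<dots> = (\<Sum>k\<in>UNIV. \<tau> k (push s t v) *\<^sub>R push t s (e k))"
      by (rule linear_on_sum[OF push_linear[OF t] subspace_tangent_space e(1)])
    finally show ?thesis using v by (simp add: push_comp[OF s t s] push_id[OF s v] pull_def)
  qed
  moreover have "pull s t (\<tau> j) (push t s (e k)) = (if j = k then 1 else 0)" for j k
    by (simp add: pull_def push_tangent[OF s] push_comp[OF t s t] push_id[OF t e(1)] e(3))
  ultimately show ?thesis
    using push_tangent[OF s] pull_cotangent[OF s t e(2)] unfolding dual_frame_def by blast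
qed

text \<open>The contraction at \<open>\<gamma> t\<close> sums over a coordinate frame there, which
  after carrying the arguments back is a frame at \<open>\<gamma> s\<close>, in general not a
  coordinate frame. Basis independence of the trace closes the gap.\<close>

lemma tensor_transport_contraction:
  assumes s: "s \<in> J" and t: "t \<in> J" and T: "T \<in> tensors A (\<gamma> s) p q" and ij: "i < p" "j < q"
  shows "tensor_transport s t (contraction A (\<gamma> s) i j T) = contraction A (\<gamma> t) i j (tensor_transport s t T)"
proof (intro ext)
  fix \<omega>s vs
  have some: "(SOME c. c \<in> A \<and> x \<in> fst c) \<in> A \<and> x \<in> fst (SOME c. c \<in> A \<and> x \<in> fst c)" for x
    by (rule someI_ex) (use ex_chart in blast)
  define c where "c = (SOME c. c \<in> A \<and> \<gamma> s \<in> fst c)"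
  define c' where "c' = (SOME c. c \<in> A \<and> \<gamma> t \<in> fst c)"
  have c: "c \<in> A" "\<gamma> s \<in> fst c" and c': "c' \<in> A" "\<gamma> t \<in> fst c'"
    using some unfolding c_def c'_def by blast+
  \<comment> \<open>Inserting members of the coordinate frame leaves admissibility unchanged, so the
    cutoff is the same for every summand.\<close>
  have adm: "admissible t (take i \<omega>s @ coord_covec A (\<gamma> t) c' k # drop i \<omega>s)
      (take j vs @ coord_vec A (\<gamma> t) c' k # drop j vs) \<longleftrightarrow> admissible t \<omega>s vs" for k
    using admissible_take_drop[of t \<omega>s vs i j] coord_covec_cotangent[of "\<gamma> t" c' k] coord_vec_tangent[OF c', of k]
    by (auto simp: admissible_def)
  show "tensor_transport s t (contraction A (\<gamma> s) i j T) \<omega>s vs =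
    contraction A (\<gamma> t) i j (tensor_transport s t T) \<omega>s vs"
  proof (cases "admissible t \<omega>s vs")
    case False
    then show ?thesis
      by (simp add: contraction_def Let_def tensor_transport_def adm flip: c'_def)
  next
    case True
    define \<omega>s' where "\<omega>s' = map (pull s t) \<omega>s"
    define vs' where "vs' = map (push t s) vs"
    have adm': "admissible s \<omega>s' vs'" unfolding \<omega>s'_def vs'_def by (rule admissible_map[OF s t True])
    then have sets: "set (take i \<omega>s') \<subseteq> cotangent_space A (\<gamma> s)" "set (drop i \<omega>s') \<subseteq> cotangent_space A (\<gamma> s)"
      "set (take j vs') \<subseteq> tangent_space A (\<gamma> s)" "set (drop j vs') \<subseteq> tangent_space A (\<gamma> s)"
      using admissible_take_drop[of s \<omega>s' vs' i j] by (auto simp: admissible_def)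
    define f where "f \<omega> v = T (take i \<omega>s' @ \<omega> # drop i \<omega>s') (take j vs' @ v # drop j vs')" for \<omega> v
    have "(\<Sum>k\<in>UNIV. f (pull s t (coord_covec A (\<gamma> t) c' k)) (push t s (coord_vec A (\<gamma> t) c' k)))
      = (\<Sum>k\<in>UNIV. f (coord_covec A (\<gamma> s) c k) (coord_vec A (\<gamma> s) c k))"
    proof (rule dual_frame_trace[OF dual_frame_coord[OF c] dual_frame_transport[OF s t dual_frame_coord[OF c']]])
      show "linear_on (cotangent_space A (\<gamma> s)) (\<lambda>\<omega>. f \<omega> v)" if "v \<in> tangent_space A (\<gamma> s)" for v
        unfolding f_def by (rule tensors_linear_covec_slot[OF T sets(1,2)]) (use sets that in auto)
      show "linear_on (tangent_space A (\<gamma> s)) (f \<omega>)" if "\<omega> \<in> cotangent_space A (\<gamma> s)" for \<omega>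
        unfolding f_def by (rule tensors_linear_vec_slot[OF T _ sets(3,4)]) (use sets that in auto)
    qed
    then show ?thesis
      using True
      by (simp add: contraction_def Let_def tensor_transport_def adm f_def \<omega>s'_def vs'_def take_map drop_map
          flip: c_def c'_def)
  qed
qed

lemma tensor_transport_scalar: "tensor_transport s t (scalar_tensor a) = scalar_tensor a"
  by (auto simp: tensor_transport_def scalar_tensor_def admissible_def fun_eq_iff)

lemma tensor_transport_comp:
  assumes "s \<in> J" "t \<in> J" "r \<in> J"
  shows "tensor_transport t r (tensor_transport s t T) = tensor_transport s r T"
  using admissible_map[OF assms(2,3)]
  by (auto simp: tensor_transport_def fun_eq_iff o_def pull_comp[OF assms] push_comp[OF assms(3,2,1)])

lemma tensor_transport_id:
  assumes s: "s \<in> J" and T: "T \<in> tensor_algebra A (\<gamma> s)"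
  shows "tensor_transport s s T = T"
proof (intro ext)
  fix \<omega>s vs
  show "tensor_transport s s T \<omega>s vs = T \<omega>s vs"
  proof (cases "admissible s \<omega>s vs")
    case True
    then have "map (pull s s) \<omega>s = \<omega>s" "map (push s s) vs = vs"
      by (auto intro!: map_idI pull_id[OF s] push_id[OF s] simp: admissible_def)
    then show ?thesis using True by (simp add: tensor_transport_def)
  next
    case False
    then show ?thesis
      using tensor_algebra_support[OF T, of \<omega>s vs] by (auto simp: tensor_transport_def admissible_def)
  qed
qed

text \<open>A C1 tensor field is tested against fields depending on the same single parameter,
  whereas the carried-back arguments also depend on the other one. Written as combinations of the
  frame at \<open>fst x\<close> with coefficients on \<open>J \<times> J\<close>, they are resolved
  slot by slot into genuine fields.\<close>

lemma tensor_field_multilinear_C1: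
  fixes a :: "('n \<Rightarrow> real \<times> real \<Rightarrow> real) list"
  assumes T: "c1_tensor_field A J \<gamma> T"
    and "\<forall>\<omega>\<in>set \<omega>s. c1_covector_field A J \<gamma> \<omega>" "\<forall>X\<in>set Xs. c1_vector_field A J \<gamma> X"
    and "\<forall>f\<in>set as. \<forall>i. C1_on (J \<times> J) (f i)" "\<forall>f\<in>set bs. \<forall>i. C1_on (J \<times> J) (f i)"
  shows "C1_on (J \<times> J) (\<lambda>x. T (fst x)
    (map (\<lambda>\<omega>. \<omega> (fst x)) \<omega>s @ map (\<lambda>f. \<Sum>i\<in>UNIV. f i x *\<^sub>R \<theta> (fst x) i) as)
    (map (\<lambda>X. X (fst x)) Xs @ map (\<lambda>f. \<Sum>i\<in>UNIV. f i x *\<^sub>R E i (fst x)) bs))"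
proof -
  let ?cov = "\<lambda>x f. \<Sum>i\<in>UNIV. f i x *\<^sub>R \<theta> (fst x) i"
  let ?vec = "\<lambda>x f. \<Sum>i\<in>UNIV. f i x *\<^sub>R E i (fst x)"
  have alg: "T s \<in> tensor_algebra A (\<gamma> s)" if "s \<in> J" for s
    using T that by (simp add: c1_tensor_field_def)
  have cov: "?cov x f \<in> cotangent_space A (\<gamma> (fst x))" if "x \<in> J \<times> J" for x f
    using that by (intro subspace_sum subspace_scale subspace_cotangent_space \<theta>_cotangent) auto
  have vec: "?vec x f \<in> tangent_space A (\<gamma> (fst x))" if "x \<in> J \<times> J" for x f
    using that by (intro subspace_sum subspace_scale subspace_tangent_space E_tangent) auto
  \<comment> \<open>The vector slots are expanded while all covector slots are still genuine fields;
    the covector slots follow in the outer induction.\<close>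
  have base: "C1_on (J \<times> J) (\<lambda>x. T (fst x) (map (\<lambda>\<omega>. \<omega> (fst x)) \<omega>s)
      (map (\<lambda>X. X (fst x)) Xs @ map (?vec x) bs))"
    if \<omega>s: "\<forall>\<omega>\<in>set \<omega>s. c1_covector_field A J \<gamma> \<omega>" and Xs: "\<forall>X\<in>set Xs. c1_vector_field A J \<gamma> X"
      and bs: "\<forall>f\<in>set bs. \<forall>i. C1_on (J \<times> J) (f i)" for \<omega>s Xs bs
    using Xs bs
  proof (induction bs arbitrary: Xs)
    case Nil
    have "C1_on J (\<lambda>s. T s (map (\<lambda>\<omega>. \<omega> s) \<omega>s) (map (\<lambda>X. X s) Xs))"
      using T \<omega>s Nil.prems(1) unfolding c1_tensor_field_def by blast
    from C1_on_fst[OF this] show ?case by simp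
  next
    case (Cons f bs)
    \<comment> \<open>By linearity the first combined slot turns into the field \<open>E i\<close>,
      which joins the end of \<open>Xs\<close>; hence the induction keeps \<open>Xs\<close>
      arbitrary.\<close>
    have "C1_on (J \<times> J) (\<lambda>x. \<Sum>i\<in>UNIV. f i x * T (fst x) (map (\<lambda>\<omega>. \<omega> (fst x)) \<omega>s)
      (map (\<lambda>X. X (fst x)) (Xs @ [E i]) @ map (?vec x) bs))"
      using Cons.prems by (intro C1_on_sum C1_on_mult Cons.IH) (auto simp: E_field)
    then show ?case
    proof (rule C1_on_cong[OF refl, THEN iffD2, rotated])
      fix x assume x: "x \<in> J \<times> J"
      then have s: "fst x \<in> J" by auto
      have sets: "set (map (\<lambda>\<omega>. \<omega> (fst x)) \<omega>s) \<subseteq> cotangent_space A (\<gamma> (fst x))"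
        "set (map (\<lambda>X. X (fst x)) Xs) \<subseteq> tangent_space A (\<gamma> (fst x))"
        "set (map (?vec x) bs) \<subseteq> tangent_space A (\<gamma> (fst x))"
        using \<omega>s Cons.prems(1) x vec[OF x] by (auto simp: c1_covector_field_def c1_vector_field_def)
      show "T (fst x) (map (\<lambda>\<omega>. \<omega> (fst x)) \<omega>s) (map (\<lambda>X. X (fst x)) Xs @ map (?vec x) (f # bs)) =
        (\<Sum>i\<in>UNIV. f i x * T (fst x) (map (\<lambda>\<omega>. \<omega> (fst x)) \<omega>s)
          (map (\<lambda>X. X (fst x)) (Xs @ [E i]) @ map (?vec x) bs))"
        using linear_on_sum[where I = UNIV and a = "\<lambda>i. f i x" and v = "\<lambda>i. E i (fst x)",
            OF tensor_algebra_linear_vec_slot[OF alg[OF s] sets] subspace_tangent_space E_tangent[OF s]] by simp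
    qed
  qed
  show ?thesis
    using assms(2,4)
  proof (induction as arbitrary: \<omega>s)
    case Nil
    then show ?case using base[OF Nil(1) assms(3,5)] by (simp only: list.map append.simps append_Nil2)
  next
    case (Cons f as)
    have "C1_on (J \<times> J) (\<lambda>x. \<Sum>i\<in>UNIV. f i x * T (fst x)
      (map (\<lambda>\<omega>. \<omega> (fst x)) (\<omega>s @ [\<lambda>s. \<theta> s i]) @ map (?cov x) as)
      (map (\<lambda>X. X (fst x)) Xs @ map (?vec x) bs))"
      using Cons.prems by (intro C1_on_sum C1_on_mult Cons.IH) (auto simp: \<theta>_field)
    then show ?case
    proof (rule C1_on_cong[OF refl, THEN iffD2, rotated])
      fix x assume x: "x \<in> J \<times> J"
      then have s: "fst x \<in> J" by auto
      have sets: "set (map (\<lambda>\<omega>. \<omega> (fst x)) \<omega>s) \<subseteq> cotangent_space A (\<gamma> (fst x))"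
        "set (map (?cov x) as) \<subseteq> cotangent_space A (\<gamma> (fst x))"
        "set (map (\<lambda>X. X (fst x)) Xs @ map (?vec x) bs) \<subseteq> tangent_space A (\<gamma> (fst x))"
        using Cons.prems(1) assms(3) x cov[OF x] vec[OF x]
        by (auto simp: c1_covector_field_def c1_vector_field_def)
      show "T (fst x) (map (\<lambda>\<omega>. \<omega> (fst x)) \<omega>s @ map (?cov x) (f # as)) (map (\<lambda>X. X (fst x)) Xs @ map (?vec x) bs) =
        (\<Sum>i\<in>UNIV. f i x * T (fst x) (map (\<lambda>\<omega>. \<omega> (fst x)) (\<omega>s @ [\<lambda>s. \<theta> s i]) @ map (?cov x) as)
          (map (\<lambda>X. X (fst x)) Xs @ map (?vec x) bs))"
        using linear_on_sum[where I = UNIV and a = "\<lambda>i. f i x" and v = "\<theta> (fst x)",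
            OF tensor_algebra_linear_covec_slot[OF alg[OF s] sets] subspace_cotangent_space \<theta>_cotangent[OF s]] by simp
    qed
  qed
qed

lemma H_C1_components: "C1_on (J \<times> J) (\<lambda>x. H (snd x) (fst x) $ i $ j)" "C1_on (J \<times> J) (\<lambda>x. H (fst x) (snd x) $ i $ j)"
proof -
  show 1: "C1_on (J \<times> J) (\<lambda>x. H (snd x) (fst x) $ i $ j)"
    using H_C1[of i j] by (simp add: case_prod_unfold)
  have "bounded_linear (\<lambda>x::real \<times> real. (snd x, fst x))"
    by (intro bounded_linear_Pair bounded_linear_snd bounded_linear_fst)
  moreover have "(\<lambda>x. (snd x, fst x)) ` (J \<times> J) \<subseteq> J \<times> J" by auto
  ultimately have "C1_on (J \<times> J) (\<lambda>x. H (snd (snd x, fst x)) (fst (snd x, fst x)) $ i $ j)"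
    by (intro C1_on_compose[OF 1] C1_on_linear)
  then show "C1_on (J \<times> J) (\<lambda>x. H (fst x) (snd x) $ i $ j)" by simp
qed

text \<open>Carrying the test fields back to \<open>\<gamma> s\<close> gives combinations of the
  frame at \<open>\<gamma> s\<close> whose coefficients are products of entries of \<open>H\<close>
  and frame components, hence C1 in both parameters.\<close>

lemma tensor_transport_C1:
  assumes T: "c1_tensor_field A J \<gamma> T" and \<omega>s: "\<forall>\<omega>\<in>set \<omega>s. c1_covector_field A J \<gamma> \<omega>"
    and Xs: "\<forall>X\<in>set Xs. c1_vector_field A J \<gamma> X"
  shows "C1_on (J \<times> J) (\<lambda>(s, t). tensor_transport s t (T s) (map (\<lambda>\<omega>. \<omega> t) \<omega>s) (map (\<lambda>X. X t) Xs))"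
proof -
  \<comment> \<open>\<open>a \<omega> j\<close> is the component of the pulled back covector along
    \<theta> j, found by evaluation on \<open>E j s\<close>; \<open>b X i\<close> below is the
    component along \<open>E i\<close> of the vector carried back.\<close>
  define a where "a \<omega> j x = (\<Sum>i\<in>UNIV. H (snd x) (fst x) $ i $ j * \<omega> (snd x) (E i (snd x)))"
    for \<omega> :: "real \<Rightarrow> ('m, 'n) covec" and j x
  define b where "b X i x = (\<Sum>j\<in>UNIV. H (fst x) (snd x) $ i $ j * \<theta> (snd x) j (X (snd x)))"
    for X :: "real \<Rightarrow> ('m, 'n) tvec" and i x
  have aC: "C1_on (J \<times> J) (a \<omega> j)" if "c1_covector_field A J \<gamma> \<omega>" for \<omega> j
    unfolding a_def
    by (intro C1_on_sum C1_on_mult H_C1_components C1_on_snd[where f = "\<lambda>s. \<omega> s (E i s)" for i])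
      (use that E_field in \<open>simp add: c1_covector_field_def\<close>)
  have bC: "C1_on (J \<times> J) (b X i)" if "c1_vector_field A J \<gamma> X" for X i
    unfolding b_def
    by (intro C1_on_sum C1_on_mult H_C1_components C1_on_snd[OF components_C1[OF that]])
  have "C1_on (J \<times> J) (\<lambda>x. T (fst x)
    (map (\<lambda>\<omega>. \<omega> (fst x)) [] @ map (\<lambda>f. \<Sum>i\<in>UNIV. f i x *\<^sub>R \<theta> (fst x) i) (map a \<omega>s))
    (map (\<lambda>X. X (fst x)) [] @ map (\<lambda>f. \<Sum>i\<in>UNIV. f i x *\<^sub>R E i (fst x)) (map b Xs)))"
    by (rule tensor_field_multilinear_C1[OF T]) (use \<omega>s Xs aC bC in auto)
  then show ?thesis
  proof (rule C1_on_cong[OF refl, THEN iffD2, rotated])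
    fix x assume "x \<in> J \<times> J"
    then obtain s t where x: "x = (s, t)" "s \<in> J" "t \<in> J" by blast
    have \<omega>t: "\<omega> t \<in> cotangent_space A (\<gamma> t)" if "\<omega> \<in> set \<omega>s" for \<omega>
      using \<omega>s that x(3) by (simp add: c1_covector_field_def)
    have Xt: "X t \<in> tangent_space A (\<gamma> t)" if "X \<in> set Xs" for X
      using Xs that x(3) by (simp add: c1_vector_field_def)
    have adm: "admissible t (map (\<lambda>\<omega>. \<omega> t) \<omega>s) (map (\<lambda>X. X t) Xs)"
      using \<omega>t Xt by (auto simp: admissible_def)
    have "pull s t (\<omega> t) = (\<Sum>i\<in>UNIV. a \<omega> i x *\<^sub>R \<theta> s i)" if "\<omega> \<in> set \<omega>s" for \<omega>
    proof -
      have "pull s t (\<omega> t) (E j s) = a \<omega> j x" for j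
      proof -
        have "push s t (E j s) = (\<Sum>i\<in>UNIV. H t s $ i $ j *\<^sub>R E i t)"
          by (simp add: push_def \<theta>_E[OF x(2)] if_distrib[of "\<lambda>x. _ * x"] cong: if_cong)
        then show ?thesis
          by (simp add: pull_def E_tangent[OF x(2)] a_def x(1)
              linear_on_sum[OF cotangent_linear[OF \<omega>t[OF that]] subspace_tangent_space E_tangent[OF x(3)]])
      qed
      then show ?thesis
        using dual_frame_covec[OF frame[OF x(2)] pull_cotangent[OF x(2,3) \<omega>t[OF that]]] by simp
    qed
    moreover have "push t s (X t) = (\<Sum>i\<in>UNIV. b X i x *\<^sub>R E i s)" for X
      by (simp add: push_def b_def x(1))
    ultimately show "(case x of (s, t) \<Rightarrow> tensor_transport s t (T s) (map (\<lambda>\<omega>. \<omega> t) \<omega>s) (map (\<lambda>X. X t) Xs)) =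
      T (fst x) (map (\<lambda>\<omega>. \<omega> (fst x)) [] @ map (\<lambda>f. \<Sum>i\<in>UNIV. f i x *\<^sub>R \<theta> (fst x) i) (map a \<omega>s))
        (map (\<lambda>X. X (fst x)) [] @ map (\<lambda>f. \<Sum>i\<in>UNIV. f i x *\<^sub>R E i (fst x)) (map b Xs))"
      using adm by (simp add: x(1) tensor_transport_def o_def cong: map_cong)
  qed
qed

lemma S_transport_tensor_transport: "S_transport A J \<gamma> tensor_transport"
  unfolding S_transport_def
proof (intro conjI ballI allI impI)
  fix s t assume s: "s \<in> J" and t: "t \<in> J"
  show "tensor_transport s t ` tensor_algebra A (\<gamma> s) \<subseteq> tensor_algebra A (\<gamma> t)"
    using tensor_transport_algebra[OF s t] by blast
  show "linear_on (tensor_algebra A (\<gamma> s)) (tensor_transport s t)" by (rule tensor_transport_linear)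
  show "tensor_transport s t ` tensors A (\<gamma> s) r q \<subseteq> tensors A (\<gamma> t) r q" for r q
    using tensor_transport_tensors[OF s t] by blast
  show "tensor_transport s t (tensor_prod T U) =
    tensor_prod (tensor_transport s t T) (tensor_transport s t U)" for T U by (rule tensor_transport_prod)
  show "tensor_transport s t (contraction A (\<gamma> s) i j T) = contraction A (\<gamma> t) i j (tensor_transport s t T)"
    if "T \<in> tensors A (\<gamma> s) r q" "i < r" "j < q" for r q i j T
    by (rule tensor_transport_contraction[OF s t that])
  show "tensor_transport s t (scalar_tensor a) = scalar_tensor a" for a by (rule tensor_transport_scalar)
  show "tensor_transport t r (tensor_transport s t T) = tensor_transport s r T" if "r \<in> J" for r T
    by (rule tensor_transport_comp[OF s t that])
next
  fix s T assume "s \<in> J" "T \<in> tensor_algebra A (\<gamma> s)"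
  then show "tensor_transport s s T = T" by (rule tensor_transport_id)
next
  fix T \<omega>s Xs
  assume "c1_tensor_field A J \<gamma> T" "\<forall>\<omega>\<in>set \<omega>s. c1_covector_field A J \<gamma> \<omega>" "\<forall>X\<in>set Xs. c1_vector_field A J \<gamma> X"
  then show "C1_on (J \<times> J) (\<lambda>(s, t). tensor_transport s t (T s) (map (\<lambda>\<omega>. \<omega> t) \<omega>s) (map (\<lambda>X. X t) Xs))"
    by (rule tensor_transport_C1)
qed

text \<open>Evaluating a vector on a pulled back covector is evaluating the covector on the pushed
  vector.\<close>

lemma vec_transport_tensor_transport:
  assumes s: "s \<in> J" and t: "t \<in> J" and v: "v \<in> tangent_space A (\<gamma> s)"
  shows "vec_transport A \<gamma> tensor_transport s t v = push s t v"
proof (rule vec_transport_eqI[OF push_tangent[OF t]], intro ext)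
  fix \<omega>s vs
  show "tensor_transport s t (vec_tensor A (\<gamma> s) v) \<omega>s vs = vec_tensor A (\<gamma> t) (push s t v) \<omega>s vs"
  proof (cases "vs = [] \<and> (\<exists>\<omega>\<in>cotangent_space A (\<gamma> t). \<omega>s = [\<omega>])")
    case True
    then show ?thesis
      using pull_cotangent[OF s t] v by (auto simp: tensor_transport_def admissible_def pull_def[of s t])
  next
    case False
    then show ?thesis
      by (auto simp: tensor_transport_def admissible_def vec_tensor_def map_eq_Cons_conv)
  qed
qed

text \<open>All difference quotients lie in the one tangent space at \<open>\<gamma> s\<close>, so
  convergence of their frame coefficients, which is the assumed derivative, is enough.\<close>

lemma has_coefficients_tensor_transport:
  assumes \<Gamma>: "\<And>s. s \<in> J \<Longrightarrow> (H s has_vector_derivative \<Gamma> s) (at s within J)"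
  shows "has_coefficients A J \<gamma> E tensor_transport \<Gamma>"
  unfolding has_coefficients_def
proof (intro ballI allI)
  fix s j assume s: "s \<in> J"
  let ?F = "at 0 within {\<epsilon>. s + \<epsilon> \<in> J}"
  \<comment> \<open>Continuous from coefficient vectors into the product topology, since each
    coordinate is a finite linear combination; it transports the limit of coefficients to a limit of
    tangent vectors.\<close>
  define \<Phi> :: "real^'n \<Rightarrow> ('m, 'n) tvec" where "\<Phi> x = (\<Sum>i\<in>UNIV. x $ i *\<^sub>R E i s)" for x
  have "continuous_on UNIV \<Phi>"
    unfolding \<Phi>_def
    by (rule continuous_on_coordinatewise_then_product) (simp add: sum_fun_apply continuous_intros)
  moreover have "((\<lambda>\<epsilon>. \<chi> i. (H s (s + \<epsilon>) $ i $ j - H s s $ i $ j) / \<epsilon>) \<longlongrightarrow> (\<chi> i. \<Gamma> s $ i $ j)) ?F"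
  proof (rule vec_tendstoI)
    fix i
    have "((\<lambda>r. H s r $ i $ j) has_real_derivative \<Gamma> s $ i $ j) (at s within J)"
      unfolding has_real_derivative_iff_has_vector_derivative
      by (intro bounded_linear.has_vector_derivative[OF bounded_linear_vec_nth] \<Gamma> s)
    from has_real_derivative_increment_limit[OF this]
    show "((\<lambda>\<epsilon>. (\<chi> i. (H s (s + \<epsilon>) $ i $ j - H s s $ i $ j) / \<epsilon>) $ i) \<longlongrightarrow> (\<chi> i. \<Gamma> s $ i $ j) $ i) ?F"
      by simp
  qed
  ultimately have "((\<lambda>\<epsilon>. \<Phi> (\<chi> i. (H s (s + \<epsilon>) $ i $ j - H s s $ i $ j) / \<epsilon>)) \<longlongrightarrow> \<Phi> (\<chi> i. \<Gamma> s $ i $ j)) ?F"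
    by (rule continuous_on_tendsto_compose) simp_all
  moreover have "\<Phi> (\<chi> i. (H s (s + \<epsilon>) $ i $ j - H s s $ i $ j) / \<epsilon>) =
      (1 / \<epsilon>) *\<^sub>R (vec_transport A \<gamma> tensor_transport (s + \<epsilon>) s (E j (s + \<epsilon>)) - E j s)"
    if \<epsilon>: "s + \<epsilon> \<in> J" for \<epsilon>
  proof -
    have "push (s + \<epsilon>) s (E j (s + \<epsilon>)) = (\<Sum>i\<in>UNIV. H s (s + \<epsilon>) $ i $ j *\<^sub>R E i s)"
      by (simp add: push_def \<theta>_E[OF \<epsilon>] if_distrib[of "\<lambda>x. _ * x"] cong: if_cong)
    moreover have "E j s = (\<Sum>i\<in>UNIV. H s s $ i $ j *\<^sub>R E i s)"
      by (simp add: H_id[OF s] mat_def if_distrib[of "\<lambda>x. x *\<^sub>R _"] cong: if_cong)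
    ultimately have "vec_transport A \<gamma> tensor_transport (s + \<epsilon>) s (E j (s + \<epsilon>)) - E j s =
        (\<Sum>i\<in>UNIV. (H s (s + \<epsilon>) $ i $ j - H s s $ i $ j) *\<^sub>R E i s)"
      by (simp add: vec_transport_tensor_transport[OF \<epsilon> s E_tangent[OF \<epsilon>]] sum_subtractf scaleR_diff_left)
    then show ?thesis by (simp add: \<Phi>_def scaleR_sum_right)
  qed
  then have "eventually (\<lambda>\<epsilon>. \<Phi> (\<chi> i. (H s (s + \<epsilon>) $ i $ j - H s s $ i $ j) / \<epsilon>) =
      (1 / \<epsilon>) *\<^sub>R (vec_transport A \<gamma> tensor_transport (s + \<epsilon>) s (E j (s + \<epsilon>)) - E j s)) ?F"
    by (auto simp: eventually_at_filter)
  ultimately have "((\<lambda>\<epsilon>. (1 / \<epsilon>) *\<^sub>R (vec_transport A \<gamma> tensor_transport (s + \<epsilon>) s (E j (s + \<epsilon>)) - E j s))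
      \<longlongrightarrow> \<Phi> (\<chi> i. \<Gamma> s $ i $ j)) ?F"
    by (rule Lim_transform_eventually)
  then show "((\<lambda>\<epsilon>. (1 / \<epsilon>) *\<^sub>R (vec_transport A \<gamma> tensor_transport (s + \<epsilon>) s (E j (s + \<epsilon>)) - E j s))
      \<longlongrightarrow> (\<Sum>i\<in>UNIV. (\<Gamma> s $ i $ j) *\<^sub>R E i s)) ?F"
    by (simp add: \<Phi>_def)
qed

end

context frame_along begin

text \<open>The product form \<open>X t ** Y s\<close> separates the parameters: joint regularity is
  immediate, and the cocycle law reduces to \<open>Y t ** X t = mat 1\<close>.\<close>

lemma transport_exists:
  assumes "continuous_on J \<Gamma>"
  shows "\<exists>S. S_transport A J \<gamma> S \<and> has_coefficients A J \<gamma> E S \<Gamma>"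
proof -
  obtain X Y :: "real \<Rightarrow> real^'n^'n" where XY: "\<forall>t\<in>J. X t ** Y t = mat 1 \<and> Y t ** X t = mat 1"
    and C1: "C1_on J X" "C1_on J Y" and Y: "\<forall>t\<in>J. (Y has_vector_derivative Y t ** \<Gamma> t) (at t within J)"
    using transition_matrices[OF nondegenerate assms] by (elim exE conjE) (rule that; assumption)
  define H where "H t s = X t ** Y s" for t s
  interpret frame_cocycle A J \<gamma> E H
  proof unfold_locales
    show "H r t ** H t s = H r s" if "r \<in> J" "s \<in> J" "t \<in> J" for r s t
    proof -
      have "H r t ** H t s = X r ** (Y t ** X t) ** Y s" by (simp add: H_def matrix_mul_assoc)
      then show ?thesis using XY that by (simp add: H_def)
    qed
    show "H s s = mat 1" if "s \<in> J" for s using XY that by (simp add: H_def)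
    show "C1_on (J \<times> J) (\<lambda>(s, t). H t s $ i $ j)" for i j
    proof -
      have "C1_on (J \<times> J) (\<lambda>x. \<Sum>k\<in>UNIV. X (snd x) $ i $ k * Y (fst x) $ k $ j)"
        by (intro C1_on_sum C1_on_mult C1_on_vec_nth
            C1_on_compose[OF C1(1) C1_on_linear[OF bounded_linear_snd]]
            C1_on_compose[OF C1(2) C1_on_linear[OF bounded_linear_fst]]) auto
      then show ?thesis by (simp add: H_def matrix_matrix_mult_def case_prod_unfold)
    qed
  qed
  have "(H s has_vector_derivative \<Gamma> s) (at s within J)" if s: "s \<in> J" for s
  proof -
    \<comment> \<open>At \<open>r = s\<close> the factors \<open>X s\<close> and \<open>Y s\<close>
      cancel, leaving \<Gamma>.\<close>
    have "((\<lambda>r. X s ** Y r) has_vector_derivative X s ** (Y s ** \<Gamma> s) + 0 ** Y s) (at s within J)"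
      by (intro has_vector_derivative_matrix_mult has_vector_derivative_const bspec[OF Y s])
    then show ?thesis using XY s by (simp add: H_def[abs_def] matrix_mul_assoc)
  qed
  then show ?thesis using S_transport_tensor_transport has_coefficients_tensor_transport by blast
qed

end

section \<open>Consistency\<close>

context frame_along begin

lemma consistent_iff_form:
  assumes g: "c1_metric A g"
    and diag: "orthogonally_diagonalised J (metric_matrix g \<gamma> E) D d"
  defines "G \<equiv> metric_matrix g \<gamma> E"
  shows "s \<in> J \<Longrightarrow> transpose (K_matrix J G D s) = K_matrix J G D s"
    and "S_transport A J \<gamma> S \<Longrightarrow> has_coefficients A J \<gamma> E S \<Gamma> \<Longrightarrow>
      consistent_along A g J \<gamma> S \<longleftrightarrow> (\<forall>s\<in>J. consistent_form (G s) (D s) (d s) (K_matrix J G D s) (\<Gamma> s))"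
proof -
  define G' where "G' s = vector_derivative G (at s within J)" for s
  have G: "(G has_vector_derivative G' s) (at s within J)" if "s \<in> J" for s
    using metric_matrix_C1[OF g] that unfolding C1_on_real_iff G_def G'_def
    by (metis differentiableI_vector vector_derivative_works)
  have Gsym: "transpose (G s) = G s" if "s \<in> J" for s
    using g E_tangent[OF that] by (simp add: symmetric_matrix_nth G_def metric_matrix_def c1_metric_def)
  \<comment> \<open>Transposition commutes with differentiation, and the derivative within
    \<open>J\<close> is unique.\<close>
  have G'sym: "transpose (G' s) = G' s" if s: "s \<in> J" for s
  proof -
    have "(G has_vector_derivative transpose (G' s)) (at s within J)"
      by (rule has_vector_derivative_transform[OF s _ has_vector_derivative_transpose[OF G[OF s]]])
        (simp add: Gsym)
    then show ?thesis
      using vector_derivative_unique_within[OF nondegenerate_interval_trivial_limit[OF nondegenerate s]] G[OF s]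
      by blast
  qed
  have K: "K_matrix J G D s = transpose (D s) ** G' s ** D s" for s
    by (simp add: K_matrix_def G'_def)
  show "s \<in> J \<Longrightarrow> transpose (K_matrix J G D s) = K_matrix J G D s"
    by (simp add: K matrix_transpose_mul G'sym matrix_mul_assoc)
  assume S: "S_transport A J \<gamma> S" and \<Gamma>: "has_coefficients A J \<gamma> E S \<Gamma>"
  have "consistent_along A g J \<gamma> S \<longleftrightarrow> (\<forall>s\<in>J. G' s = transpose (\<Gamma> s) ** G s + G s ** \<Gamma> s)"
    unfolding consistent_along_iff_matrix[OF S g, folded G_def]
    by (rule matrix_cocycle_isometry_iff[OF nondegenerate])
      (use transport_matrix_comp[OF S] transport_matrix_id[OF S] coefficients_derivative(2)[OF S \<Gamma>]
        transport_matrix_differentiable[OF S] G in auto)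
  also have "\<dots> \<longleftrightarrow> (\<forall>s\<in>J. consistent_form (G s) (D s) (d s) (K_matrix J G D s) (\<Gamma> s))"
  proof (rule ball_cong[OF refl])
    fix s assume s: "s \<in> J"
    have "orthogonal_matrix (D s)" "transpose (D s) ** G s ** D s = diag_matrix (d s)" "\<And>i. d s $ i \<noteq> 0"
      using diag s by (auto simp: orthogonally_diagonalised_def G_def)
    from consistent_form_iff[OF this G'sym[OF s], of "\<Gamma> s"]
    show "G' s = transpose (\<Gamma> s) ** G s + G s ** \<Gamma> s \<longleftrightarrow>
      consistent_form (G s) (D s) (d s) (K_matrix J G D s) (\<Gamma> s)"
      by (simp add: K)
  qed
  finally show "consistent_along A g J \<gamma> S \<longleftrightarrow>
    (\<forall>s\<in>J. consistent_form (G s) (D s) (d s) (K_matrix J G D s) (\<Gamma> s))" .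
qed

text \<open>Continuity of \<Gamma> is a consequence of being the coefficients of some transport, and
  in the other direction it is what allows a transport to be constructed.\<close>

lemma consistent_transport_exists_iff:
  assumes g: "c1_metric A g"
    and diag: "orthogonally_diagonalised J (metric_matrix g \<gamma> E) D d"
  defines "G \<equiv> metric_matrix g \<gamma> E"
  shows "(\<exists>S. S_transport A J \<gamma> S \<and> has_coefficients A J \<gamma> E S \<Gamma> \<and> consistent_along A g J \<gamma> S) \<longleftrightarrow>
    continuous_on J \<Gamma> \<and> (\<forall>s\<in>J. consistent_form (G s) (D s) (d s) (K_matrix J G D s) (\<Gamma> s))"
  using consistent_iff_form(2)[OF g diag, folded G_def] coefficients_derivative(1) transport_exists
  by metis

end

theorem proposition3p6:
  fixes A :: "('m::{t2_space, second_countable_topology}, 'n::finite) chart set"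
    and g :: "'m \<Rightarrow> ('m, 'n) tensor"
    and J :: "real set" and \<gamma> :: "real \<Rightarrow> 'm"
    and E :: "'n \<Rightarrow> real \<Rightarrow> ('m, 'n) tvec"
    and G D :: "real \<Rightarrow> real ^ 'n ^ 'n" and d :: "real \<Rightarrow> real ^ 'n"
  assumes "c2_atlas A"
    and "c1_metric A g"
    and "c1_path A J \<gamma>"
    and "c1_basis A J \<gamma> E"
    and "G = metric_matrix g \<gamma> E"
    and "\<forall>s\<in>J. \<forall>t\<in>J. matrix_signature (G s) = matrix_signature (G t)"
    and "orthogonally_diagonalised J G D d"
  shows
    "(\<forall>s\<in>J. transpose (K_matrix J G D s) = K_matrix J G D s) \<and>
     (\<forall>\<Gamma>. (\<exists>S. S_transport A J \<gamma> S \<and> has_coefficients A J \<gamma> E S \<Gamma> \<and>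
              consistent_along A g J \<gamma> S) \<longleftrightarrow>
       continuous_on J \<Gamma> \<and>
       (\<forall>s\<in>J. consistent_form (G s) (D s) (d s) (K_matrix J G D s) (\<Gamma> s))) \<and>
     (\<forall>S \<Gamma>. S_transport A J \<gamma> S \<longrightarrow> has_coefficients A J \<gamma> E S \<Gamma> \<longrightarrow>
       (consistent_along A g J \<gamma> S \<longleftrightarrow>
        (\<forall>s\<in>J. consistent_form (G s) (D s) (d s) (K_matrix J G D s) (\<Gamma> s)))) \<and>
     (\<forall>EE GG DD dd.
       (\<forall>(I, \<beta>)\<in>c1_paths A.
          c1_basis A I \<beta> (EE (I, \<beta>)) \<and>
          GG (I, \<beta>) = metric_matrix g \<beta> (EE (I, \<beta>)) \<and>
          (\<forall>s\<in>I. \<forall>t\<in>I. matrix_signature (GG (I, \<beta>) s) = matrix_signature (GG (I, \<beta>) t)) \<and>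
          orthogonally_diagonalised I (GG (I, \<beta>)) (DD (I, \<beta>)) (dd (I, \<beta>))) \<longrightarrow>
       (\<forall>\<Gamma>. (\<exists>S. (\<forall>(I, \<beta>)\<in>c1_paths A. S_transport A I \<beta> (S (I, \<beta>)) \<and>
                    has_coefficients A I \<beta> (EE (I, \<beta>)) (S (I, \<beta>)) (\<Gamma> (I, \<beta>))) \<and>
                globally_consistent A g S) \<longleftrightarrow>
         (\<forall>(I, \<beta>)\<in>c1_paths A. continuous_on I (\<Gamma> (I, \<beta>)) \<and>
           (\<forall>s\<in>I. consistent_form (GG (I, \<beta>) s) (DD (I, \<beta>) s) (dd (I, \<beta>) s)
                     (K_matrix I (GG (I, \<beta>)) (DD (I, \<beta>)) s) (\<Gamma> (I, \<beta>) s)))) \<and>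
       (\<forall>S \<Gamma>. (\<forall>(I, \<beta>)\<in>c1_paths A. S_transport A I \<beta> (S (I, \<beta>)) \<and>
                    has_coefficients A I \<beta> (EE (I, \<beta>)) (S (I, \<beta>)) (\<Gamma> (I, \<beta>))) \<longrightarrow>
         (globally_consistent A g S \<longleftrightarrow>
         (\<forall>(I, \<beta>)\<in>c1_paths A. \<forall>s\<in>I.
            consistent_form (GG (I, \<beta>) s) (DD (I, \<beta>) s) (dd (I, \<beta>) s)
              (K_matrix I (GG (I, \<beta>)) (DD (I, \<beta>)) s) (\<Gamma> (I, \<beta>) s)))))"
proof (intro conjI)
  have frame_path: "frame_along A I \<beta> e" if "c1_path A I \<beta>" "c1_basis A I \<beta> e" for I \<beta> e
    by unfold_locales (fact assms(1) that)+
  interpret frame_along A J \<gamma> E by (rule frame_path) (fact assms(3,4))+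
  note diag = assms(7)[unfolded assms(5)]
  show "\<forall>s\<in>J. transpose (K_matrix J G D s) = K_matrix J G D s"
    unfolding assms(5) using consistent_iff_form(1)[OF assms(2) diag] by blast
  show "\<forall>\<Gamma>. (\<exists>S. S_transport A J \<gamma> S \<and> has_coefficients A J \<gamma> E S \<Gamma> \<and> consistent_along A g J \<gamma> S) \<longleftrightarrow>
      continuous_on J \<Gamma> \<and> (\<forall>s\<in>J. consistent_form (G s) (D s) (d s) (K_matrix J G D s) (\<Gamma> s))"
    unfolding assms(5) using consistent_transport_exists_iff[OF assms(2) diag] by blast
  show "\<forall>S \<Gamma>. S_transport A J \<gamma> S \<longrightarrow> has_coefficients A J \<gamma> E S \<Gamma> \<longrightarrow>
      (consistent_along A g J \<gamma> S \<longleftrightarrow>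
       (\<forall>s\<in>J. consistent_form (G s) (D s) (d s) (K_matrix J G D s) (\<Gamma> s)))"
    unfolding assms(5) using consistent_iff_form(2)[OF assms(2) diag] by blast
  show "\<forall>EE GG DD dd.
       (\<forall>(I, \<beta>)\<in>c1_paths A.
          c1_basis A I \<beta> (EE (I, \<beta>)) \<and>
          GG (I, \<beta>) = metric_matrix g \<beta> (EE (I, \<beta>)) \<and>
          (\<forall>s\<in>I. \<forall>t\<in>I. matrix_signature (GG (I, \<beta>) s) = matrix_signature (GG (I, \<beta>) t)) \<and>
          orthogonally_diagonalised I (GG (I, \<beta>)) (DD (I, \<beta>)) (dd (I, \<beta>))) \<longrightarrow>
       (\<forall>\<Gamma>. (\<exists>S. (\<forall>(I, \<beta>)\<in>c1_paths A. S_transport A I \<beta> (S (I, \<beta>)) \<and>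
                    has_coefficients A I \<beta> (EE (I, \<beta>)) (S (I, \<beta>)) (\<Gamma> (I, \<beta>))) \<and>
                globally_consistent A g S) \<longleftrightarrow>
         (\<forall>(I, \<beta>)\<in>c1_paths A. continuous_on I (\<Gamma> (I, \<beta>)) \<and>
           (\<forall>s\<in>I. consistent_form (GG (I, \<beta>) s) (DD (I, \<beta>) s) (dd (I, \<beta>) s)
                     (K_matrix I (GG (I, \<beta>)) (DD (I, \<beta>)) s) (\<Gamma> (I, \<beta>) s)))) \<and>
       (\<forall>S \<Gamma>. (\<forall>(I, \<beta>)\<in>c1_paths A. S_transport A I \<beta> (S (I, \<beta>)) \<and>
                    has_coefficients A I \<beta> (EE (I, \<beta>)) (S (I, \<beta>)) (\<Gamma> (I, \<beta>))) \<longrightarrow>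
         (globally_consistent A g S \<longleftrightarrow>
         (\<forall>(I, \<beta>)\<in>c1_paths A. \<forall>s\<in>I.
            consistent_form (GG (I, \<beta>) s) (DD (I, \<beta>) s) (dd (I, \<beta>) s)
              (K_matrix I (GG (I, \<beta>)) (DD (I, \<beta>)) s) (\<Gamma> (I, \<beta>) s))))"
  proof (intro allI impI conjI)
    fix EE :: "real set \<times> (real \<Rightarrow> 'm) \<Rightarrow> 'n \<Rightarrow> real \<Rightarrow> ('m, 'n) tvec"
      and GG DD :: "real set \<times> (real \<Rightarrow> 'm) \<Rightarrow> real \<Rightarrow> real^'n^'n"
      and dd :: "real set \<times> (real \<Rightarrow> 'm) \<Rightarrow> real \<Rightarrow> real^'n"
    assume *: "\<forall>(I, \<beta>)\<in>c1_paths A.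
          c1_basis A I \<beta> (EE (I, \<beta>)) \<and>
          GG (I, \<beta>) = metric_matrix g \<beta> (EE (I, \<beta>)) \<and>
          (\<forall>s\<in>I. \<forall>t\<in>I. matrix_signature (GG (I, \<beta>) s) = matrix_signature (GG (I, \<beta>) t)) \<and>
          orthogonally_diagonalised I (GG (I, \<beta>)) (DD (I, \<beta>)) (dd (I, \<beta>))"
    \<comment> \<open>Pairs \<open>(I, \<beta>)\<close> are handled as single points
      \<open>x\<close>, so that the results for one path apply directly and choices can be made path
      by path.\<close>
    define form where "form \<Gamma> x \<longleftrightarrow> (\<forall>s\<in>fst x. consistent_form (GG x s) (DD x s) (dd x s)
        (K_matrix (fst x) (GG x) (DD x)  s) (\<Gamma> x s))" for \<Gamma> x
    define transport where "transport S \<Gamma> x \<longleftrightarrow> S_transport A (fst x) (snd x) S \<and>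
        has_coefficients A (fst x) (snd x) (EE x) S (\<Gamma> x)" for S \<Gamma> x
    have path: "frame_along A (fst x) (snd x) (EE x)" "GG x = metric_matrix g (snd x) (EE x)"
      "orthogonally_diagonalised (fst x) (metric_matrix g (snd x) (EE x)) (DD x) (dd x)"
      if "x \<in> c1_paths A" for x
      using bspec[OF * that] that by (auto simp: c1_paths_def intro!: frame_path)
    have consistent: "consistent_along A g (fst x) (snd x) S \<longleftrightarrow> form \<Gamma> x"
      if "x \<in> c1_paths A" "transport S \<Gamma> x" for x S \<Gamma>
      using frame_along.consistent_iff_form(2)[OF path(1)[OF that(1)] assms(2) path(3)[OF that(1)]] that
      unfolding form_def path(2)[OF that(1)] transport_def by blast
    have exists: "(\<exists>S. transport S \<Gamma> x \<and> consistent_along A g (fst x) (snd x) S) \<longleftrightarrow>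
        continuous_on (fst x) (\<Gamma> x) \<and> form \<Gamma> x" if "x \<in> c1_paths A" for x \<Gamma>
      using frame_along.consistent_transport_exists_iff[OF path(1)[OF that] assms(2) path(3)[OF that]]
      unfolding form_def path(2)[OF that] transport_def by (simp add: conj_assoc)
    have global: "globally_consistent A g S \<longleftrightarrow> (\<forall>x\<in>c1_paths A. consistent_along A g (fst x) (snd x) (S x))" for S
      by (simp add: globally_consistent_def case_prod_unfold)
    show "(\<exists>S. (\<forall>(I, \<beta>)\<in>c1_paths A. S_transport A I \<beta> (S (I, \<beta>)) \<and>
                    has_coefficients A I \<beta> (EE (I, \<beta>)) (S (I, \<beta>)) (\<Gamma> (I, \<beta>))) \<and>
                globally_consistent A g S) \<longleftrightarrow>
         (\<forall>(I, \<beta>)\<in>c1_paths A. continuous_on I (\<Gamma> (I, \<beta>)) \<and>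
           (\<forall>s\<in>I. consistent_form (GG (I, \<beta>) s) (DD (I, \<beta>) s) (dd (I, \<beta>) s)
                     (K_matrix I (GG (I, \<beta>)) (DD (I, \<beta>)) s) (\<Gamma> (I, \<beta>) s)))" for \<Gamma>
    proof -
      \<comment> \<open>Transports along different paths obey no common condition, so a global
        transport amounts to an independent choice for each path.\<close>
      have "(\<exists>S. (\<forall>x\<in>c1_paths A. transport (S x) \<Gamma> x) \<and> globally_consistent A g S) \<longleftrightarrow>
        (\<forall>x\<in>c1_paths A. \<exists>S. transport S \<Gamma> x \<and> consistent_along A g (fst x) (snd x) S)"
        unfolding global bchoice_iff by blast
      also have "\<dots> \<longleftrightarrow> (\<forall>x\<in>c1_paths A. continuous_on (fst x) (\<Gamma> x) \<and> form \<Gamma> x)"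
        using exists by simp
      finally show ?thesis by (simp add: transport_def form_def case_prod_unfold)
    qed
    show "globally_consistent A g S \<longleftrightarrow>
         (\<forall>(I, \<beta>)\<in>c1_paths A. \<forall>s\<in>I.
            consistent_form (GG (I, \<beta>) s) (DD (I, \<beta>) s) (dd (I, \<beta>) s)
              (K_matrix I (GG (I, \<beta>)) (DD (I, \<beta>)) s) (\<Gamma> (I, \<beta>) s))"
      if tr: "\<forall>(I, \<beta>)\<in>c1_paths A. S_transport A I \<beta> (S (I, \<beta>)) \<and>
                    has_coefficients A I \<beta> (EE (I, \<beta>)) (S (I, \<beta>)) (\<Gamma> (I, \<beta>))" for S \<Gamma>
    proof -
      have "consistent_along A g (fst x) (snd x) (S x) \<longleftrightarrow> form \<Gamma> x" if "x \<in> c1_paths A" for x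
        using consistent[OF that, of "S x" \<Gamma>] bspec[OF tr that] by (simp add: transport_def case_prod_unfold)
      then have "globally_consistent A g S \<longleftrightarrow> (\<forall>x\<in>c1_paths A. form \<Gamma> x)"
        unfolding global by (rule ball_cong[OF refl])
      then show ?thesis by (simp add: form_def case_prod_unfold)
    qed
  qed
qed

end
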